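(* Let $X$, the orders $n_j$, the function space $\mathcal F_X$ (rapidly decreasing case, or $T$-periodic case with a fixed unitary Bloch multiplier $\varkappa\in S^1$) and the product $\langle\cdot,\cdot\rangle$ be as defined in the context. Then $\langle\cdot,\cdot\rangle$ is well-defined on $\mathcal F_X$ by the regularized integral, and it is an indefinite inner product with exactly $$l_X=\sum_{j=1}^{N} l_{n_j},\qquad l_{n_j}=\left[\frac{n_j+1}{2}\right]$$ negative squares; in the periodic case this holds for each $\varkappa\in S^1$.
   Context: $[\cdot]$ denotes the integer part. Fix points and orders $n_j\in\mathbb Z_+$ as follows. Rapidly decreasing case: $X=\{x_1,\dots,x_N\}\subset\mathbb R$ is a finite set with orders $n_1,\dots,n_N$. Periodic case: $x_1,\dots,x_N$ are distinct points modulo a period $T>0$, with orders $n_1,\dots,n_N$, $X$ is the set of all their shifts by $T\mathbb Z$ (a shifted point has the same order), and a number $\varkappa\in\mathbb C$, $|\varkappa|=1$, is fixed. The space $\mathcal F_X$ consists of complex-valued functions $\Psi$ that are $C^\infty$ on $\mathbb R\setminus X$ and such that near every $x_j\in X$, with $y=x-x_j$, $$\Psi=\sum_{k=0}^{n_j} a_{jk}\,y^{-(n_j-2k)}+O(y^{n_j+1})$$ for some constants $a_{jk}\in\mathbb C$. In the periodic case one requires in addition $\Psi(x+T)=\varkappa\Psi(x)$; in the rapidly decreasing case one requires rapid decay of $\Psi$ as $|x|\to\infty$. The product is $\langle\Psi_1,\Psi_2\rangle=\int\Psi_1(x)\overline{\Psi_2(\bar x)}\,dx$, over one period $[0,T]$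 (or any period with endpoints outside $X$) in the periodic case and over $\mathbb R$ in the rapidly decreasing case, where the integration path goes around the singular points in the complex domain. Precisely: near $x_j$ the integrand is $\sum_{m\ge1} b_{m}\,y^{-2m}$ (finite sum, even powers only, hence zero residue) plus a bounded function; the bounded part is integrated in the usual way, and each polar term is integrated along a path avoiding $y=0$ in $\mathbb C$, i.e. $\int_{-\delta}^{\delta}y^{-2m}dy:=-\frac{2}{2m-1}\delta^{1-2m}$. A Hermitian form has exactly $l$ negative squares if $l$ is the maximal dimension of a subspace on which the form is negative definite. *)

theory Defs
  imports "HOL-Analysis.Analysis" "HOL-Library.Function_Algebras"
begin

section \<open>The function spaces\<close>

definition smooth_on :: "real set \<Rightarrow> (real \<Rightarrow> complex) \<Rightarrow> bool" where
  "smooth_on S \<Psi> \<longleftrightarrow>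
     (\<forall>k. \<forall>t\<in>S. ((\<lambda>f s. vector_derivative f (at s)) ^^ k) \<Psi> differentiable (at t))"

definition singular_expansion :: "(real \<Rightarrow> complex) \<Rightarrow> real \<Rightarrow> nat \<Rightarrow> bool" where
  "singular_expansion \<Psi> p d \<longleftrightarrow>
     (\<exists>a :: nat \<Rightarrow> complex.
        (\<lambda>t. \<Psi> t - (\<Sum>k=0..d. a k * complex_of_real (t - p) powi (- (int d - 2 * int k))))
          \<in> O[at p](\<lambda>t. complex_of_real (t - p) ^ (d + 1)))"

definition decreasing_points :: "nat \<Rightarrow> (nat \<Rightarrow> real) \<Rightarrow> real set" where
  "decreasing_points N x = x ` {1..N}"

definition periodic_points :: "nat \<Rightarrow> (nat \<Rightarrow> real) \<Rightarrow> real \<Rightarrow> real set" where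
  "periodic_points N x T = {x j + of_int m * T | j m. j \<in> {1..N}}"

definition distinct_mod :: "nat \<Rightarrow> (nat \<Rightarrow> real) \<Rightarrow> real \<Rightarrow> bool" where
  "distinct_mod N x T \<longleftrightarrow>
     (\<forall>i\<in>{1..N}. \<forall>j\<in>{1..N}. i \<noteq> j \<longrightarrow> (\<forall>m::int. x i - x j \<noteq> of_int m * T))"

definition rapidly_decreasing :: "(real \<Rightarrow> complex) \<Rightarrow> bool" where
  "rapidly_decreasing \<Psi> \<longleftrightarrow>
     (\<forall>k::nat. ((\<lambda>t. complex_of_real t ^ k * \<Psi> t) \<longlongrightarrow> 0) at_infinity)"

text \<open>The elements of the spaces are functions on the complement of the singular set \<open>X\<close>.
  They are represented by total functions with the dummy value \<open>0\<close> on \<open>X\<close>, so that equality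
  of representatives is equality on the complement of \<open>X\<close>.\<close>

definition F_decreasing :: "nat \<Rightarrow> (nat \<Rightarrow> real) \<Rightarrow> (nat \<Rightarrow> nat) \<Rightarrow> (real \<Rightarrow> complex) set" where
  "F_decreasing N x n =
     {\<Psi>. smooth_on (- decreasing_points N x) \<Psi>
        \<and> (\<forall>t\<in>decreasing_points N x. \<Psi> t = 0)
        \<and> (\<forall>j\<in>{1..N}. singular_expansion \<Psi> (x j) (n j))
        \<and> rapidly_decreasing \<Psi>}"

definition F_periodic ::
  "nat \<Rightarrow> (nat \<Rightarrow> real) \<Rightarrow> (nat \<Rightarrow> nat) \<Rightarrow> real \<Rightarrow> complex \<Rightarrow> (real \<Rightarrow> complex) set" where
  "F_periodic N x n T \<kappa> =
     {\<Psi>. smooth_on (- periodic_points N x T) \<Psi>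
        \<and> (\<forall>t\<in>periodic_points N x T. \<Psi> t = 0)
        \<and> (\<forall>j\<in>{1..N}. \<forall>m::int. singular_expansion \<Psi> (x j + of_int m * T) (n j))
        \<and> (\<forall>t. \<Psi> (t + T) = \<kappa> * \<Psi> t)}"


section \<open>The regularized integral\<close>

text \<open>\<open>S\<close> is the domain of integration and \<open>P\<close> the finite set of singular points in it.\<close>

definition admissible_radius :: "real set \<Rightarrow> real set \<Rightarrow> real \<Rightarrow> bool" where
  "admissible_radius S P \<delta> \<longleftrightarrow>
     0 < \<delta> \<and> (\<forall>p\<in>P. {p - \<delta>..p + \<delta>} \<subseteq> S)
     \<and> (\<forall>p\<in>P. \<forall>q\<in>P. p \<noteq> q \<longrightarrow> {p - \<delta>..p + \<delta>} \<inter> {q - \<delta>..q + \<delta>} = {})"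

definition polar_part :: "(nat \<Rightarrow> complex) \<Rightarrow> nat \<Rightarrow> real \<Rightarrow> complex" where
  "polar_part b M y = (\<Sum>m=1..M. b m * complex_of_real y powi (- 2 * int m))"

text \<open>The integral of \<open>y\<^sup>-\<^sup>2\<^sup>m\<close> from \<open>-\<delta>\<close> to \<open>\<delta>\<close> along a path
  that avoids \<open>y = 0\<close> in the complex domain is \<open>-2 / (2m - 1) \<cdot> \<delta>\<^sup>1\<^sup>-\<^sup>2\<^sup>m\<close>.\<close>

definition polar_integral :: "(nat \<Rightarrow> complex) \<Rightarrow> nat \<Rightarrow> real \<Rightarrow> complex" where
  "polar_integral b M \<delta> =
     (\<Sum>m=1..M. b m * complex_of_real (- 2 / (2 * real m - 1) * \<delta> powi (1 - 2 * int m)))"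

definition regularized_value ::
  "(real \<Rightarrow> complex) \<Rightarrow> real set \<Rightarrow> real set \<Rightarrow> real \<Rightarrow> complex \<Rightarrow> bool" where
  "regularized_value f S P \<delta> I \<longleftrightarrow>
     (\<exists>(M :: real \<Rightarrow> nat) (b :: real \<Rightarrow> nat \<Rightarrow> complex).
        let outer = S - (\<Union>p\<in>P. {p - \<delta>..p + \<delta>});
            rest = (\<lambda>p t. f t - polar_part (b p) (M p) (t - p))
        in f absolutely_integrable_on outer
         \<and> (\<forall>p\<in>P. bounded (rest p ` ({p - \<delta>..p + \<delta>} - {p}))
                  \<and> rest p absolutely_integrable_on {p - \<delta>..p + \<delta>})
         \<and> I = integral outer f
             + (\<Sum>p\<in>P. integral {p - \<delta>..p + \<delta>} (rest p) + polar_integral (b p) (M p) \<delta>))"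

text \<open>Every admissible radius has to give the value \<open>I\<close>, and no other value, for
  whatever choice of the polar parts.\<close>

definition has_regularized_integral ::
  "(real \<Rightarrow> complex) \<Rightarrow> real set \<Rightarrow> real set \<Rightarrow> complex \<Rightarrow> bool" where
  "has_regularized_integral f S P I \<longleftrightarrow>
     finite P \<and> (\<exists>\<delta>. admissible_radius S P \<delta>)
     \<and> (\<forall>\<delta>. admissible_radius S P \<delta> \<longrightarrow> {J. regularized_value f S P \<delta> J} = {I})"


section \<open>The products\<close>

text \<open>The arguments are functions of a real variable, for which
  \<open>cnj (\<Psi>\<^sub>2 (cnj t)) = cnj (\<Psi>\<^sub>2 t)\<close>.\<close>

definition has_product_decreasing ::
  "nat \<Rightarrow> (nat \<Rightarrow> real) \<Rightarrow> (real \<Rightarrow> complex) \<Rightarrow> (real \<Rightarrow> complex) \<Rightarrow> complex \<Rightarrow> bool" where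
  "has_product_decreasing N x \<Psi>\<^sub>1 \<Psi>\<^sub>2 I \<longleftrightarrow>
     has_regularized_integral (\<lambda>t. \<Psi>\<^sub>1 t * cnj (\<Psi>\<^sub>2 t)) UNIV (decreasing_points N x) I"

text \<open>Every period with endpoints outside the singular set has to give the same value.\<close>

definition has_product_periodic ::
  "nat \<Rightarrow> (nat \<Rightarrow> real) \<Rightarrow> real \<Rightarrow> (real \<Rightarrow> complex) \<Rightarrow> (real \<Rightarrow> complex) \<Rightarrow> complex \<Rightarrow> bool" where
  "has_product_periodic N x T \<Psi>\<^sub>1 \<Psi>\<^sub>2 I \<longleftrightarrow>
     (\<forall>c. c \<notin> periodic_points N x T \<longrightarrow>
        has_regularized_integral (\<lambda>t. \<Psi>\<^sub>1 t * cnj (\<Psi>\<^sub>2 t)) {c..c + T}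
          (periodic_points N x T \<inter> {c..c + T}) I)"

definition product_decreasing ::
  "nat \<Rightarrow> (nat \<Rightarrow> real) \<Rightarrow> (real \<Rightarrow> complex) \<Rightarrow> (real \<Rightarrow> complex) \<Rightarrow> complex" where
  "product_decreasing N x \<Psi>\<^sub>1 \<Psi>\<^sub>2 = (THE I. has_product_decreasing N x \<Psi>\<^sub>1 \<Psi>\<^sub>2 I)"

definition product_periodic ::
  "nat \<Rightarrow> (nat \<Rightarrow> real) \<Rightarrow> real \<Rightarrow> (real \<Rightarrow> complex) \<Rightarrow> (real \<Rightarrow> complex) \<Rightarrow> complex" where
  "product_periodic N x T \<Psi>\<^sub>1 \<Psi>\<^sub>2 = (THE I. has_product_periodic N x T \<Psi>\<^sub>1 \<Psi>\<^sub>2 I)"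


section \<open>Indefinite inner products and negative squares\<close>

definition cscale :: "complex \<Rightarrow> (real \<Rightarrow> complex) \<Rightarrow> real \<Rightarrow> complex" where
  "cscale c \<Psi> = (\<lambda>t. c * \<Psi> t)"

interpretation cfun: vector_space cscale
  by unfold_locales (auto simp: cscale_def fun_eq_iff algebra_simps)

definition hermitian_form ::
  "(real \<Rightarrow> complex) set \<Rightarrow> ((real \<Rightarrow> complex) \<Rightarrow> (real \<Rightarrow> complex) \<Rightarrow> complex) \<Rightarrow> bool" where
  "hermitian_form F ip \<longleftrightarrow>
     (\<forall>\<Psi>\<in>F. \<forall>\<Phi>\<in>F. \<forall>\<Omega>\<in>F. ip (\<Psi> + \<Phi>) \<Omega> = ip \<Psi> \<Omega> + ip \<Phi> \<Omega>)
     \<and> (\<forall>c. \<forall>\<Psi>\<in>F. \<forall>\<Phi>\<in>F. ip (cscale c \<Psi>) \<Phi> = c * ip \<Psi> \<Phi>)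
     \<and> (\<forall>\<Psi>\<in>F. \<forall>\<Phi>\<in>F. ip \<Phi> \<Psi> = cnj (ip \<Psi> \<Phi>))"

definition indefinite_inner_product ::
  "(real \<Rightarrow> complex) set \<Rightarrow> ((real \<Rightarrow> complex) \<Rightarrow> (real \<Rightarrow> complex) \<Rightarrow> complex) \<Rightarrow> bool" where
  "indefinite_inner_product F ip \<longleftrightarrow>
     cfun.subspace F \<and> hermitian_form F ip
     \<and> (\<forall>\<Psi>\<in>F. (\<forall>\<Phi>\<in>F. ip \<Psi> \<Phi> = 0) \<longrightarrow> \<Psi> = 0)"

definition takes_both_signs ::
  "(real \<Rightarrow> complex) set \<Rightarrow> ((real \<Rightarrow> complex) \<Rightarrow> (real \<Rightarrow> complex) \<Rightarrow> complex) \<Rightarrow> bool" where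
  "takes_both_signs F ip \<longleftrightarrow> (\<exists>\<Psi>\<in>F. 0 < Re (ip \<Psi> \<Psi>)) \<and> (\<exists>\<Psi>\<in>F. Re (ip \<Psi> \<Psi>) < 0)"

definition negative_definite_subspace ::
  "(real \<Rightarrow> complex) set \<Rightarrow> ((real \<Rightarrow> complex) \<Rightarrow> (real \<Rightarrow> complex) \<Rightarrow> complex) \<Rightarrow>
   (real \<Rightarrow> complex) set \<Rightarrow> bool" where
  "negative_definite_subspace F ip V \<longleftrightarrow>
     cfun.subspace V \<and> V \<subseteq> F \<and> (\<forall>\<Psi>\<in>V. \<Psi> \<noteq> 0 \<longrightarrow> Re (ip \<Psi> \<Psi>) < 0)"

text \<open>\<open>cfun.dim\<close> is \<open>0\<close> on infinite-dimensional spaces, hence the explicit finite basis.\<close>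

definition has_dimension :: "(real \<Rightarrow> complex) set \<Rightarrow> nat \<Rightarrow> bool" where
  "has_dimension V d \<longleftrightarrow>
     (\<exists>B. finite B \<and> cfun.independent B \<and> cfun.span B = V \<and> card B = d)"

definition has_negative_squares ::
  "(real \<Rightarrow> complex) set \<Rightarrow> ((real \<Rightarrow> complex) \<Rightarrow> (real \<Rightarrow> complex) \<Rightarrow> complex) \<Rightarrow> nat \<Rightarrow> bool" where
  "has_negative_squares F ip l \<longleftrightarrow>
     (\<exists>V. negative_definite_subspace F ip V \<and> has_dimension V l)
     \<and> (\<forall>V. negative_definite_subspace F ip V \<longrightarrow> (\<exists>d\<le>l. has_dimension V d))"

definition l_order :: "nat \<Rightarrow> nat" where
  "l_order k = nat \<lfloor>(real k + 1) / 2\<rfloor>"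

definition l_total :: "nat \<Rightarrow> (nat \<Rightarrow> nat) \<Rightarrow> nat" where
  "l_total N n = (\<Sum>j=1..N. l_order (n j))"

end

theory Submission
  imports Defs
begin

text \<open>A product of two expansions at a singular point has only even powers up to a bounded error,
  which makes the regularized integral well-defined and independent of the radii and of the period.
  The form is nonnegative on the functions without negative powers, a subspace of codimension
  \<open>\<Sum> l_order (n j)\<close>, and this bounds the number of negative squares from above. Conversely,
  let \<open>q\<close> be a combination of the negative powers and \<open>\<eta>\<close> a cutoff with values in \<open>[0, 1]\<close> that
  is \<open>1\<close> near the singular point. As the regularized integral of \<open>|q|\<^sup>2\<close> over the whole line is
  \<open>0\<close>, the square of \<open>q \<eta>\<close> is the integral of \<open>|q|\<^sup>2 (\<eta>\<^sup>2 - 1)\<close>, which is negative.\<close>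

section \<open>Smooth functions\<close>

text \<open>\<open>l_order d\<close> counts the negative exponents among -d, -d + 2, ..., d, and one
  index inequality carries the argument: two indices below \<open>l_order d\<close> add up to less
  than d, two indices at or above it to at least d. Hence |q|^2 equals its own polar part exactly,
  without bounded remainder, while a function without negative powers has a square without pole. The
  primitive of y^(-2m) tends to 0 at infinity, which is why the regularized integral of |q|^2 over
  the line is 0. At a finite radius it is formally minus the integral over the outside. This outside
  yields strict negativity; inside, the cutoff gives only a weak inequality. Cutoffs with disjoint
  supports let the singular points contribute separately. The obstacle is that the value is defined
  through choices: polar parts, radius and, in the periodic case, the period. Boundedness of the
  remainders pins down the polar parts. Radii and periods are compared by rewriting the value as an
  ordinary integral of one modified function, which can be taken T-periodic in the periodic
  case.\<close>

primrec times_diff :: "nat \<Rightarrow> real set \<Rightarrow> (real \<Rightarrow> complex) \<Rightarrow> bool" where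
  "times_diff 0 U f \<longleftrightarrow> True"
| "times_diff (Suc k) U f \<longleftrightarrow>
     (\<exists>f'. (\<forall>t\<in>U. (f has_vector_derivative f' t) (at t)) \<and> times_diff k U f')"

lemma times_diff_cong:
  assumes "open U" "\<And>t. t \<in> U \<Longrightarrow> f t = g t"
  shows "times_diff k U f \<Longrightarrow> times_diff k U g"
proof (cases k)
  case (Suc m)
  assume "times_diff k U f"
  then obtain f' where f': "\<And>t. t \<in> U \<Longrightarrow> (f has_vector_derivative f' t) (at t)"
      "times_diff m U f'"
    using Suc by auto
  have "(g has_vector_derivative f' t) (at t)" if "t \<in> U" for t
    using has_vector_derivative_transform_within_open[OF f'(1)[OF that] assms(1) that] assms(2)
    by auto
  then show "times_diff k U g"
    using f'(2) Suc by auto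
qed simp

lemma times_diff_mono:
  "times_diff (Suc k) U f \<Longrightarrow> times_diff k U f"
  by (induction k arbitrary: f) fastforce+

lemma times_diff_funpow:
  assumes "open U" "times_diff (i + k) U f"
  shows "times_diff k U (((\<lambda>f s. vector_derivative f (at s)) ^^ i) f)"
  using assms(2)
proof (induction i arbitrary: k)
  case (Suc i)
  let ?g = "((\<lambda>f s. vector_derivative f (at s)) ^^ i) f"
  have "times_diff (Suc k) U ?g"
    using Suc.IH[of "Suc k"] Suc.prems by (simp only: add_Suc add_Suc_right)
  then obtain g' where g': "\<And>t. t \<in> U \<Longrightarrow> (?g has_vector_derivative g' t) (at t)"
      "times_diff k U g'"
    by auto
  show ?case
    using times_diff_cong[OF assms(1) vector_derivative_at[OF g'(1), symmetric] g'(2)]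
    by simp
qed simp

text \<open>\<open>smooth_on\<close> iterates a total derivative operator, awkward for products and
  quotients. \<open>times_diff\<close> asks only for some derivative on the set, so closure
  properties follow by induction on the order.\<close>

lemma smooth_on_iff_times_diff:
  assumes "open U"
  shows "smooth_on U f \<longleftrightarrow> (\<forall>k. times_diff k U f)"
proof (intro iffI allI)
  fix k
  assume "smooth_on U f"
  then show "times_diff k U f"
  proof (induction k arbitrary: f)
    case (Suc k)
    let ?g = "\<lambda>s. vector_derivative f (at s)"
    have "smooth_on U ?g"
      unfolding smooth_on_def
    proof (intro allI ballI)
      fix k t
      assume "t \<in> U"
      then show "((\<lambda>f s. vector_derivative f (at s)) ^^ k) ?g differentiable at t"
        using Suc.prems[unfolded smooth_on_def, rule_format, of t "Suc k"]
        by (simp only: funpow_Suc_right o_def simp_thms)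
    qed
    moreover have "f differentiable at t" if "t \<in> U" for t
      using Suc.prems[unfolded smooth_on_def, rule_format, OF that, of 0] by simp
    ultimately show ?case
      using Suc.IH[of ?g] unfolding times_diff.simps
      by (intro exI[of _ ?g]) (simp flip: vector_derivative_works)
  qed simp
next
  assume *: "\<forall>k. times_diff k U f"
  show "smooth_on U f"
    unfolding smooth_on_def
  proof (intro allI ballI)
    fix k t
    assume "t \<in> U"
    have "times_diff (Suc 0) U (((\<lambda>f s. vector_derivative f (at s)) ^^ k) f)"
      using times_diff_funpow[OF assms] * by blast
    then show "((\<lambda>f s. vector_derivative f (at s)) ^^ k) f differentiable at t"
      using \<open>t \<in> U\<close> differentiableI_vector by fastforce
  qed
qed

lemma times_diff_add:
  "times_diff k U f \<Longrightarrow> times_diff k U g \<Longrightarrow>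
   times_diff k U (\<lambda>t. f t + g t)"
proof (induction k arbitrary: f g)
  case (Suc k)
  obtain f' g' where "\<forall>t\<in>U. (f has_vector_derivative f' t) (at t)" "times_diff k U f'"
    "\<forall>t\<in>U. (g has_vector_derivative g' t) (at t)" "times_diff k U g'"
    using Suc.prems by auto
  then show ?case
    using Suc.IH by (auto intro!: exI[of _ "\<lambda>t. f' t + g' t"] derivative_intros)
qed simp

lemma times_diff_const: "times_diff k U (\<lambda>_. c)"
  by (induction k arbitrary: c) (auto intro!: derivative_eq_intros exI[of _ "\<lambda>_. 0"])

lemma times_diff_mult:
  "times_diff k U f \<Longrightarrow> times_diff k U g \<Longrightarrow>
   times_diff k U (\<lambda>t. f t * g t)"
proof (induction k arbitrary: f g)
  case (Suc k)
  obtain f' g' where *: "\<forall>t\<in>U. (f has_vector_derivative f' t) (at t)" "times_diff k U f'"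
    "\<forall>t\<in>U. (g has_vector_derivative g' t) (at t)" "times_diff k U g'"
    using Suc.prems by auto
  have "times_diff k U (\<lambda>t. f t * g' t + f' t * g t)"
    using Suc times_diff_mono *
    by (intro times_diff_add) blast+
  then show ?case
    using * by (auto intro!: exI[of _ "\<lambda>t. f t * g' t + f' t * g t"] has_vector_derivative_mult)
qed simp

text \<open>The derivative -f' / f^2 contains 1 / f again, but only to the order that the induction
  hypothesis supplies.\<close>

lemma times_diff_inverse:
  "times_diff k U f \<Longrightarrow> (\<forall>t\<in>U. f t \<noteq> 0) \<Longrightarrow>
   times_diff k U (\<lambda>t. inverse (f t))"
proof (induction k)
  case (Suc k)
  obtain f' where f': "\<forall>t\<in>U. (f has_vector_derivative f' t) (at t)" "times_diff k U f'"
    using Suc.prems by auto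
  have inv: "times_diff k U (\<lambda>t. inverse (f t))"
    using Suc times_diff_mono by blast
  have "times_diff k U (\<lambda>t. (- 1) * (f' t * (inverse (f t) * inverse (f t))))"
    by (intro times_diff_mult times_diff_const f' inv)
  moreover have "((\<lambda>t. inverse (f t)) has_vector_derivative
      (- 1) * (f' t * (inverse (f t) * inverse (f t)))) (at t)" if "t \<in> U" for t
    using field_vector_diff_chain_at[of f "f' t" t inverse "- (inverse (f t) * inverse (f t))"]
      f'(1) Suc.prems(2) that DERIV_inverse[of "f t"]
    by (auto simp: o_def power2_eq_square algebra_simps)
  ultimately show ?case
    by (auto intro!: exI[of _ "\<lambda>t. (- 1) * (f' t * (inverse (f t) * inverse (f t)))"])
qed simp

lemma smooth_on_subset: "smooth_on U f \<Longrightarrow> V \<subseteq> U \<Longrightarrow> smooth_on V f"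
  by (auto simp: smooth_on_def)

text \<open>Nothing has to be glued: \<open>smooth_on\<close> constrains the iterated derivatives at
  each point separately.\<close>

lemma smooth_on_local:
  assumes "\<And>t. t \<in> V \<Longrightarrow> \<exists>U. t \<in> U \<and> smooth_on U f"
  shows "smooth_on V f"
  using assms unfolding smooth_on_def by blast

lemma smooth_on_cong:
  assumes "open U" "smooth_on U f" "\<And>t. t \<in> U \<Longrightarrow> f t = g t"
  shows "smooth_on U g"
  using assms times_diff_cong unfolding smooth_on_iff_times_diff[OF assms(1)]
  by blast

lemma smooth_on_const: "smooth_on U (\<lambda>_. c)"
  using smooth_on_subset[of UNIV] smooth_on_iff_times_diff[of UNIV]
    times_diff_const by auto

lemma smooth_on_add:
  "open U \<Longrightarrow> smooth_on U f \<Longrightarrow> smooth_on U g \<Longrightarrow> smooth_on U (\<lambda>t. f t + g t)"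
  by (simp add: smooth_on_iff_times_diff times_diff_add)

lemma smooth_on_mult:
  "open U \<Longrightarrow> smooth_on U f \<Longrightarrow> smooth_on U g \<Longrightarrow> smooth_on U (\<lambda>t. f t * g t)"
  by (simp add: smooth_on_iff_times_diff times_diff_mult)

lemma smooth_on_inverse:
  "open U \<Longrightarrow> smooth_on U f \<Longrightarrow> (\<And>t. t \<in> U \<Longrightarrow> f t \<noteq> 0) \<Longrightarrow>
   smooth_on U (\<lambda>t. inverse (f t))"
  by (simp add: smooth_on_iff_times_diff times_diff_inverse)

lemma times_diff_affine:
  "times_diff k U f \<Longrightarrow> \<sigma> \<noteq> 0 \<Longrightarrow>
   times_diff k {t. \<sigma> * t + a \<in> U} (\<lambda>t. f (\<sigma> * t + a))"
proof (induction k arbitrary: f)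
  case (Suc k)
  obtain f' where f': "\<forall>t\<in>U. (f has_vector_derivative f' t) (at t)" "times_diff k U f'"
    using Suc.prems by auto
  have "((\<lambda>t. f (\<sigma> * t + a)) has_vector_derivative complex_of_real \<sigma> * f' (\<sigma> * t + a)) (at t)"
    if "\<sigma> * t + a \<in> U" for t
  proof -
    have "((\<lambda>t. \<sigma> * t + a) has_vector_derivative \<sigma>) (at t)"
      by (auto simp flip: has_real_derivative_iff_has_vector_derivative
          intro!: derivative_eq_intros)
    then show ?thesis
      using vector_diff_chain_at[of "\<lambda>t. \<sigma> * t + a" \<sigma> t f "f' (\<sigma> * t + a)"] f'(1) that
      by (simp add: o_def scaleR_conv_of_real)
  qed
  then show ?case
    using times_diff_mult[OF times_diff_const Suc.IH[OF f'(2)]] Suc.prems(2)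
    by (auto intro!: exI[of _ "\<lambda>t. complex_of_real \<sigma> * f' (\<sigma> * t + a)"])
qed simp

lemma smooth_on_affine:
  assumes "open U" "smooth_on U f" "\<sigma> \<noteq> 0"
  shows "smooth_on {t. \<sigma> * t + a \<in> U} (\<lambda>t. f (\<sigma> * t + a))"
proof -
  have "open ((\<lambda>t. \<sigma> * t + a) -` U)"
    using assms(1) by (intro open_vimage) (auto intro!: continuous_intros)
  then have "open {t. \<sigma> * t + a \<in> U}"
    by (simp add: vimage_def)
  then show ?thesis
    using assms times_diff_affine by (simp add: smooth_on_iff_times_diff)
qed

lemma smooth_on_powi: "smooth_on (- {p}) (\<lambda>t. complex_of_real (t - p) powi e)"
proof -
  have "times_diff k (- {p}) (\<lambda>t. complex_of_real (t - p) powi e)" for k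
  proof (induction k arbitrary: e)
    case (Suc k)
    have "((\<lambda>t. complex_of_real (t - p) powi e) has_vector_derivative
        of_int e * complex_of_real (t - p) powi (e - 1)) (at t)" if "t \<noteq> p" for t
    proof -
      have "((\<lambda>t. complex_of_real (t - p)) has_vector_derivative 1) (at t)"
        by (auto intro!: derivative_eq_intros)
      moreover have "((\<lambda>z. z powi e) has_field_derivative
          of_int e * complex_of_real (t - p) powi (e - 1)) (at (complex_of_real (t - p)))"
        using that by (auto intro!: derivative_eq_intros)
      ultimately show ?thesis
        using field_vector_diff_chain_at[of "\<lambda>t. complex_of_real (t - p)" 1 t "\<lambda>z. z powi e"]
        by (simp add: o_def)
    qed
    moreover have "times_diff k (- {p})
        (\<lambda>t. of_int e * complex_of_real (t - p) powi (e - 1))"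
      by (intro times_diff_mult times_diff_const Suc)
    ultimately show ?case
      unfolding times_diff.simps
      by (intro exI[of _ "\<lambda>t. of_int e * complex_of_real (t - p) powi (e - 1)"]) blast
  qed simp
  then show ?thesis
    by (simp add: smooth_on_iff_times_diff open_Compl)
qed

lemma smooth_on_imp_continuous_on: "smooth_on U f \<Longrightarrow> continuous_on U f"
  unfolding smooth_on_def
  by (metis (no_types, lifting) continuous_at_imp_continuous_on differentiable_imp_continuous_within
      funpow_0)

section \<open>Flat functions, bumps and cutoffs\<close>

definition flat_exp :: "nat \<Rightarrow> real \<Rightarrow> real" where
  "flat_exp m t = (if 0 < t then exp (- inverse t) * inverse t ^ m else 0)"

lemma flat_exp_tendsto_0: "((\<lambda>t. flat_exp m t) \<longlongrightarrow> 0) (at 0)"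
proof -
  \<comment> \<open>With u = 1 / t this is u^m / exp u as u tends to infinity.\<close>
  have "((\<lambda>t. exp (- inverse t) * inverse t ^ m) \<longlongrightarrow> 0) (at_right (0::real))"
    using filterlim_compose[OF tendsto_power_div_exp_0[of m] filterlim_inverse_at_top_right]
    by (simp add: exp_minus divide_simps mult.commute)
  then have "(flat_exp m \<longlongrightarrow> 0) (at_right 0)"
    by (rule Lim_transform_eventually)
      (auto simp: flat_exp_def eventually_at_filter intro!: always_eventually)
  moreover have "(flat_exp m \<longlongrightarrow> 0) (at_left 0)"
    by (rule Lim_transform_eventually[OF tendsto_const])
      (auto simp: flat_exp_def eventually_at_filter intro!: always_eventually)
  ultimately show ?thesis
    using filterlim_split_at by blast
qed

text \<open>The factor t^(-m) is carried along because differentiation of exp (-1 / t) produces such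
  factors; the whole family is closed under it up to linear combinations, so one induction gives
  smoothness.\<close>

lemma flat_exp_has_derivative:
  "(flat_exp m has_real_derivative flat_exp (m + 2) t - real m * flat_exp (m + 1) t) (at t)"
proof -
  consider "t > 0" | "t < 0" | "t = 0"
    by linarith
  then show ?thesis
  proof cases
    case 1
    have "((\<lambda>t. exp (- inverse t) * inverse t ^ m) has_real_derivative
        flat_exp (m + 2) t - real m * flat_exp (m + 1) t) (at t)"
    proof -
      have "((\<lambda>t. inverse t ^ m) has_real_derivative - (real m * inverse t ^ (m + 1))) (at t)"
        using DERIV_power[OF DERIV_inverse[of t UNIV], of m] 1
        by (cases m) (auto simp: algebra_simps power2_eq_square)
      then have "((\<lambda>t. exp (- inverse t) * inverse t ^ m) has_real_derivative
          exp (- inverse t) * inverse t ^ 2 * inverse t ^ m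
          + - (real m * inverse t ^ (m + 1)) * exp (- inverse t)) (at t)"
        using 1 by (intro DERIV_mult)
          (auto intro!: derivative_eq_intros simp: power2_eq_square)
      then show ?thesis
        using 1 by (simp add: flat_exp_def power2_eq_square algebra_simps)
    qed
    then show ?thesis
      by (rule has_field_derivative_transform_within[where d = t]) (use 1 in \<open>auto simp: flat_exp_def dist_real_def\<close>)
  next
    case 2
    have "((\<lambda>t. 0) has_real_derivative 0) (at t)"
      by simp
    then have "(flat_exp m has_real_derivative 0) (at t)"
      by (rule has_field_derivative_transform_within[where d = "- t"])
        (use 2 in \<open>auto simp: flat_exp_def dist_real_def\<close>)
    then show ?thesis
      using 2 by (simp add: flat_exp_def)
  next
    case 3
    \<comment> \<open>The difference quotient at 0 is a member of the same family, with index
      \<open>Suc m\<close>.\<close>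
    have "((\<lambda>h. flat_exp m h / h) \<longlongrightarrow> 0) (at 0)"
      using flat_exp_tendsto_0[of "Suc m"]
      by (rule Lim_transform_eventually) (auto simp: flat_exp_def divide_inverse)
    then show ?thesis
      using 3 by (simp add: DERIV_def flat_exp_def)
  qed
qed

lemma smooth_on_flat_exp: "smooth_on UNIV (\<lambda>t. complex_of_real (flat_exp m t))"
proof -
  have "times_diff k UNIV (\<lambda>t. complex_of_real (flat_exp m t))" for k
  proof (induction k arbitrary: m)
    case (Suc k)
    have "times_diff k UNIV (\<lambda>t. complex_of_real (flat_exp (m + 2) t)
        + (- of_nat m) * complex_of_real (flat_exp (m + 1) t))"
      by (intro times_diff_add times_diff_mult times_diff_const Suc)
    moreover have "((\<lambda>t. complex_of_real (flat_exp m t)) has_vector_derivative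
        complex_of_real (flat_exp (m + 2) t)
        + (- of_nat m) * complex_of_real (flat_exp (m + 1) t)) (at t)" for t
      using has_vector_derivative_of_real[OF flat_exp_has_derivative[of m t]] by simp
    ultimately show ?case
      unfolding times_diff.simps
      by (intro exI[of _ "\<lambda>t. complex_of_real (flat_exp (m + 2) t)
        + (- of_nat m) * complex_of_real (flat_exp (m + 1) t)"]) blast
  qed simp
  then show ?thesis
    by (simp add: smooth_on_iff_times_diff)
qed

lemma smooth_bump:
  obtains \<beta> :: "real \<Rightarrow> real" where "smooth_on UNIV (\<lambda>t. complex_of_real (\<beta> t))"
    "\<And>t. \<bar>t - a\<bar> < r \<Longrightarrow> 0 < \<beta> t" "\<And>t. r \<le> \<bar>t - a\<bar> \<Longrightarrow> \<beta> t = 0"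
proof
  \<comment> \<open>The first factor is positive exactly for t > a - r, the second exactly for t < a
    + r.\<close>
  let ?\<beta> = "\<lambda>t. flat_exp 0 (t + (r - a)) * flat_exp 0 (- t + (r + a))"
  show "smooth_on UNIV (\<lambda>t. complex_of_real (?\<beta> t))"
    using smooth_on_mult[OF open_UNIV, of "\<lambda>t. complex_of_real (flat_exp 0 (t + (r - a)))"
        "\<lambda>t. complex_of_real (flat_exp 0 (- t + (r + a)))"]
      smooth_on_affine[OF open_UNIV smooth_on_flat_exp, of 1 "r - a" 0]
      smooth_on_affine[OF open_UNIV smooth_on_flat_exp, of "- 1" "r + a" 0]
    by simp
qed (auto simp: flat_exp_def)

text \<open>The cutoff is \<beta> / (\<beta> + \<gamma>), where \<beta> is positive exactly for |t|
  < r and \<gamma> exactly for |t| > r / 2. The two sets cover the line, so the denominator never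
  vanishes.\<close>

lemma smooth_cutoff:
  assumes "0 < r"
  obtains \<eta> :: "real \<Rightarrow> real" where "smooth_on UNIV (\<lambda>t. complex_of_real (\<eta> t))"
    "\<And>t. 0 \<le> \<eta> t \<and> \<eta> t \<le> 1" "\<And>t. \<bar>t\<bar> \<le> r / 2 \<Longrightarrow> \<eta> t = 1" "\<And>t. r \<le> \<bar>t\<bar> \<Longrightarrow> \<eta> t = 0"
proof -
  obtain \<beta> :: "real \<Rightarrow> real" where \<beta>: "smooth_on UNIV (\<lambda>t. complex_of_real (\<beta> t))"
    "\<And>t. \<bar>t - 0\<bar> < r \<Longrightarrow> 0 < \<beta> t" "\<And>t. r \<le> \<bar>t - 0\<bar> \<Longrightarrow> \<beta> t = 0"
    by (rule smooth_bump[where a = 0 and r = r]) blast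
  define \<gamma> where "\<gamma> = (\<lambda>t. flat_exp 0 (t + (- r / 2)) + flat_exp 0 (- t + (- r / 2)))"
  have \<gamma>: "smooth_on UNIV (\<lambda>t. complex_of_real (\<gamma> t))"
    using smooth_on_add[OF open_UNIV, of "\<lambda>t. complex_of_real (flat_exp 0 (t + (- r / 2)))"
        "\<lambda>t. complex_of_real (flat_exp 0 (- t + (- r / 2)))"]
      smooth_on_affine[OF open_UNIV smooth_on_flat_exp, of 1 "- r / 2" 0]
      smooth_on_affine[OF open_UNIV smooth_on_flat_exp, of "- 1" "- r / 2" 0]
    by (simp add: \<gamma>_def)
  have \<gamma>0: "0 \<le> \<gamma> t" "r / 2 < \<bar>t\<bar> \<Longrightarrow> 0 < \<gamma> t" "\<bar>t\<bar> \<le> r / 2 \<Longrightarrow> \<gamma> t = 0" for t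
    by (auto simp: \<gamma>_def flat_exp_def add_pos_nonneg add_nonneg_pos)
  have \<beta>0: "0 \<le> \<beta> t" for t
    using \<beta>(2,3)[of t] by force
  have pos: "0 < \<beta> t + \<gamma> t" for t
  proof (cases "\<bar>t\<bar> < r")
    case True
    then show ?thesis
      using \<beta>(2)[of t] \<gamma>0(1)[of t] by simp
  next
    case False
    then show ?thesis
      using \<beta>0[of t] \<gamma>0(2)[of t] assms by simp
  qed
  show thesis
  proof
    have "smooth_on UNIV (\<lambda>t. complex_of_real (\<beta> t) *
        inverse (complex_of_real (\<beta> t) + complex_of_real (\<gamma> t)))"
      using pos by (intro smooth_on_mult smooth_on_inverse smooth_on_add \<beta> \<gamma>)
        (auto simp flip: of_real_add simp: less_imp_neq[symmetric])
    then show "smooth_on UNIV (\<lambda>t. complex_of_real (\<beta> t * inverse (\<beta> t + \<gamma> t)))"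
      by simp
    show "0 \<le> \<beta> t * inverse (\<beta> t + \<gamma> t) \<and> \<beta> t * inverse (\<beta> t + \<gamma> t) \<le> 1" for t
      using pos[of t] \<beta>0[of t] \<gamma>0(1)[of t] by (auto simp: field_simps)
    show "\<beta> t * inverse (\<beta> t + \<gamma> t) = 1" if "\<bar>t\<bar> \<le> r / 2" for t
      using \<gamma>0(3)[OF that] pos[of t] by simp
    show "\<beta> t * inverse (\<beta> t + \<gamma> t) = 0" if "r \<le> \<bar>t\<bar>" for t
      using \<beta>(3)[of t] that by simp
  qed
qed

section \<open>Singular expansions\<close>

definition singular_sum :: "(nat \<Rightarrow> complex) \<Rightarrow> nat \<Rightarrow> real \<Rightarrow> complex" where
  "singular_sum a d y = (\<Sum>k=0..d. a k * complex_of_real y powi (- (int d - 2 * int k)))"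

definition has_expansion :: "(real \<Rightarrow> complex) \<Rightarrow> real \<Rightarrow> nat \<Rightarrow> (nat \<Rightarrow> complex) \<Rightarrow> bool" where
  "has_expansion \<Psi> p d a \<longleftrightarrow>
     (\<lambda>t. \<Psi> t - singular_sum a d (t - p)) \<in> O[at p](\<lambda>t. complex_of_real (t - p) ^ (d + 1))"

text \<open>The exponents of two factors add up to -2 (d - j - k), so the pairs with j + k + m = d
  form the coefficient of y^(-2m). Writing the condition as a sum avoids truncated
  subtraction.\<close>

definition product_coeff :: "nat \<Rightarrow> (nat \<Rightarrow> complex) \<Rightarrow> (nat \<Rightarrow> complex) \<Rightarrow> nat \<Rightarrow> complex" where
  "product_coeff d a b m =
     (\<Sum>j=0..d. \<Sum>k=0..d. if j + k + m = d then a j * cnj (b k) else 0)"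

lemma singular_expansion_iff: "singular_expansion \<Psi> p d \<longleftrightarrow> (\<exists>a. has_expansion \<Psi> p d a)"
  by (simp add: singular_expansion_def has_expansion_def singular_sum_def)

section \<open>Order estimates at a point and uniqueness of coefficients\<close>

lemma eventually_at_neq: "eventually (\<lambda>t. t - p \<noteq> 0) (at (p::real))"
  by (simp add: eventually_at_filter)

lemma bigo_tendsto_zero:
  fixes f g :: "real \<Rightarrow> complex"
  assumes "f \<in> O[F](g)" "(g \<longlongrightarrow> 0) F"
  shows "(f \<longlongrightarrow> 0) F"
proof -
  obtain c where "eventually (\<lambda>t. norm (f t) \<le> c * norm (g t)) F"
    using assms(1) by (elim landau_o.bigE)
  moreover have "((\<lambda>t. c * norm (g t)) \<longlongrightarrow> 0) F"
    using tendsto_mult_right_zero[OF tendsto_norm_zero[OF assms(2)]] .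
  ultimately show ?thesis
    by (rule Lim_null_comparison)
qed

lemma bigo_cnj:
  fixes f :: "real \<Rightarrow> complex"
  assumes "f \<in> O[F](g)"
  shows "(\<lambda>t. cnj (f t)) \<in> O[F](g)"
  using assms by (simp add: bigo_def)

lemma bigo_transform:
  fixes f g :: "real \<Rightarrow> complex"
  assumes "f \<in> O[F](h)" "eventually (\<lambda>t. f t = g t) F"
  shows "g \<in> O[F](h)"
  using landau_o.big.in_cong[OF assms(2)] assms(1) by blast

lemma tendsto_diff_self: "((\<lambda>t. complex_of_real (t - p)) \<longlongrightarrow> 0) (at p)"
proof -
  have "((\<lambda>t. complex_of_real (t - p)) \<longlongrightarrow> complex_of_real (p - p)) (at p)"
    by (intro tendsto_intros)
  then show ?thesis by simp
qed

lemma bigo_one_of_tendsto: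
  fixes f :: "real \<Rightarrow> complex"
  assumes "(f \<longlongrightarrow> l) F"
  shows "f \<in> O[F](\<lambda>_. 1)"
proof -
  have "eventually (\<lambda>t. norm (f t) < norm l + 1) F"
    using order_tendstoD(2)[OF tendsto_norm[OF assms], of "norm l + 1"] by simp
  then show ?thesis
    by (intro bigoI[of _ "norm l + 1"]) (auto elim: eventually_mono)
qed

text \<open>Letting y tend to 0 kills the constant term; division by y^2 then lowers d by one and
  the order of the error by two, which is the same situation again.\<close>

lemma even_polynomial_eq_0:
  assumes "(\<lambda>t. \<Sum>k\<le>d. a k * complex_of_real (t - p) ^ (2 * k))
      \<in> O[at p](\<lambda>t. complex_of_real (t - p) ^ (2 * d + 1))"
    and "k \<le> d"
  shows "a k = 0"
  using assms
proof (induction d arbitrary: a k)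
  case (0 a k)
  have "((\<lambda>t. complex_of_real (t - p)) \<longlongrightarrow> 0) (at p)"
    by (rule tendsto_diff_self)
  then have "((\<lambda>t. a 0) \<longlongrightarrow> 0) (at p)"
    using bigo_tendsto_zero[OF 0(1)] by simp
  then show ?case
    using tendsto_unique[OF _ tendsto_const, of "at p" "a 0" 0] 0(2) by simp
next
  case (Suc d a k)
  let ?y = "\<lambda>t. complex_of_real (t - p)"
  have split: "(\<Sum>k\<le>Suc d. a k * ?y t ^ (2 * k))
      = a 0 + ?y t ^ 2 * (\<Sum>k\<le>d. a (Suc k) * ?y t ^ (2 * k))" for t
    by (simp add: sum.atMost_Suc_shift sum_distrib_left power2_eq_square mult_ac del: sum.atMost_Suc)
  have "((\<lambda>t. ?y t ^ (2 * Suc d + 1)) \<longlongrightarrow> 0 ^ (2 * Suc d + 1)) (at p)"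
    by (intro tendsto_power tendsto_diff_self)
  then have "((\<lambda>t. \<Sum>k\<le>Suc d. a k * ?y t ^ (2 * k)) \<longlongrightarrow> 0) (at p)"
    using bigo_tendsto_zero[OF Suc.prems(1)] by simp
  moreover have "((\<lambda>t. \<Sum>k\<le>Suc d. a k * ?y t ^ (2 * k))
      \<longlongrightarrow> a 0 + 0 ^ 2 * (\<Sum>k\<le>d. a (Suc k) * 0 ^ (2 * k))) (at p)"
    unfolding split by (intro tendsto_intros tendsto_diff_self)
  ultimately have a0: "a 0 = 0"
    using tendsto_unique[of "at p"] by fastforce
  have "(\<lambda>t. ?y t ^ 2 * (\<Sum>k\<le>d. a (Suc k) * ?y t ^ (2 * k)))
      \<in> O[at p](\<lambda>t. ?y t ^ 2 * ?y t ^ (2 * d + 1))"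
    using Suc.prems(1) unfolding split a0 by (simp add: power_add mult_ac power2_eq_square)
  then have "(\<lambda>t. \<Sum>k\<le>d. a (Suc k) * ?y t ^ (2 * k)) \<in> O[at p](\<lambda>t. ?y t ^ (2 * d + 1))"
    by (subst (asm) landau_o.big.mult_cancel_left) (auto simp: eventually_at_filter)
  from Suc.IH[OF this] show ?case
    using a0 Suc.prems(2) by (cases k) auto
qed

text \<open>Clearing the pole turns an expansion into an even polynomial of degree at most 2d, the
  form in which coefficients are compared and zeros counted.\<close>

lemma singular_sum_eq:
  assumes "y \<noteq> 0"
  shows "complex_of_real y ^ d * singular_sum a d y = (\<Sum>k\<le>d. a k * complex_of_real y ^ (2 * k))"
proof -
  have "complex_of_real y ^ d * (a k * complex_of_real y powi (- (int d - 2 * int k)))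
      = a k * complex_of_real y ^ (2 * k)" for k
  proof -
    have "complex_of_real y powi (int d + (- (int d - 2 * int k))) =
        complex_of_real y ^ d * complex_of_real y powi (- (int d - 2 * int k))"
      using assms by (subst power_int_add) auto
    moreover have "complex_of_real y powi (int d + (- (int d - 2 * int k)))
        = complex_of_real y ^ (2 * k)"
      by (simp flip: power_int_of_nat)
    ultimately show ?thesis
      by (simp add: mult_ac)
  qed
  then show ?thesis
    unfolding singular_sum_def sum_distrib_left atLeast0AtMost by (intro sum.cong refl) blast
qed

text \<open>Multiplication by y^d turns the error into O(y^(2d+1)), just beyond the top degree 2d of
  the even polynomial. This is why an error O(y^(d+1)) determines every coefficient up to index
  d.\<close>

lemma singular_sum_eq_0:
  assumes "singular_sum a d \<in> O[at 0](\<lambda>y. complex_of_real y ^ (d + 1))" "k \<le> d"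
  shows "a k = 0"
proof -
  have "(\<lambda>y. complex_of_real y ^ d * singular_sum a d y)
      \<in> O[at 0](\<lambda>y. complex_of_real y ^ d * complex_of_real y ^ (d + 1))"
    by (intro landau_o.big.mult_left assms)
  also have "(\<lambda>y. complex_of_real y ^ d * complex_of_real y ^ (d + 1))
      = (\<lambda>y. complex_of_real (y - 0) ^ (2 * d + 1))"
    by (simp add: fun_eq_iff power_add mult_2)
  finally have "(\<lambda>y. \<Sum>k\<le>d. a k * complex_of_real (y - 0) ^ (2 * k))
      \<in> O[at 0](\<lambda>y. complex_of_real (y - 0) ^ (2 * d + 1))"
    by (rule bigo_transform)
      (auto simp: eventually_at_filter singular_sum_eq)
  then show ?thesis
    using even_polynomial_eq_0 assms(2) by blast
qed

lemma polar_part_eq: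
  assumes "y \<noteq> 0"
  shows "complex_of_real y ^ (2 * Suc L) * polar_part b (Suc L) y
    = (\<Sum>k\<le>L. b (Suc L - k) * complex_of_real y ^ (2 * k))"
proof -
  have "complex_of_real y ^ (2 * Suc L) * (b m * complex_of_real y powi (- 2 * int m))
      = b m * complex_of_real y ^ (2 * (Suc L - m))" if "m \<in> {1..Suc L}" for m
  proof -
    have "complex_of_real y powi (int (2 * Suc L) + - 2 * int m) =
        complex_of_real y ^ (2 * Suc L) * complex_of_real y powi (- 2 * int m)"
      using assms by (subst power_int_add) (auto simp flip: power_int_of_nat)
    moreover have "int (2 * Suc L) + - 2 * int m = int (2 * (Suc L - m))"
      using that by auto
    ultimately have "complex_of_real y ^ (2 * Suc L) * complex_of_real y powi (- 2 * int m)
        = complex_of_real y ^ (2 * (Suc L - m))"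
      by (metis power_int_of_nat)
    then show ?thesis
      by (simp add: mult_ac)
  qed
  then have "complex_of_real y ^ (2 * Suc L) * polar_part b (Suc L) y
      = (\<Sum>m=1..Suc L. b m * complex_of_real y ^ (2 * (Suc L - m)))"
    unfolding polar_part_def sum_distrib_left by (intro sum.cong) auto
  also have "\<dots> = (\<Sum>k\<le>L. b (Suc L - k) * complex_of_real y ^ (2 * k))"
    by (rule sum.reindex_bij_witness[of _ "\<lambda>k. Suc L - k" "\<lambda>m. Suc L - m"]) auto
  finally show ?thesis .
qed

text \<open>Multiplication by y^(2M) leaves an even polynomial of degree at most 2M - 2 that is
  O(y^(2M)). This is weakened to O(y^(2M-1)), the error order of \<open>even_polynomial_eq_0\<close>
  for d = M - 1.\<close>

lemma polar_part_bounded_eq_0: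
  assumes "polar_part b M \<in> O[at 0](\<lambda>_. 1)" "1 \<le> m" "m \<le> M"
  shows "b m = 0"
proof -
  obtain L where L: "M = Suc L"
    using assms(2,3) by (cases M) auto
  have "(\<lambda>y. complex_of_real y ^ (2 * Suc L) * polar_part b (Suc L) y)
      \<in> O[at 0](\<lambda>y. complex_of_real y ^ (2 * Suc L) * 1)"
    using assms(1) unfolding L by (rule landau_o.big.mult_left)
  also have "(\<lambda>y. complex_of_real y ^ (2 * Suc L) * 1)
      = (\<lambda>y. complex_of_real y * complex_of_real (y - 0) ^ (2 * L + 1))"
    by (simp add: fun_eq_iff)
  also have "\<dots> \<in> O[at 0](\<lambda>y. 1 * complex_of_real (y - 0) ^ (2 * L + 1))"
    using bigo_one_of_tendsto[OF tendsto_diff_self[of 0]]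
    by (intro landau_o.big.mult_right) simp
  finally have "(\<lambda>y. \<Sum>k\<le>L. b (Suc L - k) * complex_of_real (y - 0) ^ (2 * k))
      \<in> O[at 0](\<lambda>y. complex_of_real (y - 0) ^ (2 * L + 1))"
    unfolding mult_1
    by (rule bigo_transform)
      (auto simp: eventually_at_filter polar_part_eq simp del: mult_Suc_right)
  from even_polynomial_eq_0[OF this, of "Suc L - m"] show ?thesis
    using assms(2,3) L by auto
qed

section \<open>Products, linear combinations and shifts of expansions\<close>

lemma sum_swap_last:
  "(\<Sum>j\<in>A. \<Sum>k\<in>B. \<Sum>m\<in>C. f j k m) = (\<Sum>m\<in>C. \<Sum>j\<in>A. \<Sum>k\<in>B. f j k m)"
proof -
  have "(\<Sum>j\<in>A. \<Sum>k\<in>B. \<Sum>m\<in>C. f j k m) = (\<Sum>j\<in>A. \<Sum>m\<in>C. \<Sum>k\<in>B. f j k m)"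
    by (intro sum.cong refl sum.swap)
  also have "\<dots> = (\<Sum>m\<in>C. \<Sum>j\<in>A. \<Sum>k\<in>B. f j k m)"
    by (rule sum.swap)
  finally show ?thesis .
qed

text \<open>The sign of j + k - d splits the double sum into polar and regular terms. The identity
  is exact and not merely asymptotic, so a combination of negative powers, whose regular terms all
  vanish, has a purely polar square.\<close>

lemma singular_sum_mult_cnj:
  assumes "y \<noteq> 0"
  shows "singular_sum a d y * cnj (singular_sum b d y) = polar_part (product_coeff d a b) d y
    + (\<Sum>j=0..d. \<Sum>k=0..d. if d \<le> j + k
        then a j * cnj (b k) * complex_of_real y ^ (2 * (j + k - d)) else 0)"
proof -
  let ?y = "complex_of_real y"
  have 1: "?y powi (- (int d - 2 * int j)) * ?y powi (- (int d - 2 * int k))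
      = ?y powi (2 * (int j + int k - int d))" for j k
    using assms by (subst power_int_add[symmetric]) (auto simp: algebra_simps)
  have "singular_sum a d y * cnj (singular_sum b d y)
      = (\<Sum>j=0..d. \<Sum>k=0..d. a j * cnj (b k) * ?y powi (2 * (int j + int k - int d)))"
    unfolding 1[symmetric]
    by (simp add: singular_sum_def sum_product complex_cnj_power_int mult_ac)
  also have "\<dots> = (\<Sum>j=0..d. \<Sum>k=0..d.
      (\<Sum>m=1..d. if j + k + m = d then a j * cnj (b k) * ?y powi (- 2 * int m) else 0)
      + (if d \<le> j + k then a j * cnj (b k) * ?y ^ (2 * (j + k - d)) else 0))"
  proof (intro sum.cong refl)
    fix j k
    show "a j * cnj (b k) * ?y powi (2 * (int j + int k - int d)) =
      (\<Sum>m=1..d. if j + k + m = d then a j * cnj (b k) * ?y powi (- 2 * int m) else 0)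
      + (if d \<le> j + k then a j * cnj (b k) * ?y ^ (2 * (j + k - d)) else 0)"
    proof (cases "d \<le> j + k")
      case True
      then have "(\<Sum>m=1..d. if j + k + m = d then a j * cnj (b k) * ?y powi (- 2 * int m) else 0) = 0"
        by (intro sum.neutral) auto
      moreover have "?y powi (2 * (int j + int k - int d)) = ?y ^ (2 * (j + k - d))"
      proof -
        have "2 * (int j + int k - int d) = int (2 * (j + k - d))"
          using True by auto
        then show ?thesis
          by (simp only: power_int_of_nat)
      qed
      ultimately show ?thesis
        using True by simp
    next
      case False
      have "(\<Sum>m=1..d. if j + k + m = d then a j * cnj (b k) * ?y powi (- 2 * int m) else 0)
          = (\<Sum>m=1..d. if m = d - j - k then a j * cnj (b k) * ?y powi (- 2 * int m) else 0)"
        using False by (intro sum.cong) auto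
      also have "\<dots> = a j * cnj (b k) * ?y powi (- 2 * int (d - j - k))"
        using False by (subst sum.delta) auto
      also have "- 2 * int (d - j - k) = 2 * (int j + int k - int d)"
        using False by auto
      finally show ?thesis
        using False by simp
    qed
  qed
  also have "\<dots> = (\<Sum>m=1..d. \<Sum>j=0..d. \<Sum>k=0..d.
        if j + k + m = d then a j * cnj (b k) * ?y powi (- 2 * int m) else 0)
      + (\<Sum>j=0..d. \<Sum>k=0..d. if d \<le> j + k then a j * cnj (b k) * ?y ^ (2 * (j + k - d)) else 0)"
    unfolding sum.distrib by (intro arg_cong2[where f = "(+)"] sum_swap_last refl)
  also have "(\<Sum>m=1..d. \<Sum>j=0..d. \<Sum>k=0..d.
        if j + k + m = d then a j * cnj (b k) * ?y powi (- 2 * int m) else 0)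
      = polar_part (product_coeff d a b) d y"
    unfolding polar_part_def product_coeff_def sum_distrib_right
    by (intro sum.cong refl) auto
  finally show ?thesis .
qed

lemma has_expansion_add:
  "has_expansion \<Psi> p d a \<Longrightarrow> has_expansion \<Phi> p d b \<Longrightarrow>
   has_expansion (\<Psi> + \<Phi>) p d (\<lambda>k. a k + b k)"
  unfolding has_expansion_def
  by (drule (1) sum_in_bigo(1))
    (simp add: singular_sum_def algebra_simps sum.distrib plus_fun_def)

lemma has_expansion_scale:
  assumes "has_expansion \<Psi> p d a"
  shows "has_expansion (cscale c \<Psi>) p d (\<lambda>k. c * a k)"
proof -
  have "(\<lambda>t. c * (\<Psi> t - singular_sum a d (t - p)))
      \<in> O[at p](\<lambda>t. complex_of_real (t - p) ^ (d + 1))"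
    using assms unfolding has_expansion_def by (subst cmult_in_bigo_iff) (rule disjI2)
  then show ?thesis
    by (simp add: has_expansion_def singular_sum_def cscale_def algebra_simps sum_distrib_left)
qed

lemma bigo_at_shift:
  fixes f :: "real \<Rightarrow> complex"
  shows "(\<lambda>t. f (t - p)) \<in> O[at (q + p)](\<lambda>t. g (t - p)) \<longleftrightarrow> f \<in> O[at q](g)"
proof -
  have "at (q + p) = filtermap (\<lambda>t. t + p) (at q)"
    using at_to_0[of "q + p"] at_to_0[of q] by (simp add: filtermap_filtermap add_ac)
  then show ?thesis
    by (simp add: bigo_def eventually_filtermap)
qed

lemma has_expansion_unique:
  assumes "has_expansion \<Psi> p d a" "has_expansion \<Psi> p d b" "k \<le> d"
  shows "a k = b k"
proof -
  have "(\<lambda>t. (\<Psi> t - singular_sum b d (t - p)) - (\<Psi> t - singular_sum a d (t - p)))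
      \<in> O[at p](\<lambda>t. complex_of_real (t - p) ^ (d + 1))"
    using assms unfolding has_expansion_def using sum_in_bigo(2) by blast
  then have "(\<lambda>t. singular_sum (\<lambda>k. a k - b k) d (t - p))
      \<in> O[at (0 + p)](\<lambda>t. complex_of_real (t - p) ^ (d + 1))"
    by (simp add: singular_sum_def algebra_simps sum_subtractf)
  then have "singular_sum (\<lambda>k. a k - b k) d \<in> O[at 0](\<lambda>t. complex_of_real t ^ (d + 1))"
    by (subst (asm) bigo_at_shift)
  from singular_sum_eq_0[OF this assms(3)] show ?thesis
    by simp
qed

lemma has_expansion_transform:
  assumes "has_expansion \<Psi> p d a" "eventually (\<lambda>t. \<Psi> t = \<Phi> t) (at p)"
  shows "has_expansion \<Phi> p d a"
  using assms(1) unfolding has_expansion_def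
  by (rule bigo_transform) (use assms(2) in eventually_elim, simp)

lemma has_expansion_shift:
  assumes "has_expansion \<Psi> p d a"
  shows "has_expansion (\<lambda>t. \<Psi> (t - s)) (p + s) d a"
  using bigo_at_shift[of "\<lambda>t. \<Psi> t - singular_sum a d (t - p)" s p
      "\<lambda>t. complex_of_real (t - p) ^ (d + 1)"] assms
  by (simp add: has_expansion_def algebra_simps)

lemma singular_sum_bigo:
  "(\<lambda>t. singular_sum a d (t - p)) \<in> O[at p](\<lambda>t. inverse (complex_of_real (t - p) ^ d))"
proof -
  have "((\<lambda>t. \<Sum>k\<le>d. a k * complex_of_real (t - p) ^ (2 * k))
      \<longlongrightarrow> (\<Sum>k\<le>d. a k * 0 ^ (2 * k))) (at p)"
    by (intro tendsto_intros tendsto_diff_self)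
  then have "(\<lambda>t. inverse (complex_of_real (t - p) ^ d) *
        (\<Sum>k\<le>d. a k * complex_of_real (t - p) ^ (2 * k)))
      \<in> O[at p](\<lambda>t. inverse (complex_of_real (t - p) ^ d) * 1)"
    by (intro landau_o.big.mult_left bigo_one_of_tendsto)
  then have "(\<lambda>t. inverse (complex_of_real (t - p) ^ d) *
        (\<Sum>k\<le>d. a k * complex_of_real (t - p) ^ (2 * k)))
      \<in> O[at p](\<lambda>t. inverse (complex_of_real (t - p) ^ d))"
    by simp
  then show ?thesis
  proof (rule bigo_transform)
    show "eventually (\<lambda>t. inverse (complex_of_real (t - p) ^ d) *
        (\<Sum>k\<le>d. a k * complex_of_real (t - p) ^ (2 * k)) = singular_sum a d (t - p)) (at p)"
      using eventually_at_neq[of p]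
    proof eventually_elim
      case (elim t)
      then show ?case
        using singular_sum_eq[of "t - p" d a] by (simp add: field_simps del: of_real_diff)
    qed
  qed
qed

text \<open>Multiplying the expansions leaves even powers only: the exponents of both factors have
  the parity of \<open>d\<close>, and the error \<open>O(y\<^sup>d\<^sup>+\<^sup>1)\<close> meets a pole of order at most \<open>d\<close>.\<close>

lemma has_expansion_mult_cnj:
  assumes "has_expansion \<Psi> p d a" "has_expansion \<Phi> p d b"
  shows "(\<lambda>t. \<Psi> t * cnj (\<Phi> t) - polar_part (product_coeff d a b) d (t - p)) \<in> O[at p](\<lambda>_. 1)"
proof -
  let ?y = "\<lambda>t. complex_of_real (t - p)"
  let ?A = "\<lambda>t. singular_sum a d (t - p)" and ?B = "\<lambda>t. singular_sum b d (t - p)"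
  have small: "(\<lambda>t. ?y t ^ (d + 1) * inverse (?y t ^ d)) \<in> O[at p](\<lambda>_. 1)"
  proof (rule bigo_transform[OF bigo_one_of_tendsto[OF tendsto_diff_self]])
    show "eventually (\<lambda>t. ?y t = ?y t ^ (d + 1) * inverse (?y t ^ d)) (at p)"
      using eventually_at_neq[of p] by eventually_elim (simp del: of_real_diff)
  qed
  have small': "?y \<in> O[at p](\<lambda>_. 1)"
    by (rule bigo_one_of_tendsto[OF tendsto_diff_self])
  have errA: "(\<lambda>t. \<Psi> t - ?A t) \<in> O[at p](\<lambda>t. ?y t ^ (d + 1))"
    and errB: "(\<lambda>t. cnj (\<Phi> t - ?B t)) \<in> O[at p](\<lambda>t. ?y t ^ (d + 1))"
    using assms bigo_cnj unfolding has_expansion_def by blast+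
  have pw: "(\<lambda>t. ?y t ^ (d + 1)) \<in> O[at p](\<lambda>_. 1)"
    using tendsto_power[OF tendsto_diff_self, of p "d + 1"] by (rule bigo_one_of_tendsto)
  have 1: "(\<lambda>t. (\<Psi> t - ?A t) * cnj (?B t)) \<in> O[at p](\<lambda>t. 1)"
    using landau_o.big.trans[OF landau_o.big.mult[OF errA bigo_cnj[OF singular_sum_bigo]] small] .
  have 2: "(\<lambda>t. cnj (\<Phi> t - ?B t) * ?A t) \<in> O[at p](\<lambda>t. 1)"
    using landau_o.big.trans[OF landau_o.big.mult[OF errB singular_sum_bigo] small] .
  have 3: "(\<lambda>t. (\<Psi> t - ?A t) * cnj (\<Phi> t - ?B t)) \<in> O[at p](\<lambda>t. 1)"
    using landau_o.big.mult[OF landau_o.big.trans[OF errA pw] landau_o.big.trans[OF errB pw]]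
    by simp
  have "((\<lambda>t. \<Sum>j=0..d. \<Sum>k=0..d. if d \<le> j + k then a j * cnj (b k) * ?y t ^ (2 * (j + k - d)) else 0)
      \<longlongrightarrow> (\<Sum>j=0..d. \<Sum>k=0..d. if d \<le> j + k then a j * cnj (b k) * 0 ^ (2 * (j + k - d)) else 0))
      (at p)" (is "(?R \<longlongrightarrow> _) _")
    by (intro tendsto_sum) (auto intro!: tendsto_intros tendsto_diff_self simp del: of_real_diff)
  then have 4: "?R \<in> O[at p](\<lambda>t. 1)"
    by (rule bigo_one_of_tendsto)
  have "(\<lambda>t. ((\<Psi> t - ?A t) * cnj (?B t) + cnj (\<Phi> t - ?B t) * ?A t)
      + ((\<Psi> t - ?A t) * cnj (\<Phi> t - ?B t) + ?R t)) \<in> O[at p](\<lambda>_. 1)"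
    by (intro sum_in_bigo 1 2 3 4)
  then show ?thesis
  proof (rule bigo_transform)
    show "eventually (\<lambda>t. ((\<Psi> t - ?A t) * cnj (?B t) + cnj (\<Phi> t - ?B t) * ?A t)
      + ((\<Psi> t - ?A t) * cnj (\<Phi> t - ?B t) + ?R t)
      = \<Psi> t * cnj (\<Phi> t) - polar_part (product_coeff d a b) d (t - p)) (at p)"
      using eventually_at_neq[of p]
    proof eventually_elim
      case (elim t)
      have "?R t = ?A t * cnj (?B t) - polar_part (product_coeff d a b) d (t - p)"
        using singular_sum_mult_cnj[OF elim, of a d b] by simp
      then show ?case
        by (simp only:) (simp add: algebra_simps)
    qed
  qed
qed

section \<open>The regularized integral\<close>

definition outer_part :: "real set \<Rightarrow> real set \<Rightarrow> real \<Rightarrow> real set" where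
  "outer_part S P \<delta> = S - (\<Union>p\<in>P. {p - \<delta>..p + \<delta>})"

definition polar_remainder ::
  "(real \<Rightarrow> complex) \<Rightarrow> (real \<Rightarrow> nat) \<Rightarrow> (real \<Rightarrow> nat \<Rightarrow> complex) \<Rightarrow> real \<Rightarrow> real \<Rightarrow> complex" where
  "polar_remainder f M b p t = f t - polar_part (b p) (M p) (t - p)"

definition regularizable ::
  "(real \<Rightarrow> complex) \<Rightarrow> real set \<Rightarrow> real set \<Rightarrow> real \<Rightarrow> (real \<Rightarrow> nat) \<Rightarrow> (real \<Rightarrow> nat \<Rightarrow> complex) \<Rightarrow> bool"
  where
  "regularizable f S P \<delta> M b \<longleftrightarrow> f absolutely_integrable_on outer_part S P \<delta>
     \<and> (\<forall>p\<in>P. bounded (polar_remainder f M b p ` ({p - \<delta>..p + \<delta>} - {p}))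
              \<and> polar_remainder f M b p absolutely_integrable_on {p - \<delta>..p + \<delta>})"

definition regularized_sum ::
  "(real \<Rightarrow> complex) \<Rightarrow> real set \<Rightarrow> real set \<Rightarrow> real \<Rightarrow> (real \<Rightarrow> nat) \<Rightarrow> (real \<Rightarrow> nat \<Rightarrow> complex) \<Rightarrow> complex"
  where
  "regularized_sum f S P \<delta> M b = integral (outer_part S P \<delta>) f
     + (\<Sum>p\<in>P. integral {p - \<delta>..p + \<delta>} (polar_remainder f M b p)
              + polar_integral (b p) (M p) \<delta>)"

lemma regularized_value_iff:
  "regularized_value f S P \<delta> I \<longleftrightarrow>
     (\<exists>M b. regularizable f S P \<delta> M b \<and> I = regularized_sum f S P \<delta> M b)"
  by (simp add: regularized_value_def regularizable_def regularized_sum_def outer_part_def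
      polar_remainder_def[abs_def] Let_def)

section \<open>Uniqueness and linearity of the regularized value\<close>

lemma polar_part_add:
  "polar_part (\<lambda>m. b m + c m) M y = polar_part b M y + polar_part c M y"
  by (simp add: polar_part_def sum.distrib algebra_simps)

lemma polar_part_scale: "polar_part (\<lambda>m. c * b m) M y = c * polar_part b M y"
  by (simp add: polar_part_def sum_distrib_left mult.assoc)

lemma polar_part_cnj: "polar_part (\<lambda>m. cnj (b m)) M y = cnj (polar_part b M y)"
  by (simp add: polar_part_def)

lemma polar_integral_add:
  "polar_integral (\<lambda>m. b m + c m) M \<delta> = polar_integral b M \<delta> + polar_integral c M \<delta>"
  unfolding polar_integral_def sum.distrib[symmetric] by (simp only: distrib_right)

lemma polar_integral_scale: "polar_integral (\<lambda>m. c * b m) M \<delta> = c * polar_integral b M \<delta>"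
  by (simp add: polar_integral_def sum_distrib_left mult.assoc)

lemma polar_integral_cnj: "polar_integral (\<lambda>m. cnj (b m)) M \<delta> = cnj (polar_integral b M \<delta>)"
  by (simp add: polar_integral_def)

lemma sum_pad:
  fixes g :: "nat \<Rightarrow> complex"
  assumes "M \<le> K"
  shows "(\<Sum>m=1..M. b m * g m) = (\<Sum>m=1..K. (if m \<le> M then b m else 0) * g m)"
  using assms by (intro sum.mono_neutral_cong_left) auto

lemma polar_part_pad:
  "M \<le> K \<Longrightarrow> polar_part b M y = polar_part (\<lambda>m. if m \<le> M then b m else 0) K y"
  unfolding polar_part_def by (rule sum_pad)

lemma polar_integral_pad:
  "M \<le> K \<Longrightarrow> polar_integral b M \<delta> = polar_integral (\<lambda>m. if m \<le> M then b m else 0) K \<delta>"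
  unfolding polar_integral_def by (rule sum_pad)

text \<open>Two witnesses of regularized values may have polar parts of different lengths. Padding
  with zeros gives them a common length, on which coefficients can be compared or added.\<close>

lemma regularizable_pad:
  fixes b :: "real \<Rightarrow> nat \<Rightarrow> complex"
  assumes "\<And>p. M p \<le> K p"
  defines "b' \<equiv> \<lambda>p m. if m \<le> M p then b p m else 0"
  shows "regularizable f S P \<delta> M b \<longleftrightarrow> regularizable f S P \<delta> K b'"
    and "regularized_sum f S P \<delta> M b = regularized_sum f S P \<delta> K b'"
proof -
  have "polar_remainder f M b = polar_remainder f K b'"
    unfolding polar_remainder_def[abs_def] b'_def using polar_part_pad[OF assms(1)] by simp
  then show "regularizable f S P \<delta> M b \<longleftrightarrow> regularizable f S P \<delta> K b'"
    and "regularized_sum f S P \<delta> M b = regularized_sum f S P \<delta> K b'"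
    unfolding regularizable_def regularized_sum_def b'_def
    using polar_integral_pad[OF assms(1)] by simp_all
qed

lemma bounded_imp_bigo_one:
  fixes g :: "real \<Rightarrow> complex"
  assumes "0 < \<delta>" "bounded (g ` ({p - \<delta>..p + \<delta>} - {p}))"
  shows "g \<in> O[at p](\<lambda>_. 1)"
proof -
  obtain B where B: "\<And>t. t \<in> {p - \<delta>..p + \<delta>} - {p} \<Longrightarrow> norm (g t) \<le> B"
    using assms(2) unfolding bounded_iff by blast
  have "eventually (\<lambda>t. norm (g t) \<le> B * norm (1::complex)) (at p)"
    unfolding eventually_at using assms(1) B
    by (intro exI[of _ \<delta>]) (auto simp: dist_real_def abs_less_iff intro!: B)
  then show ?thesis
    by (rule bigoI)
qed

text \<open>The difference of the two bounded remainders is a polar part that stays bounded, hence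
  has zero coefficients.\<close>

lemma polar_part_coeff_unique:
  assumes "(\<lambda>t. f t - polar_part b M (t - p)) \<in> O[at p](\<lambda>_. 1)"
    and "(\<lambda>t. f t - polar_part c M (t - p)) \<in> O[at p](\<lambda>_. 1)"
    and "1 \<le> m" "m \<le> M"
  shows "b m = c m"
proof -
  have "(\<lambda>t. (f t - polar_part c M (t - p)) - (f t - polar_part b M (t - p))) \<in> O[at p](\<lambda>_. 1)"
    by (intro sum_in_bigo assms)
  moreover have "(f t - polar_part c M (t - p)) - (f t - polar_part b M (t - p))
      = polar_part (\<lambda>m. b m + (- 1) * c m) M (t - p)" for t
    unfolding polar_part_add polar_part_scale by simp
  ultimately have "(\<lambda>t. polar_part (\<lambda>m. b m + (- 1) * c m) M (t - p)) \<in> O[at (0 + p)](\<lambda>_. 1)"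
    by simp
  then have "polar_part (\<lambda>m. b m + (- 1) * c m) M \<in> O[at 0](\<lambda>_. 1)"
    by (rule bigo_at_shift[of _ p 0 "\<lambda>_. 1", THEN iffD1])
  from polar_part_bounded_eq_0[OF this assms(3,4)] show ?thesis
    by simp
qed

lemma regularized_values_common:
  assumes "regularized_value f S P \<delta> I" "regularized_value g S P \<delta> J"
  obtains K b c where "regularizable f S P \<delta> K b" "I = regularized_sum f S P \<delta> K b"
    "regularizable g S P \<delta> K c" "J = regularized_sum g S P \<delta> K c"
proof -
  obtain M b where b: "regularizable f S P \<delta> M b" "I = regularized_sum f S P \<delta> M b"
    using assms(1) by (auto simp: regularized_value_iff)
  obtain L c where c: "regularizable g S P \<delta> L c" "J = regularized_sum g S P \<delta> L c"
    using assms(2) by (auto simp: regularized_value_iff)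
  define K where "K p = max (M p) (L p)" for p
  define b' where "b' = (\<lambda>p m. if m \<le> M p then b p m else 0)"
  define c' where "c' = (\<lambda>p m. if m \<le> L p then c p m else 0)"
  have b': "regularizable f S P \<delta> K b'" "I = regularized_sum f S P \<delta> K b'"
    using regularizable_pad[of M K f S P \<delta> b] b by (simp_all add: K_def b'_def)
  have c': "regularizable g S P \<delta> K c'" "J = regularized_sum g S P \<delta> K c'"
    using regularizable_pad[of L K g S P \<delta> c] c by (simp_all add: K_def c'_def)
  show thesis
    by (rule that[OF b' c'])
qed

text \<open>Boundedness of the remainders determines the coefficients with index in 1..K p at each p
  in P, and the value depends on the polar parts only through these.\<close>

lemma regularized_value_unique:
  assumes "0 < \<delta>" "regularized_value f S P \<delta> I" "regularized_value f S P \<delta> J"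
  shows "I = J"
proof -
  obtain K b' c' where b': "regularizable f S P \<delta> K b'" "I = regularized_sum f S P \<delta> K b'"
    and c': "regularizable f S P \<delta> K c'" "J = regularized_sum f S P \<delta> K c'"
    using regularized_values_common[OF assms(2,3)] by blast
  have eq: "b' p m = c' p m" if "p \<in> P" "1 \<le> m" "m \<le> K p" for p m
  proof (rule polar_part_coeff_unique[OF _ _ that(2,3)])
    show "(\<lambda>t. f t - polar_part (b' p) (K p) (t - p)) \<in> O[at p](\<lambda>_. 1)"
      "(\<lambda>t. f t - polar_part (c' p) (K p) (t - p)) \<in> O[at p](\<lambda>_. 1)"
      using b'(1) c'(1) that(1)
      by (auto simp: regularizable_def polar_remainder_def[abs_def]
          intro!: bounded_imp_bigo_one[OF assms(1)])
  qed
  have "polar_part (b' p) (K p) y = polar_part (c' p) (K p) y"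
    "polar_integral (b' p) (K p) \<delta> = polar_integral (c' p) (K p) \<delta>" if "p \<in> P" for p y
    using eq[OF that] unfolding polar_part_def polar_integral_def by simp_all
  then show "I = J"
    unfolding b'(2) c'(2) regularized_sum_def polar_remainder_def[abs_def] by simp
qed

lemma regularized_value_add:
  assumes "regularized_value f S P \<delta> I" "regularized_value g S P \<delta> J"
  shows "regularized_value (\<lambda>t. f t + g t) S P \<delta> (I + J)"
proof -
  obtain K b' c' where b': "regularizable f S P \<delta> K b'" "I = regularized_sum f S P \<delta> K b'"
    and c': "regularizable g S P \<delta> K c'" "J = regularized_sum g S P \<delta> K c'"
    using regularized_values_common[OF assms(1,2)] by blast
  let ?d = "\<lambda>p m. b' p m + c' p m"
  have rem: "polar_remainder (\<lambda>t. f t + g t) K ?d p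
      = (\<lambda>t. polar_remainder f K b' p t + polar_remainder g K c' p t)" for p
    by (simp add: polar_remainder_def fun_eq_iff polar_part_add)
  note int = set_lebesgue_integral_eq_integral(1)
  have "regularizable (\<lambda>t. f t + g t) S P \<delta> K ?d"
    using b'(1) c'(1) unfolding regularizable_def rem
    by (auto intro!: set_integral_add(1) bounded_plus_comp)
  moreover have "I + J = regularized_sum (\<lambda>t. f t + g t) S P \<delta> K ?d"
  proof -
    have "integral (outer_part S P \<delta>) (\<lambda>t. f t + g t)
        = integral (outer_part S P \<delta>) f + integral (outer_part S P \<delta>) g"
      using b'(1) c'(1) int unfolding regularizable_def by (intro integral_add) blast+
    moreover have "integral {p - \<delta>..p + \<delta>} (\<lambda>t. polar_remainder f K b' p t + polar_remainder g K c' p t)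
        = integral {p - \<delta>..p + \<delta>} (polar_remainder f K b' p)
          + integral {p - \<delta>..p + \<delta>} (polar_remainder g K c' p)" if "p \<in> P" for p
      using b'(1) c'(1) int that unfolding regularizable_def by (intro integral_add) blast+
    ultimately show ?thesis
      unfolding b'(2) c'(2) regularized_sum_def rem
      by (simp add: polar_integral_add sum.distrib algebra_simps)
  qed
  ultimately show ?thesis
    unfolding regularized_value_iff by blast
qed

lemma regularized_value_scale:
  assumes "regularized_value f S P \<delta> I"
  shows "regularized_value (\<lambda>t. c * f t) S P \<delta> (c * I)"
proof -
  obtain M b where b: "regularizable f S P \<delta> M b" "I = regularized_sum f S P \<delta> M b"
    using assms by (auto simp: regularized_value_iff)
  let ?d = "\<lambda>p m. c * b p m"
  have rem: "polar_remainder (\<lambda>t. c * f t) M ?d p = (\<lambda>t. c * polar_remainder f M b p t)" for p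
    by (simp add: polar_remainder_def fun_eq_iff polar_part_scale right_diff_distrib)
  have bdd: "bounded ((\<lambda>t. c * h t) ` A)" if "bounded (h ` A)" for h :: "real \<Rightarrow> complex" and A
    using bounded_linear_image[OF that bounded_linear_mult_right[of c]] by (simp add: image_image)
  have "regularizable (\<lambda>t. c * f t) S P \<delta> M ?d"
    using b(1) unfolding regularizable_def rem
    by (auto intro!: set_integrable_mult_right bdd)
  moreover have "c * I = regularized_sum (\<lambda>t. c * f t) S P \<delta> M ?d"
    unfolding b(2) regularized_sum_def rem
    by (simp add: polar_integral_scale sum_distrib_left distrib_left)
  ultimately show ?thesis
    unfolding regularized_value_iff by blast
qed

lemma regularized_value_cnj:
  assumes "regularized_value f S P \<delta> I"
  shows "regularized_value (\<lambda>t. cnj (f t)) S P \<delta> (cnj I)"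
proof -
  obtain M b where b: "regularizable f S P \<delta> M b" "I = regularized_sum f S P \<delta> M b"
    using assms by (auto simp: regularized_value_iff)
  let ?d = "\<lambda>p m. cnj (b p m)"
  have rem: "polar_remainder (\<lambda>t. cnj (f t)) M ?d p = (\<lambda>t. cnj (polar_remainder f M b p t))" for p
    by (simp add: polar_remainder_def fun_eq_iff polar_part_cnj)
  have abs: "(\<lambda>t. cnj (h t)) absolutely_integrable_on A"
    if "h absolutely_integrable_on A" for h :: "real \<Rightarrow> complex" and A
    using absolutely_integrable_linear[OF that bounded_linear_cnj] by (simp add: o_def)
  have int: "integral A (\<lambda>t. cnj (h t)) = cnj (integral A h)"
    if "h absolutely_integrable_on A" for h :: "real \<Rightarrow> complex" and A
    using integral_linear[OF set_lebesgue_integral_eq_integral(1)[OF that] bounded_linear_cnj]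
    by (simp add: o_def)
  have bdd: "bounded ((\<lambda>t. cnj (h t)) ` A)" if "bounded (h ` A)" for h :: "real \<Rightarrow> complex" and A
    using bounded_linear_image[OF that bounded_linear_cnj] by (simp add: image_image)
  have "regularizable (\<lambda>t. cnj (f t)) S P \<delta> M ?d"
    using b(1) unfolding regularizable_def rem
    by (auto intro!: abs bdd)
  moreover have "cnj I = regularized_sum (\<lambda>t. cnj (f t)) S P \<delta> M ?d"
    using b(1) unfolding b(2) regularized_sum_def rem regularizable_def
    by (simp add: polar_integral_cnj int)
  ultimately show ?thesis
    unfolding regularized_value_iff by blast
qed

subsection \<open>Independence of the radius\<close>

text \<open>On each interval the polar part is replaced by the difference of itself and a constant
  with the same regularized integral. What remains is an ordinary integral over \<open>S\<close>.\<close>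

definition polar_cut :: "(nat \<Rightarrow> complex) \<Rightarrow> nat \<Rightarrow> real \<Rightarrow> real \<Rightarrow> complex" where
  "polar_cut b M \<delta> y = (if \<bar>y\<bar> \<le> \<delta>
     then polar_part b M y - polar_integral b M \<delta> / complex_of_real (2 * \<delta>) else 0)"

definition regular_part ::
  "(real \<Rightarrow> complex) \<Rightarrow> real set \<Rightarrow> real \<Rightarrow> (real \<Rightarrow> nat) \<Rightarrow> (real \<Rightarrow> nat \<Rightarrow> complex) \<Rightarrow> real \<Rightarrow> complex"
  where
  "regular_part f P \<delta> M b t = f t - (\<Sum>p\<in>P. polar_cut (b p) (M p) \<delta> (t - p))"

lemma has_integral_restrict_iff:
  fixes f :: "real \<Rightarrow> complex"
  shows "((\<lambda>t. if t \<in> S then f t else 0) has_integral I) UNIV \<longleftrightarrow> (f has_integral I) S"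
  using has_integral_restrict_UNIV[of S f I] by simp

lemma sum_polar_cut:
  assumes "admissible_radius S P \<delta>" "finite P" "p \<in> P" "\<bar>t - p\<bar> \<le> \<delta>"
  shows "(\<Sum>q\<in>P. polar_cut (b q) (M q) \<delta> (t - q)) = polar_cut (b p) (M p) \<delta> (t - p)"
proof -
  have "polar_cut (b q) (M q) \<delta> (t - q) = 0" if "q \<in> P" "q \<noteq> p" for q
  proof -
    have "t \<in> {p - \<delta>..p + \<delta>}"
      using assms(4) by auto
    then have "t \<notin> {q - \<delta>..q + \<delta>}"
      using assms(1,3) that unfolding admissible_radius_def by blast
    then show ?thesis
      by (auto simp: polar_cut_def)
  qed
  then show ?thesis
    using assms(2,3) by (simp add: sum.remove[of P p])
qed

text \<open>This is \<open>regularized_sum\<close> before integration: the constant, spread over an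
  interval of length \<open>2 * \<delta>\<close>, integrates to the polar integral.\<close>

lemma regular_part_split:
  assumes "admissible_radius S P \<delta>" "finite P"
  shows "(if t \<in> S then regular_part f P \<delta> M b t else 0)
    = (if t \<in> outer_part S P \<delta> then f t else 0)
      + (\<Sum>p\<in>P. if t \<in> {p - \<delta>..p + \<delta>} then polar_remainder f M b p t
          + polar_integral (b p) (M p) \<delta> / complex_of_real (2 * \<delta>) else 0)"
proof (cases "\<exists>p\<in>P. t \<in> {p - \<delta>..p + \<delta>}")
  case True
  then obtain p where p: "p \<in> P" "t \<in> {p - \<delta>..p + \<delta>}"
    by blast
  have notin: "t \<notin> {q - \<delta>..q + \<delta>}" if "q \<in> P - {p}" for q
    using assms(1) p that unfolding admissible_radius_def by blast
  have "(\<Sum>p\<in>P - {p}. if t \<in> {p - \<delta>..p + \<delta>} then polar_remainder f M b p t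
          + polar_integral (b p) (M p) \<delta> / complex_of_real (2 * \<delta>) else 0) = 0"
    by (intro sum.neutral ballI) (simp only: notin if_False)
  then have "(\<Sum>p\<in>P. if t \<in> {p - \<delta>..p + \<delta>} then polar_remainder f M b p t
          + polar_integral (b p) (M p) \<delta> / complex_of_real (2 * \<delta>) else 0)
      = polar_remainder f M b p t + polar_integral (b p) (M p) \<delta> / complex_of_real (2 * \<delta>)"
    using p(2) by (simp add: sum.remove[OF assms(2) p(1)])
  moreover have "t \<in> S"
    using assms(1) p unfolding admissible_radius_def by blast
  moreover have "t \<notin> outer_part S P \<delta>"
    using p by (auto simp: outer_part_def)
  moreover have "regular_part f P \<delta> M b t
      = polar_remainder f M b p t + polar_integral (b p) (M p) \<delta> / complex_of_real (2 * \<delta>)"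
  proof -
    have "\<bar>t - p\<bar> \<le> \<delta>"
      using p by (auto simp: abs_le_iff)
    then show ?thesis
      unfolding regular_part_def sum_polar_cut[OF assms p(1) \<open>\<bar>t - p\<bar> \<le> \<delta>\<close>]
      by (simp add: polar_cut_def polar_remainder_def)
  qed
  ultimately show ?thesis
    by simp
next
  case False
  have "(\<Sum>p\<in>P. polar_cut (b p) (M p) \<delta> (t - p)) = 0"
    using False by (intro sum.neutral) (auto simp: polar_cut_def abs_le_iff)
  moreover have "(\<Sum>p\<in>P. if t \<in> {p - \<delta>..p + \<delta>} then polar_remainder f M b p t
          + polar_integral (b p) (M p) \<delta> / complex_of_real (2 * \<delta>) else 0) = 0"
    by (intro sum.neutral ballI if_not_P) (use False in blast)
  moreover have "t \<in> outer_part S P \<delta> \<longleftrightarrow> t \<in> S"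
    using False unfolding outer_part_def by blast
  ultimately show ?thesis
    by (simp only: regular_part_def diff_zero add_0_right)
qed

lemma regular_part_integral:
  assumes "admissible_radius S P \<delta>" "finite P" "regularizable f S P \<delta> M b"
  shows "regular_part f P \<delta> M b absolutely_integrable_on S"
    and "integral S (regular_part f P \<delta> M b) = regularized_sum f S P \<delta> M b"
proof -
  let ?c = "\<lambda>p. polar_integral (b p) (M p) \<delta> / complex_of_real (2 * \<delta>)"
  have \<delta>: "0 < \<delta>"
    using assms(1) by (simp add: admissible_radius_def)
  have out: "f absolutely_integrable_on outer_part S P \<delta>"
    and inn: "\<And>p. p \<in> P \<Longrightarrow> polar_remainder f M b p absolutely_integrable_on {p - \<delta>..p + \<delta>}"
    using assms(3) by (auto simp: regularizable_def)
  have inn': "(\<lambda>t. polar_remainder f M b p t + ?c p) absolutely_integrable_on {p - \<delta>..p + \<delta>}"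
    if "p \<in> P" for p
    by (intro set_integral_add(1) inn that) (simp add: absolutely_integrable_continuous_real)
  have "(\<lambda>t. if t \<in> S then regular_part f P \<delta> M b t else 0) absolutely_integrable_on UNIV"
    unfolding regular_part_split[OF assms(1,2)]
    by (intro set_integral_add(1) absolutely_integrable_sum assms(2))
      (simp_all only: absolutely_integrable_restrict_UNIV out inn')
  then show "regular_part f P \<delta> M b absolutely_integrable_on S"
    by (simp only: absolutely_integrable_restrict_UNIV)
  have const: "((\<lambda>t. ?c p) has_integral polar_integral (b p) (M p) \<delta>) {p - \<delta>..p + \<delta>}" for p
    using has_integral_const_real[of "?c p" "p - \<delta>" "p + \<delta>"] \<delta>
    by (simp add: scaleR_conv_of_real)
  have "((\<lambda>t. if t \<in> S then regular_part f P \<delta> M b t else 0) has_integral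
      (integral (outer_part S P \<delta>) f + (\<Sum>p\<in>P. integral {p - \<delta>..p + \<delta>} (polar_remainder f M b p)
        + polar_integral (b p) (M p) \<delta>))) UNIV"
    unfolding regular_part_split[OF assms(1,2)]
  proof (intro has_integral_add has_integral_sum assms(2))
    show "((\<lambda>t. if t \<in> outer_part S P \<delta> then f t else 0) has_integral
        integral (outer_part S P \<delta>) f) UNIV"
      unfolding has_integral_restrict_iff
      using out set_lebesgue_integral_eq_integral(1) by blast
    show "((\<lambda>t. if t \<in> {p - \<delta>..p + \<delta>} then polar_remainder f M b p t + ?c p else 0) has_integral
        (integral {p - \<delta>..p + \<delta>} (polar_remainder f M b p) + polar_integral (b p) (M p) \<delta>)) UNIV"
      if "p \<in> P" for p
      unfolding has_integral_restrict_iff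
      using inn[OF that] set_lebesgue_integral_eq_integral(1)
      by (intro has_integral_add const) blast
  qed
  then show "integral S (regular_part f P \<delta> M b) = regularized_sum f S P \<delta> M b"
    unfolding has_integral_restrict_iff regularized_sum_def by (rule integral_unique)
qed

text \<open>Integrability of the pieces is recovered from the single function
  \<open>regular_part\<close>, by restriction to the intervals and by subtraction on the outer part.
  A change of radius can then be studied on that function alone.\<close>

lemma regularizableI_regular_part:
  assumes "admissible_radius S P \<delta>" "finite P"
    and reg: "regular_part f P \<delta> M b absolutely_integrable_on S"
    and "\<And>p. p \<in> P \<Longrightarrow> bounded (polar_remainder f M b p ` ({p - \<delta>..p + \<delta>} - {p}))"
  shows "regularizable f S P \<delta> M b"
proof -
  let ?c = "\<lambda>p. polar_integral (b p) (M p) \<delta> / complex_of_real (2 * \<delta>)"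
  have sub: "{p - \<delta>..p + \<delta>} \<subseteq> S" if "p \<in> P" for p
    using assms(1) that by (simp add: admissible_radius_def)
  have regp: "regular_part f P \<delta> M b t = polar_remainder f M b p t + ?c p"
    if "p \<in> P" "t \<in> {p - \<delta>..p + \<delta>}" for p t
  proof -
    have "\<bar>t - p\<bar> \<le> \<delta>"
      using that by (auto simp: abs_le_iff)
    then show ?thesis
      unfolding regular_part_def sum_polar_cut[OF assms(1,2) that(1) \<open>\<bar>t - p\<bar> \<le> \<delta>\<close>]
      by (simp add: polar_cut_def polar_remainder_def)
  qed
  have inn': "(\<lambda>t. polar_remainder f M b p t + ?c p) absolutely_integrable_on {p - \<delta>..p + \<delta>}"
    if "p \<in> P" for p
    by (rule absolutely_integrable_spike[OF
          absolutely_integrable_on_subinterval[OF reg sub[OF that]], of "{}"])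
      (simp_all add: regp[OF that])
  have inn: "polar_remainder f M b p absolutely_integrable_on {p - \<delta>..p + \<delta>}" if "p \<in> P" for p
  proof -
    have "(\<lambda>t. (polar_remainder f M b p t + ?c p) - ?c p) absolutely_integrable_on {p - \<delta>..p + \<delta>}"
      by (intro set_integral_diff(1) inn' that) (simp add: absolutely_integrable_continuous_real)
    then show ?thesis
      by simp
  qed
  have "(\<lambda>t. (if t \<in> S then regular_part f P \<delta> M b t else 0)
      - (\<Sum>p\<in>P. if t \<in> {p - \<delta>..p + \<delta>} then polar_remainder f M b p t + ?c p else 0))
      absolutely_integrable_on UNIV"
    using reg inn' assms(2)
    by (intro set_integral_diff(1) absolutely_integrable_sum)
      (simp_all only: absolutely_integrable_restrict_UNIV)
  then have "f absolutely_integrable_on outer_part S P \<delta>"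
    unfolding regular_part_split[OF assms(1,2)] add_diff_cancel_right'
      absolutely_integrable_restrict_UNIV .
  then show ?thesis
    using inn assms(4) by (simp add: regularizable_def)
qed

text \<open>Formally this differentiates an integral from -y to y of an even function: both
  endpoints contribute the same value.\<close>

lemma polar_integral_has_derivative:
  assumes "0 < y"
  shows "(polar_integral b M has_vector_derivative 2 * polar_part b M y) (at y)"
proof -
  have "((\<lambda>y. complex_of_real (- 2 / (2 * real m - 1) * y powi (1 - 2 * int m)))
      has_vector_derivative 2 * complex_of_real y powi (- 2 * int m)) (at y)"
    if "1 \<le> m" for m
  proof -
    have "((\<lambda>y. y powi (1 - 2 * int m)) has_real_derivative
        of_int (1 - 2 * int m) * y powi (1 - 2 * int m - 1)) (at y)"
      using assms by (auto intro!: derivative_eq_intros)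
    from DERIV_cmult[OF this, of "- 2 / (2 * real m - 1)"]
    have "((\<lambda>y. - 2 / (2 * real m - 1) * y powi (1 - 2 * int m)) has_real_derivative
        - 2 / (2 * real m - 1) * (of_int (1 - 2 * int m) * y powi (1 - 2 * int m - 1))) (at y)" .
    moreover have "- 2 / (2 * real m - 1) * (of_int (1 - 2 * int m) * y powi (1 - 2 * int m - 1))
        = 2 * y powi (- 2 * int m)"
    proof -
      have "2 * real m - 1 \<noteq> 0"
        using that by linarith
      then show ?thesis
        by (simp add: field_simps)
    qed
    ultimately have "((\<lambda>y. - 2 / (2 * real m - 1) * y powi (1 - 2 * int m)) has_real_derivative
        2 * y powi (- 2 * int m)) (at y)"
      by simp
    from has_vector_derivative_of_real[OF this, where 'a = complex] show ?thesis
      by simp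
  qed
  then have "((\<lambda>y. \<Sum>m=1..M. b m * complex_of_real (- 2 / (2 * real m - 1) * y powi (1 - 2 * int m)))
      has_vector_derivative (\<Sum>m=1..M. b m * (2 * complex_of_real y powi (- 2 * int m)))) (at y)"
    by (intro has_vector_derivative_sum has_vector_derivative_mult_right) simp_all
  then show ?thesis
    unfolding polar_integral_def[abs_def] polar_part_def sum_distrib_left by (simp only: mult_ac)
qed

lemma polar_part_minus: "polar_part b M (- y) = polar_part b M y"
proof -
  have "complex_of_real (- y) powi (- 2 * int m) = complex_of_real y powi (- 2 * int m)" for m
    by (subst (1 2) power_int_mult) simp
  then show ?thesis
    unfolding polar_part_def by (simp only:)
qed

lemma has_integral_polar_part:
  assumes "0 < r" "r \<le> \<delta>"
  shows "((\<lambda>t. polar_part b M (t - p)) has_integral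
    (polar_integral b M \<delta> - polar_integral b M r) / 2) {p + r..p + \<delta>}"
proof -
  have "((\<lambda>t. polar_part b M (t - p)) has_integral
      polar_integral b M (p + \<delta> - p) / 2 - polar_integral b M (p + r - p) / 2) {p + r..p + \<delta>}"
  proof (rule fundamental_theorem_of_calculus)
    fix t
    assume t: "t \<in> {p + r..p + \<delta>}"
    have "((\<lambda>t. t - p) has_vector_derivative 1) (at t)"
      by (auto intro!: derivative_eq_intros)
    from vector_diff_chain_at[OF this polar_integral_has_derivative[of "t - p" b M]]
    have "((\<lambda>t. polar_integral b M (t - p)) has_vector_derivative 2 * polar_part b M (t - p)) (at t)"
      using t assms by (simp add: o_def)
    from has_vector_derivative_divide[OF this, of 2]
    have "((\<lambda>t. polar_integral b M (t - p) / 2) has_vector_derivative polar_part b M (t - p)) (at t)"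
      by simp
    then show "((\<lambda>t. polar_integral b M (t - p) / 2) has_vector_derivative polar_part b M (t - p))
        (at t within {p + r..p + \<delta>})"
      by (rule has_vector_derivative_at_within)
  qed (use assms in simp)
  then show "((\<lambda>t. polar_part b M (t - p)) has_integral
      (polar_integral b M \<delta> - polar_integral b M r) / 2) {p + r..p + \<delta>}"
    by (simp add: diff_divide_distrib)
qed

lemma has_integral_polar_left:
  assumes "0 < r" "r \<le> \<delta>"
  shows "((\<lambda>t. polar_part b M (t - p)) has_integral
    (polar_integral b M \<delta> - polar_integral b M r) / 2) {p - \<delta>..p - r}"
proof -
  have "((\<lambda>t. polar_part b M (- t - - p)) has_integral
      (polar_integral b M \<delta> - polar_integral b M r) / 2) {- (- p + \<delta>)..- (- p + r)}"
    by (rule iffD2[OF has_integral_reflect_real has_integral_polar_part[OF assms]])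
  moreover have "polar_part b M (- t - - p) = polar_part b M (t - p)" for t
    using polar_part_minus[of b M "t - p"] by simp
  ultimately show ?thesis
    by simp
qed

lemma continuous_on_polar_part: "p \<notin> A \<Longrightarrow> continuous_on A (\<lambda>t. polar_part b M (t - p))"
  unfolding polar_part_def
  by (intro continuous_intros) auto

text \<open>Growth of the radius from r to \<delta> adds the integrals of the polar part over two
  shells, altogether the change of \<open>polar_integral\<close>. The constants subtracted in the
  two cuts compensate exactly this amount.\<close>

lemma polar_cut_diff:
  fixes p :: real
  assumes "0 < r" "r \<le> \<delta>"
  shows "(\<lambda>t. polar_cut b M \<delta> (t - p) - polar_cut b M r (t - p)) absolutely_integrable_on UNIV"
     
    and "((\<lambda>t. polar_cut b M \<delta> (t - p) - polar_cut b M r (t - p)) has_integral 0) UNIV"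
proof -
  let ?h = "\<lambda>t. polar_cut b M \<delta> (t - p) - polar_cut b M r (t - p)"
  let ?c = "\<lambda>\<delta>. polar_integral b M \<delta> / complex_of_real (2 * \<delta>)"
  let ?q = "\<lambda>t. polar_part b M (t - p)"
  define g where "g = (\<lambda>t. ((if t \<in> {p - \<delta>..p - r} then ?q t else 0)
      + (if t \<in> {p + r..p + \<delta>} then ?q t else 0))
      + ((if t \<in> {p - r..p + r} then ?c r else 0) - (if t \<in> {p - \<delta>..p + \<delta>} then ?c \<delta> else 0)))"
  \<comment> \<open>At p - r and p + r the closed intervals overlap and g counts the polar part once
    too often; two points are negligible.\<close>
  have hg: "?h t = g t" if "t \<in> UNIV - {p - r, p + r}" for t
    using that assms by (auto simp: g_def polar_cut_def abs_le_iff)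
  have "g absolutely_integrable_on UNIV"
    unfolding g_def
    using assms
    by (intro set_integral_add(1) set_integral_diff(1); subst absolutely_integrable_restrict_UNIV)
      (auto intro!: absolutely_integrable_continuous_real continuous_on_polar_part)
  then show "?h absolutely_integrable_on UNIV"
    by (rule absolutely_integrable_spike[where S = "{p - r, p + r}"]) (use hg in auto)
  have const: "((\<lambda>t. ?c s) has_integral polar_integral b M s) {p - s..p + s}" if "0 < s" for s
    using has_integral_const_real[of "?c s" "p - s" "p + s"] that
    by (simp add: scaleR_conv_of_real)
  have "(g has_integral (((polar_integral b M \<delta> - polar_integral b M r) / 2
      + (polar_integral b M \<delta> - polar_integral b M r) / 2)
      + (polar_integral b M r - polar_integral b M \<delta>))) UNIV"
    unfolding g_def
    by (intro has_integral_add has_integral_diff; subst has_integral_restrict_iff)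
      (use has_integral_polar_part has_integral_polar_left const assms in auto)
  then have g0: "(g has_integral 0) UNIV"
    by simp
  show "(?h has_integral 0) UNIV"
  proof (rule has_integral_spike[where S = "{p - r, p + r}"])
    show "?h t = g t" if "t \<in> UNIV - {p - r, p + r}" for t
      by (rule hg[OF that])
  qed (use g0 in simp_all)
qed

lemma admissible_radius_mono:
  assumes "admissible_radius S P \<delta>" "0 < r" "r \<le> \<delta>"
  shows "admissible_radius S P r"
proof -
  have sub: "{p - r..p + r} \<subseteq> {p - \<delta>..p + \<delta>}" for p
    using assms by auto
  show ?thesis
    using assms sub unfolding admissible_radius_def by blast
qed

text \<open>For the same polar parts, the regular parts of two radii differ by functions with
  integral 0.\<close>

lemma regularized_value_shrink:
  assumes adm: "admissible_radius S P \<delta>" and fin: "finite P" and r: "0 < r" "r \<le> \<delta>"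
    and val: "regularized_value f S P \<delta> I"
  shows "regularized_value f S P r I"
proof -
  obtain M b where b: "regularizable f S P \<delta> M b" "I = regularized_sum f S P \<delta> M b"
    using val by (auto simp: regularized_value_iff)
  let ?h = "\<lambda>p t. polar_cut (b p) (M p) \<delta> (t - p) - polar_cut (b p) (M p) r (t - p)"
  note adm' = admissible_radius_mono[OF adm r]
  have eq: "regular_part f P r M b = (\<lambda>t. regular_part f P \<delta> M b t + (\<Sum>p\<in>P. ?h p t))"
    by (simp add: regular_part_def sum_subtractf fun_eq_iff)
  \<comment> \<open>Both cuts live in an interval contained in S, so their integrals over the line
    and over S agree.\<close>
  have h0: "?h p t = 0" if "t \<notin> S" "p \<in> P" for p t
  proof -
    have "{p - \<delta>..p + \<delta>} \<subseteq> S"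
      using adm that(2) by (simp add: admissible_radius_def)
    then have "t \<notin> {p - \<delta>..p + \<delta>}"
      using that(1) by blast
    then show ?thesis
      using r by (auto simp: polar_cut_def abs_le_iff)
  qed
  have hS: "?h p absolutely_integrable_on S" "(?h p has_integral 0) S" if "p \<in> P" for p
  proof -
    have "(\<lambda>t. if t \<in> S then ?h p t else 0) = ?h p"
      using h0 that by (auto simp: fun_eq_iff)
    then show "?h p absolutely_integrable_on S" "(?h p has_integral 0) S"
      using polar_cut_diff[OF r, of "b p" "M p" p] absolutely_integrable_restrict_UNIV[of S "?h p"]
        has_integral_restrict_iff[of S "?h p" 0]
      by simp_all
  qed
  have "regularizable f S P r M b"
  proof (rule regularizableI_regular_part[OF adm' fin])
    show "regular_part f P r M b absolutely_integrable_on S"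
      unfolding eq
      by (intro set_integral_add(1) absolutely_integrable_sum fin hS regular_part_integral[OF adm fin b(1)])
    show "bounded (polar_remainder f M b p ` ({p - r..p + r} - {p}))" if "p \<in> P" for p
    proof (rule bounded_subset)
      show "bounded (polar_remainder f M b p ` ({p - \<delta>..p + \<delta>} - {p}))"
        using b(1) that by (simp add: regularizable_def)
    qed (use r in auto)
  qed
  moreover have "I = regularized_sum f S P r M b"
  proof -
    have "(regular_part f P \<delta> M b has_integral I) S"
      using regular_part_integral[OF adm fin b(1)] set_lebesgue_integral_eq_integral(1) b(2)
      by (metis integrable_integral)
    then have "(regular_part f P r M b has_integral (I + (\<Sum>p\<in>P. 0))) S"
      unfolding eq by (intro has_integral_add has_integral_sum fin hS)
    then have "integral S (regular_part f P r M b) = I"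
      by (simp add: integral_unique)
    then show ?thesis
      using regular_part_integral(2)[OF adm' fin \<open>regularizable f S P r M b\<close>] by simp
  qed
  ultimately show ?thesis
    unfolding regularized_value_iff by blast
qed

section \<open>The regularized integral: linearity and existence from local data\<close>

lemma has_regularized_integral_iff:
  "has_regularized_integral f S P I \<longleftrightarrow> finite P \<and> (\<exists>\<delta>. admissible_radius S P \<delta>)
     \<and> (\<forall>\<delta>. admissible_radius S P \<delta> \<longrightarrow> regularized_value f S P \<delta> I)"
proof -
  have "{J. regularized_value f S P \<delta> J} = {I} \<longleftrightarrow> regularized_value f S P \<delta> I"
    if "admissible_radius S P \<delta>" for \<delta>
  proof -
    have "0 < \<delta>"
      using that by (simp add: admissible_radius_def)
    from regularized_value_unique[OF this] show ?thesis
      by blast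
  qed
  then show ?thesis
    unfolding has_regularized_integral_def by blast
qed

lemma has_regularized_integral_unique:
  "has_regularized_integral f S P I \<Longrightarrow> has_regularized_integral f S P J \<Longrightarrow> I = J"
  unfolding has_regularized_integral_def by blast

text \<open>Values pass only from a radius to a smaller one, so two radii are compared at their
  minimum, where the value is unique.\<close>

lemma has_regularized_integralI:
  assumes "finite P" "\<And>\<delta>. admissible_radius S P \<delta> \<Longrightarrow> \<exists>I. regularized_value f S P \<delta> I"
    and "admissible_radius S P \<delta>\<^sub>0" "regularized_value f S P \<delta>\<^sub>0 I"
  shows "has_regularized_integral f S P I"
  unfolding has_regularized_integral_iff
proof (intro conjI allI impI exI)
  fix \<delta>
  assume adm: "admissible_radius S P \<delta>"
  obtain J where J: "regularized_value f S P \<delta> J"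
    using assms(2)[OF adm] by blast
  have r: "0 < min \<delta> \<delta>\<^sub>0"
    using adm assms(3) by (simp add: admissible_radius_def)
  have "regularized_value f S P (min \<delta> \<delta>\<^sub>0) J" "regularized_value f S P (min \<delta> \<delta>\<^sub>0) I"
    using regularized_value_shrink[OF _ assms(1) r] adm assms(3,4) J by auto
  then show "regularized_value f S P \<delta> I"
    using regularized_value_unique[OF r] J by blast
qed (use assms in auto)

lemma has_regularized_integral_add:
  "has_regularized_integral f S P I \<Longrightarrow> has_regularized_integral g S P J \<Longrightarrow>
   has_regularized_integral (\<lambda>t. f t + g t) S P (I + J)"
  unfolding has_regularized_integral_iff using regularized_value_add by blast

lemma has_regularized_integral_scale:
  "has_regularized_integral f S P I \<Longrightarrow> has_regularized_integral (\<lambda>t. c * f t) S P (c * I)"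
  unfolding has_regularized_integral_iff using regularized_value_scale by blast

lemma has_regularized_integral_cnj:
  "has_regularized_integral f S P I \<Longrightarrow> has_regularized_integral (\<lambda>t. cnj (f t)) S P (cnj I)"
  unfolding has_regularized_integral_iff using regularized_value_cnj by blast

lemma continuous_on_compact_integrable:
  fixes f :: "real \<Rightarrow> complex"
  assumes "compact K" "continuous_on K f"
  shows "f absolutely_integrable_on K"
  using integrable_completion[of "\<lambda>x. indicator K x *\<^sub>R f x" lborel] borel_integrable_compact[OF assms]
  by (simp add: set_integrable_def)

lemma admissible_radius_point:
  assumes "admissible_radius S P \<delta>" "p \<in> P"
  shows "{p - \<delta>..p + \<delta>} \<subseteq> S" "{p - \<delta>..p + \<delta>} \<inter> P = {p}" "0 < \<delta>"
proof -
  show \<delta>: "0 < \<delta>" "{p - \<delta>..p + \<delta>} \<subseteq> S"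
    using assms by (auto simp: admissible_radius_def)
  have ne: "q \<notin> {p - \<delta>..p + \<delta>}" if "q \<in> P" "q \<noteq> p" for q
  proof
    assume "q \<in> {p - \<delta>..p + \<delta>}"
    moreover have "q \<in> {q - \<delta>..q + \<delta>}"
      using \<delta> by simp
    ultimately show False
      using assms that unfolding admissible_radius_def by blast
  qed
  have "p \<in> {p - \<delta>..p + \<delta>}"
    using \<delta> by simp
  then show "{p - \<delta>..p + \<delta>} \<inter> P = {p}"
    using ne assms(2) by blast
qed

text \<open>The remainder is bounded close to p by its germ and on the rest of the interval by
  continuity on a compact set; being continuous off p, it is integrable. On the outer part,
  compactness settles |t| \<le> R and \<open>tail\<close> settles the remaining t.\<close>

lemma regularizable_of_germs:
  assumes adm: "admissible_radius S P \<delta>" and fin: "finite P" and S: "closed S"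
    and cont: "continuous_on (S - P) f"
    and germ: "\<And>p. p \<in> P \<Longrightarrow> polar_remainder f M b p \<in> O[at p](\<lambda>_. 1)"
    and tail: "f absolutely_integrable_on {t \<in> S. R < \<bar>t\<bar>}"
  shows "regularizable f S P \<delta> M b"
proof -
  have \<delta>: "0 < \<delta>"
    using adm by (simp add: admissible_radius_def)
  have rem_cont: "continuous_on ({p - \<delta>..p + \<delta>} - {p}) (polar_remainder f M b p)" if "p \<in> P" for p
    unfolding polar_remainder_def[abs_def] using admissible_radius_point[OF adm that]
    by (intro continuous_on_diff continuous_on_polar_part continuous_on_subset[OF cont]) auto
  have bdd: "bounded (polar_remainder f M b p ` ({p - \<delta>..p + \<delta>} - {p}))" if "p \<in> P" for p
  proof -
    note germ_p = germ[OF that]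
    obtain c where "eventually (\<lambda>t. norm (polar_remainder f M b p t) \<le> c * norm (1::complex)) (at p)"
      using germ_p by (elim landau_o.bigE)
    then obtain e where e: "0 < e" "\<And>t. t \<noteq> p \<Longrightarrow> \<bar>t - p\<bar> < e \<Longrightarrow> norm (polar_remainder f M b p t) \<le> c"
      by (auto simp: eventually_at dist_real_def)
    have "{p - \<delta>..p + \<delta>} - {p} \<subseteq> ({p - e<..<p + e} - {p}) \<union> ({p - \<delta>..p + \<delta>} - {p - e<..<p + e})"
      by auto
    moreover have "bounded (polar_remainder f M b p ` ({p - e<..<p + e} - {p}))"
      unfolding bounded_iff using e(2) by (intro exI[of _ c]) (auto simp: abs_less_iff)
    moreover have "bounded (polar_remainder f M b p ` ({p - \<delta>..p + \<delta>} - {p - e<..<p + e}))"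
    proof (intro compact_imp_bounded compact_continuous_image)
      show "continuous_on ({p - \<delta>..p + \<delta>} - {p - e<..<p + e}) (polar_remainder f M b p)"
        by (rule continuous_on_subset[OF rem_cont[OF that] Diff_mono[OF order_refl]]) (simp add: e(1))
      show "compact ({p - \<delta>..p + \<delta>} - {p - e<..<p + e})"
        by (rule compact_diff) simp_all
    qed
    ultimately show ?thesis
      using bounded_subset[OF _ image_mono, of "polar_remainder f M b p"] unfolding image_Un bounded_Un
      by (metis (no_types) bounded_Un image_Un)
  qed
  have inn: "polar_remainder f M b p absolutely_integrable_on {p - \<delta>..p + \<delta>}" if "p \<in> P" for p
  proof -
    let ?J = "{p - \<delta>..p + \<delta>} - {p}"
    note bdd_p = bdd[OF that]
    obtain B where B: "\<And>t. t \<in> ?J \<Longrightarrow> norm (polar_remainder f M b p t) \<le> B"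
      using bdd_p unfolding bounded_iff by blast
    have "(\<lambda>t. B) integrable_on ?J"
      using integrable_spike_set_eq[of "{p - \<delta>..p + \<delta>}" ?J "\<lambda>_. B"]
      by (auto intro: negligible_subset[of "{p}"])
    then have "polar_remainder f M b p absolutely_integrable_on ?J"
      using B rem_cont[OF that]
      by (intro measurable_bounded_by_integrable_imp_absolutely_integrable[where g = "\<lambda>_. B"]
          continuous_imp_measurable_on_sets_lebesgue) auto
    then show ?thesis
      by (subst absolutely_integrable_spike_set_eq[where T = ?J]) (auto intro: negligible_subset[of "{p}"])
  qed
  have "f absolutely_integrable_on outer_part S P \<delta>"
  proof (rule set_integrable_subset)
    \<comment> \<open>Removing the open instead of the closed intervals keeps the set compact, and
      it still covers the bounded part of \<open>outer_part\<close>.\<close>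
    let ?K = "(S \<inter> {- R..R}) - (\<Union>p\<in>P. {p - \<delta><..<p + \<delta>})"
    have K: "compact ?K"
      using S by (intro compact_diff closed_Int_compact) auto
    have "continuous_on ?K f"
      using \<delta> by (intro continuous_on_subset[OF cont]) force
    then have "f absolutely_integrable_on ?K"
      by (rule continuous_on_compact_integrable[OF K])
    moreover have "{t \<in> S. R < \<bar>t\<bar>} \<in> sets lebesgue"
    proof -
      have "{t \<in> S. R < \<bar>t\<bar>} = S - {- R..R}"
        by auto
      then show ?thesis
        using S by simp
    qed
    ultimately show "f absolutely_integrable_on {t \<in> S. R < \<bar>t\<bar>} \<union> ?K"
      using tail K by (intro set_integrable_Un) (auto simp: borel_compact)
    show "outer_part S P \<delta> \<in> sets lebesgue"
      using S fin unfolding outer_part_def by (intro sets.Diff sets.finite_UN) auto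
    show "outer_part S P \<delta> \<subseteq> {t \<in> S. R < \<bar>t\<bar>} \<union> ?K"
      by (auto simp: outer_part_def)
  qed
  then show ?thesis
    using bdd inn by (simp add: regularizable_def)
qed

lemma has_regularized_integral_of_germs:
  assumes adm: "admissible_radius S P \<delta>" and fin: "finite P" and S: "closed S"
    and cont: "continuous_on (S - P) f"
    and germ: "\<And>p. p \<in> P \<Longrightarrow> polar_remainder f M b p \<in> O[at p](\<lambda>_. 1)"
    and tail: "f absolutely_integrable_on {t \<in> S. R < \<bar>t\<bar>}"
  shows "has_regularized_integral f S P (regularized_sum f S P \<delta> M b)"
proof (rule has_regularized_integralI[OF fin _ adm])
  show "\<exists>I. regularized_value f S P \<delta>' I" if "admissible_radius S P \<delta>'" for \<delta>'
    using regularizable_of_germs[OF that assms(2-6)] unfolding regularized_value_iff by blast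
  show "regularized_value f S P \<delta> (regularized_sum f S P \<delta> M b)"
    using regularizable_of_germs[OF assms] unfolding regularized_value_iff by blast
qed

section \<open>Dimensions\<close>

text \<open>The kernel of one functional has codimension at most one, and a vector outside it
  extends a basis of the kernel; induction over the functionals builds a finite basis explicitly.
  Linearity is asked for on V only, since the intended functionals read off coefficients of
  expansions, which exist only for members of the space.\<close>

lemma has_dimension_le:
  assumes "finite I" "cfun.subspace V"
    and "\<And>i u v. i \<in> I \<Longrightarrow> u \<in> V \<Longrightarrow> v \<in> V \<Longrightarrow> L i (u + v) = L i u + L i v"
    and "\<And>i c v. i \<in> I \<Longrightarrow> v \<in> V \<Longrightarrow> L i (cscale c v) = c * L i v"
    and "\<And>v. v \<in> V \<Longrightarrow> \<forall>i\<in>I. L i v = 0 \<Longrightarrow> v = 0"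
  shows "\<exists>d\<le>card I. has_dimension V d"
  using assms
proof (induction I arbitrary: V rule: finite_induct)
  case empty
  then have "V = {0}"
    using cfun.subspace_0 by blast
  then have "has_dimension V 0"
    unfolding has_dimension_def
    by (intro exI[of _ "{}"]) (simp add: cfun.independent_empty)
  then show ?case
    by auto
next
  case (insert i I V)
  define V\<^sub>0 where "V\<^sub>0 = {v \<in> V. L i v = 0}"
  have sub0: "cfun.subspace V\<^sub>0"
  proof (rule cfun.subspaceI)
    have z: "0 \<in> V"
      by (rule cfun.subspace_0[OF insert.prems(1)])
    have "L i (0 + 0) = L i 0 + L i 0"
      by (rule insert.prems(2)[OF insertI1 z z])
    then have "L i 0 = 0"
      by (simp only: add_0_left add_cancel_right_right)
    then show "0 \<in> V\<^sub>0"
      using z unfolding V\<^sub>0_def by blast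
    show "u + v \<in> V\<^sub>0" if "u \<in> V\<^sub>0" "v \<in> V\<^sub>0" for u v
    proof -
      have uv: "u \<in> V" "v \<in> V" "L i u + L i v = 0"
        using that by (simp_all add: V\<^sub>0_def)
      then have "L i (u + v) = 0"
        by (simp only: insert.prems(2)[OF insertI1 uv(1,2)])
      then show ?thesis
        using uv cfun.subspace_add[OF insert.prems(1)] unfolding V\<^sub>0_def by blast
    qed
    show "cscale c v \<in> V\<^sub>0" if "v \<in> V\<^sub>0" for c v
      using that insert.prems(3)[of i v c] cfun.subspace_scale[OF insert.prems(1), of v c]
      unfolding V\<^sub>0_def by simp
  qed
  have "\<exists>d\<le>card I. has_dimension V\<^sub>0 d"
  proof (rule insert.IH[OF sub0])
    show "L j (u + v) = L j u + L j v" if "j \<in> I" "u \<in> V\<^sub>0" "v \<in> V\<^sub>0" for j u v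
      using insert.prems(2)[of j u v] that unfolding V\<^sub>0_def by blast
    show "L j (cscale c v) = c * L j v" if "j \<in> I" "v \<in> V\<^sub>0" for j c v
      using insert.prems(3)[of j v c] that unfolding V\<^sub>0_def by blast
    show "v = 0" if "v \<in> V\<^sub>0" "\<forall>j\<in>I. L j v = 0" for v
      using insert.prems(4)[of v] that unfolding V\<^sub>0_def by blast
  qed
  then obtain d B where d: "d \<le> card I" and B: "finite B" "cfun.independent B" "cfun.span B = V\<^sub>0" "card B = d"
    by (auto simp: has_dimension_def)
  show ?case
  proof (cases "V\<^sub>0 = V")
    case True
    then have "has_dimension V d"
      using B by (auto simp: has_dimension_def)
    then show ?thesis
      using d insert.hyps by (intro exI[of _ d]) simp
  next
    case False
    then obtain w where w: "w \<in> V" "w \<notin> V\<^sub>0"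
      by (auto simp: V\<^sub>0_def)
    then have Lw: "L i w \<noteq> 0"
      by (simp add: V\<^sub>0_def)
    have "w \<notin> B"
      using w(2) B(3) cfun.span_base by blast
    have "cfun.span (insert w B) = V"
    proof
      show "cfun.span (insert w B) \<subseteq> V"
        using insert.prems(1) w(1) B(3) cfun.span_superset[of B]
        by (intro cfun.span_minimal) (auto simp: V\<^sub>0_def)
      show "V \<subseteq> cfun.span (insert w B)"
      proof
        fix u
        assume u: "u \<in> V"
        let ?k = "L i u / L i w"
        have "u + cscale (- ?k) w \<in> V"
          using u w(1) insert.prems(1) cfun.subspace_add cfun.subspace_scale by blast
        moreover have "L i (u + cscale (- ?k) w) = 0"
        proof -
          have "L i (u + cscale (- ?k) w) = L i u + (- ?k) * L i w"
            by (simp only: insert.prems(2)[OF insertI1 u cfun.subspace_scale[OF insert.prems(1) w(1)]]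
                insert.prems(3)[OF insertI1 w(1)])
          then show ?thesis
            using Lw by (simp only:) simp
        qed
        ultimately have "u + cscale (- ?k) w \<in> cfun.span B"
          by (simp add: B(3) V\<^sub>0_def)
        then have "u - cscale ?k w \<in> cfun.span B"
          by (simp only: cfun.scale_minus_left add_uminus_conv_diff)
        then show "u \<in> cfun.span (insert w B)"
          unfolding cfun.span_breakdown_eq by blast
      qed
    qed
    moreover have "cfun.independent (insert w B)"
      using B(2,3) w(2) \<open>w \<notin> B\<close> by (simp add: cfun.independent_insert)
    ultimately have "has_dimension V (Suc d)"
      unfolding has_dimension_def using B(1,4) \<open>w \<notin> B\<close> by (intro exI[of _ "insert w B"]) simp
    then show ?thesis
      using d insert.hyps by (intro exI[of _ "Suc d"]) simp
  qed
qed

lemma span_image_eq_range: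
  assumes "finite I" "inj_on e I"
  shows "cfun.span (e ` I) = range (\<lambda>c. \<Sum>i\<in>I. cscale (c i) (e i))"
proof -
  have "(\<Sum>v\<in>e ` I. cscale (u v) v) = (\<Sum>i\<in>I. cscale (u (e i)) (e i))" for u
    using assms(2) by (simp add: sum.reindex)
  moreover have "\<exists>u. (\<Sum>i\<in>I. cscale (c i) (e i)) = (\<Sum>i\<in>I. cscale (u (e i)) (e i))" for c
    by (intro exI[of _ "\<lambda>v. c (inv_into I e v)"] sum.cong) (simp_all add: assms(2))
  ultimately show ?thesis
    using assms(1) by (auto simp: cfun.span_finite image_def)
qed

text \<open>The hypothesis concerns the indexed family rather than its image: a repeated vector
  would give the vanishing combination e i - e j, so it also forces injectivity and the full
  cardinality of the basis.\<close>

lemma has_dimension_span_image: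
  assumes "finite I"
    and ne: "\<And>c. \<exists>i\<in>I. c i \<noteq> 0 \<Longrightarrow> (\<Sum>i\<in>I. cscale (c i) (e i)) \<noteq> 0"
  shows "inj_on e I" "has_dimension (cfun.span (e ` I)) (card I)"
proof -
  show inj: "inj_on e I"
  proof (rule inj_onI, rule ccontr)
    fix i j
    assume ij: "i \<in> I" "j \<in> I" "e i = e j" "i \<noteq> j"
    define c :: "'a \<Rightarrow> complex" where "c k = (if k = i then 1 else if k = j then - 1 else 0)" for k
    have "(\<Sum>k\<in>I. cscale (c k) (e k)) = (\<Sum>k\<in>{i, j}. cscale (c k) (e k))"
      using ij assms(1) by (intro sum.mono_neutral_right) (auto simp: c_def)
    also have "\<dots> = 0"
      using ij by (simp add: c_def)
    finally have "(\<Sum>k\<in>I. cscale (c k) (e k)) = 0" .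
    then show False
    proof -
      have "c i \<noteq> 0"
        by (simp add: c_def)
      then show ?thesis
        using ne[of c] ij(1) \<open>(\<Sum>k\<in>I. cscale (c k) (e k)) = 0\<close> by blast
    qed
  qed
  have "cfun.independent (e ` I)"
  proof
    assume "cfun.dependent (e ` I)"
    then obtain u where u: "\<exists>v\<in>e ` I. u v \<noteq> 0" "(\<Sum>v\<in>e ` I. cscale (u v) v) = 0"
      using assms(1) by (auto simp: cfun.dependent_finite)
    have "(\<Sum>i\<in>I. cscale (u (e i)) (e i)) = 0"
      using u(2) inj by (simp add: sum.reindex)
    then show False
      using ne[of "u \<circ> e"] u(1) by auto
  qed
  then show "has_dimension (cfun.span (e ` I)) (card I)"
    unfolding has_dimension_def
    using assms(1) inj by (intro exI[of _ "e ` I"]) (simp add: card_image)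
qed

section \<open>Negativity of the singular part\<close>

text \<open>In this form \<open>l_order k\<close> is visibly the number of j with 2 j < k, that is,
  of the negative exponents -(k - 2 j).\<close>

lemma l_order_eq: "l_order k = (k + 1) div 2"
proof -
  have "(real k + 1) / 2 = real (k + 1) / real 2"
    by simp
  then show ?thesis
    unfolding l_order_def by (simp only: floor_divide_of_nat_eq nat_int)
qed

text \<open>Two indices at or above \<open>l_order d\<close> add up to at least d, so j + k + m = d
  leaves no room for m \<ge> 1.\<close>

lemma product_coeff_regular:
  assumes "\<And>k. k < l_order d \<Longrightarrow> a k = 0" "1 \<le> m"
  shows "product_coeff d a a m = 0"
  unfolding product_coeff_def
proof (intro sum.neutral ballI)
  fix j k
  have "a j = 0 \<or> a k = 0" if "j + k + m = d"
  proof -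
    have "j < l_order d \<or> k < l_order d"
      using that assms(2) by (auto simp: l_order_eq)
    then show ?thesis
      using assms(1) by blast
  qed
  then show "(if j + k + m = d then a j * cnj (a k) else 0) = 0"
    by auto
qed

text \<open>Two indices below \<open>l_order d\<close> add up to less than d, so a product of
  negative powers contains no nonnegative power and nothing remains beside the polar part.\<close>

lemma singular_sum_norm:
  assumes "\<And>k. l_order d \<le> k \<Longrightarrow> a k = 0"
  shows "polar_part (product_coeff d a a) d y = complex_of_real ((cmod (singular_sum a d y))\<^sup>2)"
proof (cases "y = 0")
  \<comment> \<open>A nonzero power of 0 has the value 0, so the identity persists at the singular
    point itself and the later estimates hold on whole intervals.\<close>
  case True
  have "a k * complex_of_real y powi (- (int d - 2 * int k)) = 0" for k
  proof (cases "k < l_order d")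
    case True
    then have "- (int d - 2 * int k) \<noteq> 0"
      unfolding l_order_eq by presburger
    then show ?thesis
      using \<open>y = 0\<close> by (simp add: power_int_0_left_if)
  next
    case False
    then show ?thesis
      using assms[of k] by simp
  qed
  then have "singular_sum a d y = 0"
    unfolding singular_sum_def by (intro sum.neutral) blast
  moreover have "polar_part (product_coeff d a a) d y = 0"
    using True unfolding polar_part_def by (intro sum.neutral) (auto simp: power_int_0_left_if)
  ultimately show ?thesis
    by simp
next
  case False
  have "(\<Sum>j=0..d. \<Sum>k=0..d. if d \<le> j + k
        then a j * cnj (a k) * complex_of_real y ^ (2 * (j + k - d)) else 0) = 0"
  proof (intro sum.neutral ballI)
    fix j k
    have "a j = 0 \<or> a k = 0" if "d \<le> j + k"
    proof -
      have "l_order d \<le> j \<or> l_order d \<le> k"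
        using that unfolding l_order_eq by presburger
      then show ?thesis
        using assms by blast
    qed
    then show "(if d \<le> j + k then a j * cnj (a k) * complex_of_real y ^ (2 * (j + k - d)) else 0) = 0"
      by auto
  qed
  then show ?thesis
    using singular_sum_mult_cnj[OF False, of a d a] by (simp add: complex_norm_square del: of_real_power)
qed

lemma polar_integral_tendsto_0: "(polar_integral b M \<longlongrightarrow> 0) at_top"
proof -
  have "((\<lambda>\<delta>. complex_of_real (- 2 / (2 * real m - 1) * \<delta> powi (1 - 2 * int m))) \<longlongrightarrow> 0) at_top"
    if "1 \<le> m" for m
  proof -
    have "((\<lambda>\<delta>::real. inverse (\<delta> ^ (2 * m - 1))) \<longlongrightarrow> 0) at_top"
      using that by (intro tendsto_inverse_0_at_top filterlim_pow_at_top filterlim_ident) auto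
    moreover have "inverse (\<delta> ^ (2 * m - 1)) = \<delta> powi (1 - 2 * int m)" for \<delta> :: real
    proof -
      have "1 - 2 * int m = - int (2 * m - 1)"
        using that by auto
      then show ?thesis
        by (simp only: power_int_minus power_int_of_nat)
    qed
    ultimately have "((\<lambda>\<delta>::real. \<delta> powi (1 - 2 * int m)) \<longlongrightarrow> 0) at_top"
      by simp
    from tendsto_of_real[OF tendsto_mult_right_zero[OF this, of "- 2 / (2 * real m - 1)"], where 'a = complex]
    show ?thesis
      by simp
  qed
  then have "((\<lambda>\<delta>. \<Sum>m=1..M. b m * complex_of_real (- 2 / (2 * real m - 1) * \<delta> powi (1 - 2 * int m)))
      \<longlongrightarrow> (\<Sum>m=1..M. b m * 0)) at_top"
    by (intro tendsto_sum tendsto_mult tendsto_const) auto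
  then show ?thesis
    by (simp only: polar_integral_def[abs_def]) simp
qed

text \<open>As a function of the radius the regularized integral of a polar part that is nonnegative
  on the real axis increases to \<open>0\<close>: formally it is minus the integral over the complement of
  the interval.\<close>

lemma polar_integral_nonpos:
  assumes pos: "\<And>y. 0 < y \<Longrightarrow> 0 \<le> Re (polar_part b M y)" and "0 < r"
  shows "Re (polar_integral b M r) \<le> 0"
    and "Re (polar_integral b M r) = 0 \<Longrightarrow> r < y \<Longrightarrow> Re (polar_part b M y) = 0"
proof -
  let ?\<phi> = "\<lambda>y. Re (polar_integral b M y)"
  have der: "(?\<phi> has_real_derivative 2 * Re (polar_part b M y)) (at y)" if "0 < y" for y
    using bounded_linear.has_vector_derivative[OF bounded_linear_Re
        polar_integral_has_derivative[OF that, of b M]]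
    by (simp add: has_real_derivative_iff_has_vector_derivative)
  have mono: "?\<phi> u \<le> ?\<phi> v" if "0 < u" "u \<le> v" for u v
    using that(2)
  proof (rule DERIV_nonneg_imp_nondecreasing)
    fix y
    assume "u \<le> y"
    then show "\<exists>z. (?\<phi> has_real_derivative z) (at y) \<and> 0 \<le> z"
      using der[of y] pos[of y] that(1) by (intro exI[of _ "2 * Re (polar_part b M y)"]) simp
  qed
  have lim: "(?\<phi> \<longlongrightarrow> 0) at_top"
    using tendsto_Re[OF polar_integral_tendsto_0[of b M]] by simp
  have le: "?\<phi> u \<le> 0" if "0 < u" for u
    by (rule tendsto_lowerbound[OF lim]) (auto intro!: eventually_at_top_linorderI[of u] mono that)
  show "?\<phi> r \<le> 0"
    using le assms(2) .
  show "Re (polar_part b M y) = 0" if "?\<phi> r = 0" "r < y"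
  proof -
    \<comment> \<open>A nondecreasing function that is bounded by 0 and already vanishes at r is
      constant beyond r; its derivative there is twice the polar part.\<close>
    have zero: "0 = ?\<phi> u" if "u \<in> {r<..}" for u
      using mono[of r u] le[of u] that assms(2) \<open>?\<phi> r = 0\<close> by simp
    have "((\<lambda>u. 0) has_real_derivative 0) (at y)"
      by simp
    then have "(?\<phi> has_real_derivative 0) (at y)"
      by (rule has_field_derivative_transform_within_open[OF _ open_greaterThan _ zero])
        (use that(2) in simp_all)
    from DERIV_unique[OF der this] show ?thesis
      using that(2) assms(2) by simp
  qed
qed

text \<open>After the pole is cleared, the polynomial in z = y^2 has infinitely many roots.\<close>

lemma singular_sum_eq_0_imp:
  assumes "\<And>y. r < y \<Longrightarrow> singular_sum a d y = 0" "0 < r" "k \<le> d"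
  shows "a k = 0"
proof (rule ccontr)
  assume "a k \<noteq> 0"
  then have "finite {z. (\<Sum>i\<le>d. a i * z ^ i) = 0}"
    unfolding polyfun_finite_roots using assms(3) by blast
  moreover have "(\<lambda>y. complex_of_real (y\<^sup>2)) ` {r<..} \<subseteq> {z. (\<Sum>i\<le>d. a i * z ^ i) = 0}"
  proof
    fix z
    assume "z \<in> (\<lambda>y. complex_of_real (y\<^sup>2)) ` {r<..}"
    then obtain y where y: "r < y" "z = complex_of_real y ^ 2"
      by auto
    then show "z \<in> {z. (\<Sum>i\<le>d. a i * z ^ i) = 0}"
      using singular_sum_eq[where y = y and d = d and a = a] assms by (simp add: power_mult[symmetric])
  qed
  moreover have "inj_on (\<lambda>y. complex_of_real (y\<^sup>2)) {r<..}"
    using assms(2) by (auto simp: inj_on_def power2_eq_iff simp flip: of_real_power)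
  ultimately have "finite {r<..}"
    using finite_imageD finite_subset by blast
  then show False
    by (simp add: infinite_Ioi)
qed

text \<open>The value is formally minus the integral of |q|^2 over |y| > r. If it were 0, then q
  would vanish there and so would all its coefficients.\<close>

lemma polar_integral_product_neg:
  assumes "\<And>k. l_order d \<le> k \<Longrightarrow> a k = 0" "0 < r"
  shows "Re (polar_integral (product_coeff d a a) d r) \<le> 0"
    and "a k \<noteq> 0 \<Longrightarrow> Re (polar_integral (product_coeff d a a) d r) < 0"
proof -
  have pos: "0 \<le> Re (polar_part (product_coeff d a a) d y)" for y
    using singular_sum_norm[OF assms(1)] by simp
  show le: "Re (polar_integral (product_coeff d a a) d r) \<le> 0"
    using polar_integral_nonpos(1)[OF pos assms(2)] .
  show "Re (polar_integral (product_coeff d a a) d r) < 0" if "a k \<noteq> 0"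
  proof (rule ccontr)
    assume "\<not> ?thesis"
    then have eq: "Re (polar_integral (product_coeff d a a) d r) = 0"
      using le by simp
    have "singular_sum a d y = 0" if "r < y" for y
      using polar_integral_nonpos(2)[OF pos assms(2) eq that] singular_sum_norm[OF assms(1), where y = y]
      by simp
    moreover have "k \<le> d"
    proof -
      have "k < l_order d"
        using assms(1) that not_less by blast
      then show ?thesis
        unfolding l_order_eq by presburger
    qed
    ultimately show False
      using singular_sum_eq_0_imp[OF _ assms(2)] that by blast
  qed
qed

lemma Re_integral_nonneg:
  fixes f :: "real \<Rightarrow> complex"
  assumes "f absolutely_integrable_on A" "\<And>t. t \<in> A \<Longrightarrow> 0 \<le> Re (f t)"
  shows "0 \<le> Re (integral A f)"
proof -
  have "(f has_integral integral A f) A"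
    using assms(1) set_lebesgue_integral_eq_integral(1) by blast
  from has_integral_linear[OF this bounded_linear_Re] show ?thesis
    by (rule has_integral_nonneg) (simp add: assms(2))
qed

lemma Re_integral_nonpos:
  fixes f :: "real \<Rightarrow> complex"
  assumes "f absolutely_integrable_on A" "\<And>t. t \<in> A \<Longrightarrow> Re (f t) \<le> 0"
  shows "Re (integral A f) \<le> 0"
  using Re_integral_nonneg[where f = "\<lambda>t. - f t" and A = A] assms absolutely_integrable_linear[OF assms(1) bounded_linear_minus[OF bounded_linear_ident]]
  by (simp add: o_def)

lemma exists_admissible_radius:
  assumes "finite P" "P \<subseteq> interior S"
  shows "\<exists>\<delta>. admissible_radius S P \<delta>"
  using assms
proof (induction P rule: finite_induct)
  case empty
  then show ?case
    by (intro exI[of _ 1]) (simp add: admissible_radius_def)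
next
  case (insert p P)
  obtain \<delta> where \<delta>: "admissible_radius S P \<delta>"
    using insert by auto
  obtain \<epsilon> where \<epsilon>: "0 < \<epsilon>" "cball p \<epsilon> \<subseteq> S"
    using insert.prems by (auto simp: mem_interior_cball)
  obtain d where d: "0 < d" "\<And>q. q \<in> P \<Longrightarrow> q \<noteq> p \<Longrightarrow> d \<le> dist p q"
    using finite_set_avoid[OF insert.hyps(1), of p] by auto
  \<comment> \<open>With r \<le> d / 3, closed intervals of radius r around points at distance at
    least d are disjoint.\<close>
  define r where "r = min \<delta> (min \<epsilon> (d / 3))"
  have r: "0 < r" "r \<le> \<delta>" "r \<le> \<epsilon>" "r \<le> d / 3"
    using \<delta> \<epsilon> d by (auto simp: r_def admissible_radius_def)
  have adm: "admissible_radius S P r"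
    by (rule admissible_radius_mono[OF \<delta> r(1,2)])
  have sep: "{p - r..p + r} \<inter> {q - r..q + r} = {}" if "q \<in> P" for q
  proof -
    have "d \<le> \<bar>p - q\<bar>"
      using d(2)[OF that] insert.hyps(2) that by (auto simp: dist_real_def)
    then show ?thesis
      using r(1,4) by auto
  qed
  have "{p - r..p + r} \<subseteq> cball p \<epsilon>"
    using r(3) by (auto simp: dist_real_def)
  then have "{p - r..p + r} \<subseteq> S"
    using \<epsilon>(2) by blast
  then have "admissible_radius S (insert p P) r"
  proof -
    have "{q - r..q + r} \<inter> {p - r..p + r} = {}" if "q \<in> P" for q
      using sep[OF that] by blast
    note sep' = this
    have sub: "\<And>q. q \<in> P \<Longrightarrow> {q - r..q + r} \<subseteq> S"
      and dis: "\<And>q q'. q \<in> P \<Longrightarrow> q' \<in> P \<Longrightarrow> q \<noteq> q' \<Longrightarrow> {q - r..q + r} \<inter> {q' - r..q' + r} = {}"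
      using adm unfolding admissible_radius_def by meson+
    show ?thesis
      unfolding admissible_radius_def
    proof (intro conjI ballI impI)
      show "{q - r..q + r} \<subseteq> S" if "q \<in> insert p P" for q
        using that sub \<open>{p - r..p + r} \<subseteq> S\<close> by (elim insertE) simp_all
      show "{q - r..q + r} \<inter> {q' - r..q' + r} = {}"
        if "q \<in> insert p P" "q' \<in> insert p P" "q \<noteq> q'" for q q'
        using that(1,2)
      proof (elim insertE)
        assume "q = p" "q' = p"
        then show ?thesis
          using that(3) by simp
      qed (use sep sep' dis that(3) in blast)+
    qed (rule r(1))
  qed
  then show ?case
    by blast
qed

lemma has_expansion_singular_sum: "has_expansion (\<lambda>t. singular_sum a d (t - p)) p d a"
  by (simp add: has_expansion_def)

lemma has_expansion_zero:
  assumes "eventually (\<lambda>t. \<Psi> t = 0) (at p)"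
  shows "has_expansion \<Psi> p d (\<lambda>_. 0)"
proof (rule has_expansion_transform[OF has_expansion_singular_sum])
  show "eventually (\<lambda>t. singular_sum (\<lambda>_. 0) d (t - p) = \<Psi> t) (at p)"
    using assms by eventually_elim (simp add: singular_sum_def)
qed

lemma eventually_at_interval:
  "0 < \<delta> \<Longrightarrow> eventually (\<lambda>t. t \<noteq> p \<and> \<bar>t - p\<bar> < \<delta>) (at (p::real))"
  by (auto simp: eventually_at dist_real_def)

section \<open>Spaces of functions with prescribed singularities\<close>

text \<open>Both cases are instances: \<open>S\<close> is the line or a closed period, and \<open>extend\<close> says that a
  function concentrated near finitely many points of \<open>S\<close> is the restriction of an element of
  the space, in the periodic case of its quasi-periodic continuation.\<close>

locale singular_space =
  fixes S P :: "real set" and \<nu> :: "real \<Rightarrow> nat" and F :: "(real \<Rightarrow> complex) set"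
    and is_product :: "(real \<Rightarrow> complex) \<Rightarrow> (real \<Rightarrow> complex) \<Rightarrow> complex \<Rightarrow> bool"
    and ip :: "(real \<Rightarrow> complex) \<Rightarrow> (real \<Rightarrow> complex) \<Rightarrow> complex"
  assumes closed_S: "closed S" and interior_S: "interior S \<noteq> {}"
    and finite_P: "finite P" and P_interior: "P \<subseteq> interior S"
    and subspace: "cfun.subspace F"
    and smooth: "\<Psi> \<in> F \<Longrightarrow> smooth_on (interior S - P) \<Psi>"
    and cont: "\<Psi> \<in> F \<Longrightarrow> continuous_on (S - P) \<Psi>"
    and tail: "\<Psi> \<in> F \<Longrightarrow> \<Phi> \<in> F \<Longrightarrow>
      \<exists>R. (\<lambda>t. \<Psi> t * cnj (\<Phi> t)) absolutely_integrable_on {t \<in> S. R < \<bar>t\<bar>}"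
    and expansion: "\<Psi> \<in> F \<Longrightarrow> p \<in> P \<Longrightarrow> singular_expansion \<Psi> p (\<nu> p)"
    and determined: "\<Psi> \<in> F \<Longrightarrow> (\<And>t. t \<in> interior S - P \<Longrightarrow> \<Psi> t = 0) \<Longrightarrow> \<Psi> = 0"
    and extend: "compact K \<Longrightarrow> K \<subseteq> interior S \<Longrightarrow> smooth_on (- P) g \<Longrightarrow> (\<And>t. t \<notin> K \<Longrightarrow> g t = 0) \<Longrightarrow>
      (\<And>p. p \<in> P \<Longrightarrow> g p = 0 \<and> singular_expansion g p (\<nu> p)) \<Longrightarrow> \<exists>\<Psi>\<in>F. \<forall>t\<in>S. \<Psi> t = g t"
    and product: "\<Psi> \<in> F \<Longrightarrow> \<Phi> \<in> F \<Longrightarrow>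
      is_product \<Psi> \<Phi> I \<longleftrightarrow> has_regularized_integral (\<lambda>t. \<Psi> t * cnj (\<Phi> t)) S P I"
    and ip_def: "ip \<Psi> \<Phi> = (THE I. is_product \<Psi> \<Phi> I)"
begin

section \<open>The product as a Hermitian form\<close>

lemma product_germ:
  assumes "p \<in> P \<Longrightarrow> has_expansion \<Psi> p (\<nu> p) (a p)" "p \<in> P \<Longrightarrow> has_expansion \<Phi> p (\<nu> p) (b p)" "p \<in> P"
  shows "polar_remainder (\<lambda>t. \<Psi> t * cnj (\<Phi> t)) \<nu> (\<lambda>p. product_coeff (\<nu> p) (a p) (b p)) p \<in> O[at p](\<lambda>_. 1)"
  using has_expansion_mult_cnj[OF assms(1)[OF assms(3)] assms(2)[OF assms(3)]]
  by (simp add: polar_remainder_def[abs_def])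

lemma cont_product:
  "\<Psi> \<in> F \<Longrightarrow> \<Phi> \<in> F \<Longrightarrow> continuous_on (S - P) (\<lambda>t. \<Psi> t * cnj (\<Phi> t))"
  using cont by (intro continuous_intros) auto

lemma product_regularizable:
  assumes "\<Psi> \<in> F" "\<Phi> \<in> F" "admissible_radius S P \<delta>"
    and "\<And>p. p \<in> P \<Longrightarrow> polar_remainder (\<lambda>t. \<Psi> t * cnj (\<Phi> t)) M b p \<in> O[at p](\<lambda>_. 1)"
  shows "regularizable (\<lambda>t. \<Psi> t * cnj (\<Phi> t)) S P \<delta> M b"
  using tail[OF assms(1,2)]
    regularizable_of_germs[OF assms(3) finite_P closed_S cont_product[OF assms(1,2)] assms(4)]
  by blast

lemma is_product_sum:
  assumes "\<Psi> \<in> F" "\<Phi> \<in> F" "admissible_radius S P \<delta>"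
    and "\<And>p. p \<in> P \<Longrightarrow> polar_remainder (\<lambda>t. \<Psi> t * cnj (\<Phi> t)) M b p \<in> O[at p](\<lambda>_. 1)"
  shows "is_product \<Psi> \<Phi> (regularized_sum (\<lambda>t. \<Psi> t * cnj (\<Phi> t)) S P \<delta> M b)"
  unfolding product[OF assms(1,2)]
  using tail[OF assms(1,2)]
    has_regularized_integral_of_germs[OF assms(3) finite_P closed_S cont_product[OF assms(1,2)] assms(4)]
  by blast

lemma ex1_is_product:
  assumes "\<Psi> \<in> F" "\<Phi> \<in> F"
  shows "\<exists>!I. is_product \<Psi> \<Phi> I"
proof -
  obtain \<delta> where \<delta>: "admissible_radius S P \<delta>"
    using exists_admissible_radius[OF finite_P P_interior] by blast
  have "\<forall>p\<in>P. \<exists>a. has_expansion \<Psi> p (\<nu> p) a" "\<forall>p\<in>P. \<exists>b. has_expansion \<Phi> p (\<nu> p) b"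
    using expansion assms by (auto simp: singular_expansion_iff)
  then obtain a b where "\<And>p. p \<in> P \<Longrightarrow> has_expansion \<Psi> p (\<nu> p) (a p)"
      "\<And>p. p \<in> P \<Longrightarrow> has_expansion \<Phi> p (\<nu> p) (b p)"
    by metis
  from is_product_sum[OF assms \<delta> product_germ[OF this]] show ?thesis
    unfolding product[OF assms] using has_regularized_integral_unique by blast
qed

lemma is_product_ip: "\<Psi> \<in> F \<Longrightarrow> \<Phi> \<in> F \<Longrightarrow> is_product \<Psi> \<Phi> (ip \<Psi> \<Phi>)"
  unfolding ip_def by (rule theI') (rule ex1_is_product)

lemma ip_eqI: "\<Psi> \<in> F \<Longrightarrow> \<Phi> \<in> F \<Longrightarrow> is_product \<Psi> \<Phi> I \<Longrightarrow> ip \<Psi> \<Phi> = I"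
  using is_product_ip ex1_is_product by blast

lemma hermitian: "hermitian_form F ip"
  unfolding hermitian_form_def
proof (intro conjI ballI allI)
  fix \<Psi> \<Phi> \<Omega>
  assume F: "\<Psi> \<in> F" "\<Phi> \<in> F" "\<Omega> \<in> F"
  have "\<Psi> + \<Phi> \<in> F"
    using F(1,2) cfun.subspace_add[OF subspace] by blast
  moreover have "has_regularized_integral (\<lambda>t. \<Psi> t * cnj (\<Omega> t) + \<Phi> t * cnj (\<Omega> t)) S P (ip \<Psi> \<Omega> + ip \<Phi> \<Omega>)"
    using is_product_ip F product by (intro has_regularized_integral_add) blast+
  moreover have "(\<lambda>t. \<Psi> t * cnj (\<Omega> t) + \<Phi> t * cnj (\<Omega> t)) = (\<lambda>t. (\<Psi> + \<Phi>) t * cnj (\<Omega> t))"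
    by (simp add: fun_eq_iff algebra_simps)
  ultimately show "ip (\<Psi> + \<Phi>) \<Omega> = ip \<Psi> \<Omega> + ip \<Phi> \<Omega>"
    using F(3) product ip_eqI by metis
next
  fix c \<Psi> \<Phi>
  assume F: "\<Psi> \<in> F" "\<Phi> \<in> F"
  have "cscale c \<Psi> \<in> F"
    using F(1) cfun.subspace_scale[OF subspace] by blast
  moreover have "has_regularized_integral (\<lambda>t. c * (\<Psi> t * cnj (\<Phi> t))) S P (c * ip \<Psi> \<Phi>)"
    using is_product_ip F product by (intro has_regularized_integral_scale) blast+
  moreover have "(\<lambda>t. c * (\<Psi> t * cnj (\<Phi> t))) = (\<lambda>t. cscale c \<Psi> t * cnj (\<Phi> t))"
    by (simp add: fun_eq_iff cscale_def)
  ultimately show "ip (cscale c \<Psi>) \<Phi> = c * ip \<Psi> \<Phi>"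
    using F(2) product ip_eqI by metis
next
  fix \<Psi> \<Phi>
  assume F: "\<Psi> \<in> F" "\<Phi> \<in> F"
  have "has_regularized_integral (\<lambda>t. cnj (\<Psi> t * cnj (\<Phi> t))) S P (cnj (ip \<Psi> \<Phi>))"
    using is_product_ip F product by (intro has_regularized_integral_cnj) blast+
  moreover have "(\<lambda>t. cnj (\<Psi> t * cnj (\<Phi> t))) = (\<lambda>t. \<Phi> t * cnj (\<Psi> t))"
    by (simp add: fun_eq_iff)
  ultimately show "ip \<Phi> \<Psi> = cnj (ip \<Psi> \<Phi>)"
    using F product ip_eqI by metis
qed

section \<open>Localized products, nondegeneracy and positive vectors\<close>

lemma ip_localized:
  assumes F: "\<Psi> \<in> F" "\<Phi> \<in> F" and ab: "{a..b} \<subseteq> interior S - P"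
    and zero: "\<And>t. t \<in> S - {a..b} \<Longrightarrow> \<Psi> t * cnj (\<Phi> t) = 0"
  shows "ip \<Psi> \<Phi> = integral {a..b} (\<lambda>t. \<Psi> t * cnj (\<Phi> t))"
proof -
  let ?f = "\<lambda>t. \<Psi> t * cnj (\<Phi> t)"
  \<comment> \<open>A radius admissible for the complement of [a, b] keeps the intervals about P
    where the product vanishes. The polar parts can then be taken empty, and the outer part contains
    all of [a, b].\<close>
  have "P \<subseteq> interior (S - {a..b})"
    using P_interior ab by (auto simp: interior_diff)
  then obtain \<delta> where \<delta>: "admissible_radius (S - {a..b}) P \<delta>"
    using exists_admissible_radius[OF finite_P] by blast
  have sub: "{p - \<delta>..p + \<delta>} \<subseteq> S - {a..b}" if "p \<in> P" for p
    by (rule admissible_radius_point(1)[OF \<delta> that])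
  have adm: "admissible_radius S P \<delta>"
    using \<delta> unfolding admissible_radius_def by blast
  have pos: "0 < \<delta>"
    using \<delta> by (simp add: admissible_radius_def)
  have rem: "polar_remainder ?f (\<lambda>_. 0) (\<lambda>_ _. 0) p = ?f" for p
    by (simp add: polar_remainder_def polar_part_def fun_eq_iff)
  have f0: "?f t = 0" if "p \<in> P" "t \<in> {p - \<delta>..p + \<delta>}" for p t
    using sub[OF that(1)] that(2) by (intro zero) blast
  have germ: "polar_remainder ?f (\<lambda>_. 0) (\<lambda>_ _. 0) p \<in> O[at p](\<lambda>_. 1)" if "p \<in> P" for p
    unfolding rem
  proof (rule bigo_transform[of "\<lambda>_. 0"])
    show "eventually (\<lambda>t. 0 = ?f t) (at p)"
      using eventually_at_interval[OF pos, of p]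
    proof eventually_elim
      case (elim t)
      then show ?case
        using f0[OF that, of t] by (simp add: abs_less_iff)
    qed
  qed simp
  have "{a..b} \<subseteq> outer_part S P \<delta>"
    using sub ab interior_subset[of S] unfolding outer_part_def by blast
  moreover have "?f absolutely_integrable_on outer_part S P \<delta>"
    using product_regularizable[OF F adm germ] by (simp add: regularizable_def)
  moreover have "?f t = 0" if "t \<in> outer_part S P \<delta> - {a..b}" for t
    using that by (intro zero) (auto simp: outer_part_def)
  ultimately have "integral (outer_part S P \<delta>) ?f = integral {a..b} ?f"
  proof -
    have "(?f has_integral integral (outer_part S P \<delta>) ?f) (outer_part S P \<delta>)"
      using \<open>?f absolutely_integrable_on outer_part S P \<delta>\<close> set_lebesgue_integral_eq_integral(1) by blast
    have "{t \<in> outer_part S P \<delta> - {a..b}. ?f t \<noteq> 0} = {}"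
      "{t \<in> {a..b} - outer_part S P \<delta>. ?f t \<noteq> 0} = {}"
      using \<open>{a..b} \<subseteq> outer_part S P \<delta>\<close> \<open>\<And>t. t \<in> outer_part S P \<delta> - {a..b} \<Longrightarrow> ?f t = 0\<close> by blast+
    then have "negligible {t \<in> outer_part S P \<delta> - {a..b}. ?f t \<noteq> 0}"
      "negligible {t \<in> {a..b} - outer_part S P \<delta>. ?f t \<noteq> 0}"
      by (simp_all only: negligible_empty)
    from has_integral_spike_set_eq[OF this]
    have "(?f has_integral integral (outer_part S P \<delta>) ?f) {a..b}"
      using \<open>(?f has_integral integral (outer_part S P \<delta>) ?f) (outer_part S P \<delta>)\<close> by blast
    then show ?thesis
      by (simp add: integral_unique)
  qed
  moreover have "integral {p - \<delta>..p + \<delta>} ?f = 0" if "p \<in> P" for p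
  proof -
    have "integral {p - \<delta>..p + \<delta>} ?f = integral {p - \<delta>..p + \<delta>} (\<lambda>_. 0)"
      by (rule integral_cong) (rule f0[OF that])
    then show ?thesis
      by simp
  qed
  ultimately have "regularized_sum ?f S P \<delta> (\<lambda>_. 0) (\<lambda>_ _. 0) = integral {a..b} ?f"
    unfolding regularized_sum_def rem by (simp add: polar_integral_def)
  then show ?thesis
    using ip_eqI[OF F is_product_sum[OF F adm germ]] by simp
qed

lemma ip_localized_pos:
  assumes F: "\<Psi> \<in> F" "\<Phi> \<in> F" and ab: "{a..b} \<subseteq> interior S - P" "a < b"
    and zero: "\<And>t. t \<in> S - {a..b} \<Longrightarrow> \<Psi> t * cnj (\<Phi> t) = 0"
    and w: "\<And>t. t \<in> {a..b} \<Longrightarrow> 0 \<le> Re (\<Psi> t * cnj (\<Phi> t))"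
    and t\<^sub>0: "t\<^sub>0 \<in> {a..b}" "Re (\<Psi> t\<^sub>0 * cnj (\<Phi> t\<^sub>0)) \<noteq> 0"
  shows "0 < Re (ip \<Psi> \<Phi>)"
proof -
  let ?f = "\<lambda>t. \<Psi> t * cnj (\<Phi> t)"
  have "continuous_on {a..b} ?f"
    using ab(1) interior_subset[of S] by (intro continuous_on_subset[OF cont_product[OF F]]) blast
  then have int: "?f integrable_on {a..b}" and cont: "continuous_on {a..b} (\<lambda>t. Re (?f t))"
    by (rule integrable_continuous_real, rule continuous_on_Re)
  from has_integral_linear[OF integrable_integral[OF int] bounded_linear_Re]
  have hi: "((\<lambda>t. Re (?f t)) has_integral Re (integral {a..b} ?f)) {a..b}"
    by (simp add: o_def)
  \<comment> \<open>A continuous nonnegative function with integral 0 on [a, b] vanishes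
    identically.\<close>
  have "Re (integral {a..b} ?f) \<noteq> 0"
  proof
    assume "Re (integral {a..b} ?f) = 0"
    then have "Re (?f t\<^sub>0) = 0"
      using has_integral_0_cbox_imp_0[of a b "\<lambda>t. Re (?f t)" t\<^sub>0] hi cont w t\<^sub>0(1) ab(2) by simp
    then show False
      using t\<^sub>0(2) by simp
  qed
  moreover have "0 \<le> Re (integral {a..b} ?f)"
    using hi w by (rule has_integral_nonneg)
  ultimately have "0 < Re (integral {a..b} ?f)"
    by linarith
  moreover have "ip \<Psi> \<Phi> = integral {a..b} ?f"
    by (rule ip_localized[OF F ab(1)]) (rule zero)
  ultimately show ?thesis
    by (simp only:)
qed

text \<open>The support stays away from P, so g is zero near every singular point and has the zero
  expansion there.\<close>

lemma extend_localized:
  assumes ab: "{a..b} \<subseteq> interior S - P" and "smooth_on (interior S - P) g"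
    and zero: "\<And>t. t \<notin> {a..b} \<Longrightarrow> g t = 0"
  shows "\<exists>\<Psi>\<in>F. \<forall>t\<in>S. \<Psi> t = g t"
proof (rule extend)
  show "{a..b} \<subseteq> interior S"
    using ab by blast
  have out: "smooth_on (- {a..b}) g"
    by (rule smooth_on_cong[OF _ smooth_on_const[of _ 0]]) (use zero in \<open>auto simp: open_Compl\<close>)
  show "smooth_on (- P) g"
  proof (rule smooth_on_local)
    fix t
    show "\<exists>U. t \<in> U \<and> smooth_on U g"
      using out assms(2) ab by (cases "t \<in> {a..b}") blast+
  qed
  show "g p = 0 \<and> singular_expansion g p (\<nu> p)" if "p \<in> P" for p
  proof
    have p: "p \<in> - {a..b}"
      using that ab by blast
    then show "g p = 0"
      using zero by simp
    have "eventually (\<lambda>t. t \<in> - {a..b}) (at p)"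
      using p by (intro eventually_at_in_open') (simp_all add: open_Compl)
    then have "eventually (\<lambda>t. g t = 0) (at p)"
      by eventually_elim (simp add: zero)
    from has_expansion_zero[OF this] show "singular_expansion g p (\<nu> p)"
      unfolding singular_expansion_iff by blast
  qed
qed (use zero in auto)

text \<open>\<Phi> is a bump times h, so its product with a function equal to h is the bump times
  |h|^2. One construction serves nondegeneracy, with h = \<Psi>, and the existence of positive
  vectors, with h = 1; therefore h is not assumed to lie in F.\<close>

lemma exists_localized_multiple:
  assumes t\<^sub>0: "t\<^sub>0 \<in> interior S - P" and h: "smooth_on (interior S - P) h" "h t\<^sub>0 \<noteq> 0"
  shows "\<exists>\<Phi>\<in>F. 0 < Re (ip \<Phi> \<Phi>) \<and> (\<forall>\<Psi>\<in>F. (\<forall>t\<in>S. \<Psi> t = h t) \<longrightarrow> 0 < Re (ip \<Psi> \<Phi>))"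
proof -
  have op: "open (interior S - P)"
    using finite_P by (intro open_Diff finite_imp_closed) auto
  then obtain e where e: "0 < e" "cball t\<^sub>0 e \<subseteq> interior S - P"
    using t\<^sub>0 open_contains_cball by blast
  let ?K = "{t\<^sub>0 - e..t\<^sub>0 + e}"
  have K: "?K \<subseteq> interior S - P" "t\<^sub>0 - e < t\<^sub>0 + e" "t\<^sub>0 \<in> ?K"
    using e by (simp_all add: cball_eq_atLeastAtMost)
  obtain \<beta> :: "real \<Rightarrow> real" where \<beta>: "smooth_on UNIV (\<lambda>t. complex_of_real (\<beta> t))"
    "\<And>t. \<bar>t - t\<^sub>0\<bar> < e \<Longrightarrow> 0 < \<beta> t" "\<And>t. e \<le> \<bar>t - t\<^sub>0\<bar> \<Longrightarrow> \<beta> t = 0"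
    by (rule smooth_bump[where a = t\<^sub>0 and r = e]) blast
  have \<beta>0: "0 \<le> \<beta> t" for t
    using \<beta>(2,3)[of t] by force
  have \<beta>t: "\<beta> t\<^sub>0 \<noteq> 0"
    using \<beta>(2)[of t\<^sub>0] e(1) by simp
  have out: "\<beta> t = 0" if "t \<notin> ?K" for t
    using that by (intro \<beta>(3)) auto
  have "smooth_on (interior S - P) (\<lambda>t. of_real (\<beta> t) * h t)"
    using h(1) smooth_on_subset[OF \<beta>(1)] by (intro smooth_on_mult op) auto
  then obtain \<Phi> where \<Phi>: "\<Phi> \<in> F" "\<And>t. t \<in> S \<Longrightarrow> \<Phi> t = of_real (\<beta> t) * h t"
    using extend_localized[OF K(1), of "\<lambda>t. of_real (\<beta> t) * h t"] out by auto
  \<comment> \<open>The weight \<gamma> is the bump \<beta> for the pair (\<Phi>, \<Phi>) and the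
    constant 1 for a pair (\<Psi>, \<Phi>) with \<Psi> = h on S.\<close>
  have pos: "0 < Re (ip \<Psi> \<Phi>)"
    if \<Psi>: "\<Psi> \<in> F" and \<gamma>: "\<And>t. 0 \<le> \<gamma> t" "\<gamma> t\<^sub>0 \<noteq> 0"
      and eq: "\<And>t. t \<in> S \<Longrightarrow> \<Psi> t = of_real (\<gamma> t) * h t" for \<Psi> \<gamma>
  proof (rule ip_localized_pos[OF \<Psi> \<Phi>(1) K(1,2) _ _ K(3)])
    have f: "\<Psi> t * cnj (\<Phi> t) = of_real (\<gamma> t * \<beta> t * (cmod (h t))\<^sup>2)" if "t \<in> S" for t
      using \<Phi>(2)[OF that] eq[OF that] by (simp add: complex_norm_square mult_ac del: of_real_power)
    have S: "t \<in> S" if "t \<in> ?K" for t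
      using that K(1) interior_subset[of S] by blast
    show "\<Psi> t * cnj (\<Phi> t) = 0" if "t \<in> S - ?K" for t
      using that f[of t] out[of t] by simp
    show "0 \<le> Re (\<Psi> t * cnj (\<Phi> t))" if "t \<in> ?K" for t
      unfolding f[OF S[OF that]] Re_complex_of_real using \<beta>0[of t] \<gamma>(1)[of t] by simp
    show "Re (\<Psi> t\<^sub>0 * cnj (\<Phi> t\<^sub>0)) \<noteq> 0"
      unfolding f[OF S[OF K(3)]] Re_complex_of_real using \<beta>t \<gamma>(2) h(2) by simp
  qed
  have "0 < Re (ip \<Phi> \<Phi>)"
    by (rule pos[OF \<Phi>(1) \<beta>0 \<beta>t \<Phi>(2)])
  moreover have "0 < Re (ip \<Psi> \<Phi>)" if "\<Psi> \<in> F" "\<forall>t\<in>S. \<Psi> t = h t" for \<Psi>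
    using pos[OF that(1), of "\<lambda>_. 1"] that(2) by simp
  ultimately show ?thesis
    using \<Phi>(1) by blast
qed

lemma nondegenerate:
  assumes "\<Psi> \<in> F" "\<forall>\<Phi>\<in>F. ip \<Psi> \<Phi> = 0"
  shows "\<Psi> = 0"
proof (rule determined[OF assms(1)], rule ccontr)
  fix t\<^sub>0
  assume "t\<^sub>0 \<in> interior S - P" "\<Psi> t\<^sub>0 \<noteq> 0"
  from exists_localized_multiple[OF this(1) smooth[OF assms(1)] this(2)]
  obtain \<Phi> where "\<Phi> \<in> F" "0 < Re (ip \<Psi> \<Phi>)"
    using assms(1) by blast
  then show False
    using assms(2) by simp
qed

lemma exists_positive: "\<exists>\<Psi>\<in>F. 0 < Re (ip \<Psi> \<Psi>)"
proof -
  \<comment> \<open>A finite set is closed, and the only nonempty set of reals that is both open and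
    closed is the whole line.\<close>
  have "infinite (interior S)"
    using interior_S by (metis clopen finite_imp_closed infinite_UNIV_char_0 open_interior)
  then obtain t\<^sub>0 where "t\<^sub>0 \<in> interior S - P"
    using finite_P by (metis finite_Diff2 finite.emptyI ex_in_conv)
  from exists_localized_multiple[OF this smooth_on_const one_neq_zero] show ?thesis
    by blast
qed

lemma indefinite: "indefinite_inner_product F ip"
  unfolding indefinite_inner_product_def using subspace hermitian nondegenerate by blast

section \<open>The upper bound for the dimension of negative subspaces\<close>

lemma ip_nonneg:
  assumes F: "\<Psi> \<in> F" and a: "\<And>p. p \<in> P \<Longrightarrow> has_expansion \<Psi> p (\<nu> p) (a p)"
    and zero: "\<And>p k. p \<in> P \<Longrightarrow> k < l_order (\<nu> p) \<Longrightarrow> a p k = 0"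
  shows "0 \<le> Re (ip \<Psi> \<Psi>)"
proof -
  let ?f = "\<lambda>t. \<Psi> t * cnj (\<Psi> t)" and ?b = "\<lambda>p. product_coeff (\<nu> p) (a p) (a p)"
  obtain \<delta> where \<delta>: "admissible_radius S P \<delta>"
    using exists_admissible_radius[OF finite_P P_interior] by blast
  \<comment> \<open>No pole is left in |\<Psi>|^2, so every term of the regularized sum is either
    zero or an ordinary integral of a nonnegative function.\<close>
  have b: "?b p m = 0" if "p \<in> P" "1 \<le> m" for p m
    using product_coeff_regular[of "\<nu> p" "a p"] zero that by blast
  have rem: "polar_remainder ?f \<nu> ?b p = ?f" "polar_integral (?b p) (\<nu> p) \<delta> = 0" if "p \<in> P" for p
    using b[OF that] by (simp_all add: polar_remainder_def[abs_def] polar_part_def polar_integral_def)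
  have reg: "regularizable ?f S P \<delta> \<nu> ?b"
    by (rule product_regularizable[OF F F \<delta> product_germ[OF a a]])
  have f: "0 \<le> Re (?f t)" for t
    by simp
  have "0 \<le> Re (regularized_sum ?f S P \<delta> \<nu> ?b)"
    using reg f unfolding regularized_sum_def regularizable_def
    by (auto simp: rem intro!: add_nonneg_nonneg sum_nonneg Re_integral_nonneg)
  then show ?thesis
    using ip_eqI[OF F F is_product_sum[OF F F \<delta> product_germ[OF a a]]] by simp
qed

text \<open>The functionals are the coefficients of the negative powers. A vector of V on which all
  of them vanish has a nonnegative square and must be 0, so they separate the points of V.\<close>

lemma negative_definite_dimension:
  assumes "negative_definite_subspace F ip V"
  shows "\<exists>d\<le>(\<Sum>p\<in>P. l_order (\<nu> p)). has_dimension V d"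
proof -
  let ?I = "SIGMA p:P. {..<l_order (\<nu> p)}"
  have V: "cfun.subspace V" "V \<subseteq> F" "\<And>\<Psi>. \<Psi> \<in> V \<Longrightarrow> \<Psi> \<noteq> 0 \<Longrightarrow> Re (ip \<Psi> \<Psi>) < 0"
    using assms by (auto simp: negative_definite_subspace_def)
  \<comment> \<open>Coefficients up to index \<nu> p are unique, so this choice is linear on V in
    the range that matters for L.\<close>
  define a where "a \<Psi> p = (SOME a. has_expansion \<Psi> p (\<nu> p) a)" for \<Psi> p
  have a: "has_expansion \<Psi> p (\<nu> p) (a \<Psi> p)" if "\<Psi> \<in> V" "p \<in> P" for \<Psi> p
    using expansion[of \<Psi> p] that V(2) someI_ex[of "has_expansion \<Psi> p (\<nu> p)"]
    by (auto simp: singular_expansion_iff a_def)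
  define L where "L = (\<lambda>(p, k) \<Psi>. a \<Psi> p k)"
  have le: "k \<le> d" if "k < l_order d" for k d
    using that unfolding l_order_eq by presburger
  have "\<exists>d\<le>card ?I. has_dimension V d"
  proof (rule has_dimension_le[OF _ V(1), where L = L])
    show "finite ?I"
      using finite_P by simp
    show "L i (u + v) = L i u + L i v" if i: "i \<in> ?I" and uv: "u \<in> V" "v \<in> V" for i u v
    proof -
      obtain p k where pk: "i = (p, k)" "p \<in> P" "k < l_order (\<nu> p)"
        using i by auto
      show ?thesis
        using has_expansion_unique[OF a[OF cfun.subspace_add[OF V(1) uv] pk(2)]
            has_expansion_add[OF a[OF uv(1) pk(2)] a[OF uv(2) pk(2)]] le[OF pk(3)]]
        unfolding L_def pk(1) prod.case .
    qed
    show "L i (cscale c v) = c * L i v" if i: "i \<in> ?I" and v: "v \<in> V" for i c v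
    proof -
      obtain p k where pk: "i = (p, k)" "p \<in> P" "k < l_order (\<nu> p)"
        using i by auto
      show ?thesis
        using has_expansion_unique[OF a[OF cfun.subspace_scale[OF V(1) v] pk(2)]
            has_expansion_scale[OF a[OF v pk(2)]] le[OF pk(3)]]
        unfolding L_def pk(1) prod.case .
    qed
    show "v = 0" if v: "v \<in> V" "\<forall>i\<in>?I. L i v = 0" for v
    proof (rule ccontr)
      assume "v \<noteq> 0"
      moreover have "0 \<le> Re (ip v v)"
      proof (rule ip_nonneg)
        show "v \<in> F"
          using v(1) V(2) by blast
        show "has_expansion v p (\<nu> p) (a v p)" if "p \<in> P" for p
          by (rule a[OF v(1) that])
        show "a v p k = 0" if "p \<in> P" "k < l_order (\<nu> p)" for p k
          using v(2) that by (auto simp: L_def)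
      qed
      ultimately show False
        using V(3)[OF v(1)] by simp
    qed
  qed
  then show ?thesis
    using finite_P by simp
qed

end

section \<open>A negative definite subspace of the full dimension\<close>

lemma sum_fun_apply: "(\<Sum>i\<in>I. f i) t = (\<Sum>i\<in>I. f i t :: complex)"
  by (induction I rule: infinite_finite_induct) auto

context singular_space
begin

text \<open>The vector with index (p, k) extends one negative power at p, cut off to the interval of
  radius r. By disjointness a combination is a single q \<eta> in each interval and 0 on the outer
  part, so its square is a sum over P of two nonpositive terms: the integral of the remainder and
  the polar integral of |q|^2. Negativity is claimed for coefficient vectors, which gives linear
  independence at the same time.\<close>

lemma exists_negative_system:
  defines "I \<equiv> SIGMA p:P. {..<l_order (\<nu> p)}"
  shows "\<exists>e. (\<forall>i\<in>I. e i \<in> F) \<and> (\<forall>c. (\<exists>i\<in>I. c i \<noteq> 0) \<longrightarrow>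
    Re (ip (\<Sum>i\<in>I. cscale (c i) (e i)) (\<Sum>i\<in>I. cscale (c i) (e i))) < 0)"
proof -
  have fin: "finite I"
    using finite_P by (simp add: I_def)
  obtain \<delta> where \<delta>: "admissible_radius S P \<delta>"
    using exists_admissible_radius[OF finite_P P_interior] by blast
  \<comment> \<open>Halving an admissible radius places the closed intervals in the interior of S,
    as \<open>extend\<close> demands of a support.\<close>
  define r where "r = \<delta> / 2"
  have r: "0 < r" "r \<le> \<delta>" "r < \<delta>"
    using \<delta> by (auto simp: r_def admissible_radius_def)
  have adm: "admissible_radius S P r"
    by (rule admissible_radius_mono[OF \<delta> r(1,2)])
  have near: "{p - r..p + r} \<subseteq> interior S" if "p \<in> P" for p
  proof -
    have "{p - \<delta><..<p + \<delta>} \<subseteq> interior S"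
      using admissible_radius_point(1)[OF \<delta> that] by (intro interior_maximal) auto
    then show ?thesis
      using r(3) by auto
  qed
  obtain \<eta> :: "real \<Rightarrow> real" where \<eta>: "smooth_on UNIV (\<lambda>t. complex_of_real (\<eta> t))"
    "\<And>t. 0 \<le> \<eta> t \<and> \<eta> t \<le> 1" "\<And>t. \<bar>t\<bar> \<le> r / 2 \<Longrightarrow> \<eta> t = 1" "\<And>t. r \<le> \<bar>t\<bar> \<Longrightarrow> \<eta> t = 0"
    by (rule smooth_cutoff[OF r(1)]) blast
  define g where "g = (\<lambda>(p, k) t. complex_of_real (t - p) powi (- (int (\<nu> p) - 2 * int k))
      * complex_of_real (\<eta> (t - p)))"
  \<comment> \<open>The exponents of negative powers are nonzero, so the convention for powers of 0
    gives g the dummy value 0 at its own singular point.\<close>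
  have exponent: "- (int d - 2 * int k) \<noteq> 0" if "k < l_order d" for d k
    using that unfolding l_order_eq by presburger
  have "\<exists>\<Psi>\<in>F. \<forall>t\<in>S. \<Psi> t = g i t" if i: "i \<in> I" for i
  proof -
    obtain p k where pk: "i = (p, k)" "p \<in> P" "k < l_order (\<nu> p)"
      using i by (auto simp: I_def)
    have kd: "k \<le> \<nu> p"
      using pk(3) unfolding l_order_eq by presburger
    show ?thesis
    proof (rule extend)
      show "{p - r..p + r} \<subseteq> interior S"
        by (rule near[OF pk(2)])
      have "smooth_on UNIV (\<lambda>t. complex_of_real (\<eta> (t - p)))"
        using smooth_on_affine[OF open_UNIV \<eta>(1), of 1 "- p"] by simp
      then have "smooth_on (- {p}) (g i)"
        unfolding g_def pk(1) prod.case
        by (intro smooth_on_mult smooth_on_powi) (auto simp: open_Compl intro: smooth_on_subset[of UNIV])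
      then show "smooth_on (- P) (g i)"
        by (rule smooth_on_subset) (use pk(2) in blast)
      show g0: "g i t = 0" if "t \<notin> {p - r..p + r}" for t
      proof -
        have "r \<le> \<bar>t - p\<bar>"
          using that by (simp add: abs_real_def) linarith
        then show ?thesis
          by (simp add: g_def pk(1) \<eta>(4))
      qed
      show "g i q = 0 \<and> singular_expansion (g i) q (\<nu> q)" if q: "q \<in> P" for q
      proof (cases "q = p")
        case True
        have "g i p = 0"
          using exponent[OF pk(3)] by (simp add: g_def pk(1) power_int_0_left_if)
        moreover have "has_expansion (g i) p (\<nu> p) (\<lambda>j. if j = k then 1 else 0)"
        proof (rule has_expansion_transform[OF has_expansion_singular_sum])
          have "0 < r / 2"
            using r(1) by simp
          from eventually_at_interval[OF this, of p]
          show "eventually (\<lambda>t. singular_sum (\<lambda>j. if j = k then 1 else 0) (\<nu> p) (t - p) = g i t) (at p)"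
          proof eventually_elim
            case (elim t)
            have "singular_sum (\<lambda>j. if j = k then 1 else 0) (\<nu> p) (t - p)
                = (\<Sum>j=0..\<nu> p. if j = k then complex_of_real (t - p) powi (- (int (\<nu> p) - 2 * int j)) else 0)"
              unfolding singular_sum_def by (intro sum.cong) auto
            also have "\<dots> = complex_of_real (t - p) powi (- (int (\<nu> p) - 2 * int k))"
              using kd by (simp add: sum.delta)
            finally show ?case
              using \<eta>(3)[of "t - p"] elim by (simp add: g_def pk(1))
          qed
        qed
        ultimately show ?thesis
          using True unfolding singular_expansion_iff by blast
      next
        case False
        have disj: "{q - r..q + r} \<inter> {p - r..p + r} = {}"
          using adm q pk(2) False unfolding admissible_radius_def by blast
        have "g i t = 0" if "\<bar>t - q\<bar> < r" for t
        proof -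
          have "t \<in> {q - r..q + r}"
            using that by auto
          then show ?thesis
            using g0 disj by blast
        qed
        moreover from this have "eventually (\<lambda>t. g i t = 0) (at q)"
          using eventually_at_interval[OF r(1), of q] by (auto elim: eventually_mono)
        ultimately show ?thesis
          using has_expansion_zero[of "g i" q] r(1) unfolding singular_expansion_iff by auto
      qed
    qed auto
  qed
  then obtain e where e: "\<And>i. i \<in> I \<Longrightarrow> e i \<in> F" "\<And>i t. i \<in> I \<Longrightarrow> t \<in> S \<Longrightarrow> e i t = g i t"
    by metis
  have "Re (ip (\<Sum>i\<in>I. cscale (c i) (e i)) (\<Sum>i\<in>I. cscale (c i) (e i))) < 0"
    if c: "\<exists>i\<in>I. c i \<noteq> 0" for c
  proof -
    define \<Psi> where "\<Psi> = (\<Sum>i\<in>I. cscale (c i) (e i))"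
    \<comment> \<open>Padding with zeros from \<open>l_order (\<nu> p)\<close> on makes the
      combination at p a \<open>singular_sum\<close> to which \<open>singular_sum_norm\<close>
      applies.\<close>
    define a where "a p k = (if k < l_order (\<nu> p) then c (p, k) else 0)" for p k
    let ?f = "\<lambda>t. \<Psi> t * cnj (\<Psi> t)" and ?b = "\<lambda>p. product_coeff (\<nu> p) (a p) (a p)"
    have F: "\<Psi> \<in> F"
      unfolding \<Psi>_def using e(1) by (intro cfun.subspace_sum[OF subspace] cfun.subspace_scale[OF subspace])
    have \<Psi>: "\<Psi> t = (\<Sum>p\<in>P. singular_sum (a p) (\<nu> p) (t - p) * complex_of_real (\<eta> (t - p)))"
      if "t \<in> S" for t
    proof -
      have "\<Psi> t = (\<Sum>i\<in>I. c i * g i t)"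
        unfolding \<Psi>_def sum_fun_apply using e(2) that by (simp add: cscale_def)
      also have "\<dots> = (\<Sum>p\<in>P. \<Sum>k<l_order (\<nu> p). c (p, k) * g (p, k) t)"
        unfolding I_def using finite_P by (simp add: sum.Sigma)
      also have "\<dots> = (\<Sum>p\<in>P. singular_sum (a p) (\<nu> p) (t - p) * complex_of_real (\<eta> (t - p)))"
      proof (intro sum.cong refl)
        fix p
        have "{..<l_order (\<nu> p)} \<subseteq> {0..\<nu> p}"
          unfolding l_order_eq by auto
        then have "(\<Sum>k<l_order (\<nu> p). c (p, k) * g (p, k) t)
            = (\<Sum>k=0..\<nu> p. a p k * complex_of_real (t - p) powi (- (int (\<nu> p) - 2 * int k))
                * complex_of_real (\<eta> (t - p)))"
          by (intro sum.mono_neutral_cong_left) (auto simp: a_def g_def)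
        then show "(\<Sum>k<l_order (\<nu> p). c (p, k) * g (p, k) t)
            = singular_sum (a p) (\<nu> p) (t - p) * complex_of_real (\<eta> (t - p))"
          by (simp add: singular_sum_def sum_distrib_right)
      qed
      finally show ?thesis .
    qed
    have \<Psi>_near: "\<Psi> t = singular_sum (a p) (\<nu> p) (t - p) * complex_of_real (\<eta> (t - p))"
      if p: "p \<in> P" and t: "t \<in> {p - r..p + r}" for p t
    proof -
      have "singular_sum (a q) (\<nu> q) (t - q) * complex_of_real (\<eta> (t - q)) = 0" if "q \<in> P - {p}" for q
      proof -
        have "{q - r..q + r} \<inter> {p - r..p + r} = {}"
          using adm that p unfolding admissible_radius_def by blast
        then have "t \<notin> {q - r..q + r}"
          using t by blast
        then have "\<eta> (t - q) = 0"
          by (intro \<eta>(4)) auto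
        then show ?thesis
          by simp
      qed
      then have "(\<Sum>q\<in>P - {p}. singular_sum (a q) (\<nu> q) (t - q) * complex_of_real (\<eta> (t - q))) = 0"
        by (intro sum.neutral) blast
      moreover have "t \<in> S"
        using admissible_radius_point(1)[OF adm p] t by blast
      ultimately show ?thesis
        using \<Psi>[of t] sum.remove[OF finite_P p, of "\<lambda>q. singular_sum (a q) (\<nu> q) (t - q) * complex_of_real (\<eta> (t - q))"]
        by simp
    qed
    have \<Psi>_far: "\<Psi> t = 0" if "t \<in> outer_part S P r" for t
    proof -
      have "\<eta> (t - p) = 0" if "p \<in> P" for p
        using \<open>t \<in> outer_part S P r\<close> that by (intro \<eta>(4)) (auto simp: outer_part_def)
      then show ?thesis
        using \<Psi>[of t] that by (auto simp: outer_part_def)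
    qed
    have exp: "has_expansion \<Psi> p (\<nu> p) (a p)" if p: "p \<in> P" for p
    proof (rule has_expansion_transform[OF has_expansion_singular_sum])
      have "0 < r / 2"
        using r(1) by simp
      from eventually_at_interval[OF this, of p]
      show "eventually (\<lambda>t. singular_sum (a p) (\<nu> p) (t - p) = \<Psi> t) (at p)"
      proof eventually_elim
        case (elim t)
        then have "t \<in> {p - r..p + r}"
          using r(1) by (auto simp: abs_real_def split: if_splits)
        then show ?case
          using \<Psi>_near[OF p, of t] \<eta>(3)[of "t - p"] elim by simp
      qed
    qed
    have a0: "a p k = 0" if "l_order (\<nu> p) \<le> k" for p k
      using that by (simp add: a_def)
    have reg: "regularizable ?f S P r \<nu> ?b"
      by (rule product_regularizable[OF F F adm product_germ[OF exp exp]])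
    have near_le: "Re (integral {p - r..p + r} (polar_remainder ?f \<nu> ?b p)) \<le> 0" if p: "p \<in> P" for p
    proof (rule Re_integral_nonpos)
      show "polar_remainder ?f \<nu> ?b p absolutely_integrable_on {p - r..p + r}"
        using reg p by (simp add: regularizable_def)
      fix t
      assume t: "t \<in> {p - r..p + r}"
      let ?q = "cmod (singular_sum (a p) (\<nu> p) (t - p))"
      have "?f t = complex_of_real ((cmod (\<Psi> t))\<^sup>2)"
        by (simp add: complex_norm_square del: of_real_power)
      also have "cmod (\<Psi> t) = ?q * \<eta> (t - p)"
        unfolding \<Psi>_near[OF p t] using \<eta>(2)[of "t - p"] by (simp add: norm_mult)
      finally have f: "?f t = complex_of_real ((?q * \<eta> (t - p))\<^sup>2)" .
      have "polar_part (?b p) (\<nu> p) (t - p) = complex_of_real (?q\<^sup>2)"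
        by (rule singular_sum_norm) (rule a0)
      with f have "polar_remainder ?f \<nu> ?b p t = complex_of_real ((?q * \<eta> (t - p))\<^sup>2 - ?q\<^sup>2)"
        unfolding polar_remainder_def by (simp only: of_real_diff)
      then have "Re (polar_remainder ?f \<nu> ?b p t) = (?q * \<eta> (t - p))\<^sup>2 - ?q\<^sup>2"
        by (simp only: Re_complex_of_real)
      moreover have "(?q * \<eta> (t - p))\<^sup>2 \<le> ?q\<^sup>2"
        using \<eta>(2)[of "t - p"] by (intro power_mono mult_left_le) auto
      ultimately show "Re (polar_remainder ?f \<nu> ?b p t) \<le> 0"
        by simp
    qed
    have "integral (outer_part S P r) ?f = 0"
      using integral_cong[of "outer_part S P r" ?f "\<lambda>_. 0"] \<Psi>_far by simp
    then have ip: "Re (ip \<Psi> \<Psi>) = (\<Sum>p\<in>P. Re (integral {p - r..p + r} (polar_remainder ?f \<nu> ?b p))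
        + Re (polar_integral (?b p) (\<nu> p) r))"
      using ip_eqI[OF F F is_product_sum[OF F F adm product_germ[OF exp exp]]]
      by (simp add: regularized_sum_def)
    obtain p\<^sub>0 k\<^sub>0 where "p\<^sub>0 \<in> P" "k\<^sub>0 < l_order (\<nu> p\<^sub>0)" "c (p\<^sub>0, k\<^sub>0) \<noteq> 0"
      using c unfolding I_def by blast
    then have pk: "p\<^sub>0 \<in> P" "a p\<^sub>0 k\<^sub>0 \<noteq> 0"
      by (simp_all add: a_def)
    \<comment> \<open>Strictness comes from the polar integral at a point with a nonzero
      coefficient; all other terms are nonpositive.\<close>
    have "Re (ip \<Psi> \<Psi>) < (\<Sum>p\<in>P. 0)"
      unfolding ip
    proof (rule sum_strict_mono_ex1[OF finite_P])
      show "\<forall>p\<in>P. Re (integral {p - r..p + r} (polar_remainder ?f \<nu> ?b p))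
          + Re (polar_integral (?b p) (\<nu> p) r) \<le> 0"
        by (intro ballI add_nonpos_nonpos near_le polar_integral_product_neg(1)[OF _ r(1)] a0)
      show "\<exists>p\<in>P. Re (integral {p - r..p + r} (polar_remainder ?f \<nu> ?b p))
          + Re (polar_integral (?b p) (\<nu> p) r) < 0"
        using near_le[OF pk(1)] pk(1)
          polar_integral_product_neg(2)[where d = "\<nu> p\<^sub>0" and a = "a p\<^sub>0", OF a0 r(1) pk(2)]
        by (intro bexI[of _ p\<^sub>0] add_nonpos_neg)
    qed
    then show ?thesis
      by (simp add: \<Psi>_def)
  qed
  then show ?thesis
    using e(1) by blast
qed

lemma ip_zero: "ip 0 0 = 0"
proof -
  have z: "0 \<in> F"
    by (rule cfun.subspace_0[OF subspace])
  have "ip (cscale 0 0) 0 = 0 * ip 0 0"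
    using hermitian z unfolding hermitian_form_def by blast
  then show ?thesis
    by simp
qed

text \<open>A combination with negative square cannot be 0, so negativity on nontrivial coefficient
  vectors also yields the dimension of the span.\<close>

lemma negative_subspace:
  defines "l \<equiv> \<Sum>p\<in>P. l_order (\<nu> p)"
  shows "\<exists>V. negative_definite_subspace F ip V \<and> has_dimension V l"
    and "0 < l \<Longrightarrow> \<exists>\<Psi>\<in>F. Re (ip \<Psi> \<Psi>) < 0"
proof -
  define I where "I = (SIGMA p:P. {..<l_order (\<nu> p)})"
  have fin: "finite I" and card: "card I = l"
    using finite_P by (simp_all add: I_def l_def)
  obtain e where "(\<forall>i\<in>I. e i \<in> F) \<and> (\<forall>c. (\<exists>i\<in>I. c i \<noteq> 0) \<longrightarrow>
    Re (ip (\<Sum>i\<in>I. cscale (c i) (e i)) (\<Sum>i\<in>I. cscale (c i) (e i))) < 0)"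
    using exists_negative_system[folded I_def] by (rule exE)
  then have e: "\<And>i. i \<in> I \<Longrightarrow> e i \<in> F" "\<And>c. \<exists>i\<in>I. c i \<noteq> 0 \<Longrightarrow>
    Re (ip (\<Sum>i\<in>I. cscale (c i) (e i)) (\<Sum>i\<in>I. cscale (c i) (e i))) < 0"
    by blast+
  have ne: "(\<Sum>i\<in>I. cscale (c i) (e i)) \<noteq> 0" if "\<exists>i\<in>I. c i \<noteq> 0" for c
    using e(2)[OF that] ip_zero by (metis less_irrefl zero_complex.sel(1))
  have dim: "inj_on e I" "has_dimension (cfun.span (e ` I)) (card I)"
    by (rule has_dimension_span_image[OF fin]; rule ne; assumption)+
  have "negative_definite_subspace F ip (cfun.span (e ` I))"
    unfolding negative_definite_subspace_def
  proof (intro conjI ballI impI)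
    show "cfun.span (e ` I) \<subseteq> F"
      using e(1) by (intro cfun.span_minimal subspace) auto
    fix \<Psi>
    assume "\<Psi> \<in> cfun.span (e ` I)" and ne0: "\<Psi> \<noteq> 0"
    then obtain c where c: "\<Psi> = (\<Sum>i\<in>I. cscale (c i) (e i))"
      using span_image_eq_range[OF fin dim(1)] by auto
    have "\<exists>i\<in>I. c i \<noteq> 0"
    proof (rule ccontr)
      assume "\<not> ?thesis"
      then have "\<Psi> = 0"
        unfolding c by (intro sum.neutral) (metis cfun.scale_zero_left)
      then show False
        using ne0 by contradiction
    qed
    then show "Re (ip \<Psi> \<Psi>) < 0"
      unfolding c by (rule e(2))
  qed simp
  then show "\<exists>V. negative_definite_subspace F ip V \<and> has_dimension V l"
    using dim(2) card by blast
  show "\<exists>\<Psi>\<in>F. Re (ip \<Psi> \<Psi>) < 0" if "0 < l"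
  proof -
    obtain i where "i \<in> I"
      using \<open>0 < l\<close> card by (metis card.empty ex_in_conv less_irrefl)
    then have "\<exists>i\<in>I. (1 :: complex) \<noteq> 0"
      using one_neq_zero by blast
    from e(2)[OF this] show ?thesis
      using e(1) by (intro bexI[of _ "\<Sum>i\<in>I. cscale 1 (e i)"])
        (auto intro!: cfun.subspace_sum[OF subspace] cfun.subspace_scale[OF subspace])
  qed
qed

theorem negative_squares:
  assumes "l = (\<Sum>p\<in>P. l_order (\<nu> p))"
  shows "(\<forall>\<Psi>\<in>F. \<forall>\<Phi>\<in>F. \<exists>!I. is_product \<Psi> \<Phi> I) \<and> indefinite_inner_product F ip
    \<and> (0 < l \<longrightarrow> takes_both_signs F ip) \<and> has_negative_squares F ip l"
  unfolding assms takes_both_signs_def has_negative_squares_def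
  using ex1_is_product indefinite exists_positive negative_subspace negative_definite_dimension
  by blast

end

section \<open>The rapidly decreasing case\<close>

lemma smooth_on_cscale: "open U \<Longrightarrow> smooth_on U \<Psi> \<Longrightarrow> smooth_on U (cscale c \<Psi>)"
  unfolding cscale_def by (intro smooth_on_mult smooth_on_const)

lemma smooth_on_plus: "open U \<Longrightarrow> smooth_on U \<Psi> \<Longrightarrow> smooth_on U \<Phi> \<Longrightarrow> smooth_on U (\<Psi> + \<Phi>)"
  using smooth_on_add[of U \<Psi> \<Phi>] by (simp add: plus_fun_def)

lemma smooth_on_zero: "smooth_on U 0"
  using smooth_on_const[of U 0] by (simp add: zero_fun_def)

lemma singular_expansion_plus:
  "singular_expansion \<Psi> p d \<Longrightarrow> singular_expansion \<Phi> p d \<Longrightarrow> singular_expansion (\<Psi> + \<Phi>) p d"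
  unfolding singular_expansion_iff using has_expansion_add by blast

lemma singular_expansion_cscale: "singular_expansion \<Psi> p d \<Longrightarrow> singular_expansion (cscale c \<Psi>) p d"
  unfolding singular_expansion_iff using has_expansion_scale by blast

lemma singular_expansion_zero: "singular_expansion 0 p d"
  unfolding singular_expansion_iff using has_expansion_zero[of 0 p d] by auto

lemma rapidly_decreasing_plus:
  assumes "rapidly_decreasing \<Psi>" "rapidly_decreasing \<Phi>"
  shows "rapidly_decreasing (\<Psi> + \<Phi>)"
  unfolding rapidly_decreasing_def
proof
  fix k
  show "((\<lambda>t. complex_of_real t ^ k * (\<Psi> + \<Phi>) t) \<longlongrightarrow> 0) at_infinity"
    using tendsto_add[OF assms[unfolded rapidly_decreasing_def, rule_format, of k]]
    by (simp add: distrib_left)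
qed

lemma rapidly_decreasing_cscale:
  assumes "rapidly_decreasing \<Psi>"
  shows "rapidly_decreasing (cscale c \<Psi>)"
  unfolding rapidly_decreasing_def
proof
  fix k
  show "((\<lambda>t. complex_of_real t ^ k * cscale c \<Psi> t) \<longlongrightarrow> 0) at_infinity"
    using tendsto_mult_right_zero[OF assms[unfolded rapidly_decreasing_def, rule_format, of k], of c]
    by (simp add: cscale_def mult_ac)
qed

lemma integrable_inverse_square_tail:
  assumes "0 < R"
  shows "(\<lambda>t::real. 1 / t ^ 2) absolutely_integrable_on {t. R < \<bar>t\<bar>}"
proof -
  have "(\<lambda>t::real. 1 / t ^ 2) integrable_on {R..}"
    using has_integral_inverse_power_to_inf[of 2 R] assms by (auto simp: integrable_on_def)
  then have pos: "(\<lambda>t::real. 1 / t ^ 2) absolutely_integrable_on {R..}"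
    by (rule nonnegative_absolutely_integrable_1) simp
  have "(\<lambda>t::real. 1 / t ^ 2) absolutely_integrable_on uminus ` {R..}"
    using has_absolute_integral_reflect_real[of "{R..}" "uminus ` {R..}" "\<lambda>t::real. 1 / t ^ 2"
        "integral {R..} (\<lambda>t::real. 1 / t ^ 2)"] pos
    by (simp add: image_image)
  from absolutely_integrable_Un[OF pos this]
  have "(\<lambda>t::real. 1 / t ^ 2) absolutely_integrable_on {R..} \<union> uminus ` {R..}" .
  then show ?thesis
  proof (rule set_integrable_subset)
    have "{t. R < \<bar>t\<bar>} = - {- R..R}"
      by auto
    then show "{t. R < \<bar>t\<bar>} \<in> sets lebesgue"
      by simp
    show "{t. R < \<bar>t\<bar>} \<subseteq> {R..} \<union> uminus ` {R..}"
    proof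
      fix t
      assume "t \<in> {t. R < \<bar>t\<bar>}"
      then have "R \<le> t \<or> R \<le> - t"
        by auto
      then show "t \<in> {R..} \<union> uminus ` {R..}"
        using image_eqI[of t uminus "- t" "{R..}"] by auto
    qed
  qed
qed

text \<open>Each factor is eventually below 1 / |t|, which gives the integrable majorant 1 / t^2. R
  is chosen to be at least 1 and at least every |p|, so that the tail avoids both 0 and the singular
  points.\<close>

lemma rapidly_decreasing_product_tail:
  assumes "rapidly_decreasing \<Psi>" "rapidly_decreasing \<Phi>"
    and P: "finite P" and cont: "continuous_on (- P) (\<lambda>t. \<Psi> t * cnj (\<Phi> t))"
  shows "\<exists>R. (\<lambda>t. \<Psi> t * cnj (\<Phi> t)) absolutely_integrable_on {t. R < \<bar>t\<bar>}"
proof -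
  have bound: "\<exists>R. \<forall>t. R \<le> \<bar>t\<bar> \<longrightarrow> \<bar>t\<bar> * cmod (\<Omega> t) < 1" if "rapidly_decreasing \<Omega>" for \<Omega>
  proof -
    have "((\<lambda>t. complex_of_real t * \<Omega> t) \<longlongrightarrow> 0) at_infinity"
      using that[unfolded rapidly_decreasing_def, rule_format, of 1] by simp
    from order_tendstoD(2)[OF tendsto_norm_zero[OF this], of 1] show ?thesis
      by (simp add: eventually_at_infinity norm_mult)
  qed
  obtain R\<^sub>1 R\<^sub>2 where R12: "\<And>t. R\<^sub>1 \<le> \<bar>t\<bar> \<Longrightarrow> \<bar>t\<bar> * cmod (\<Psi> t) < 1" "\<And>t. R\<^sub>2 \<le> \<bar>t\<bar> \<Longrightarrow> \<bar>t\<bar> * cmod (\<Phi> t) < 1"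
    using bound assms(1,2) by meson
  obtain B where B: "\<And>p. p \<in> P \<Longrightarrow> \<bar>p\<bar> \<le> B"
    using finite_imp_bounded[OF P] by (auto simp: bounded_iff)
  define R where "R = max (max R\<^sub>1 R\<^sub>2) (max B 1)"
  have R: "R\<^sub>1 \<le> R" "R\<^sub>2 \<le> R" "B \<le> R" "1 \<le> R"
    by (auto simp: R_def)
  have eq: "{t. R < \<bar>t\<bar>} = - {- R..R}"
    by auto
  have meas: "{t. R < \<bar>t\<bar>} \<in> sets lebesgue"
    unfolding eq by simp
  have "(\<lambda>t. \<Psi> t * cnj (\<Phi> t)) absolutely_integrable_on {t. R < \<bar>t\<bar>}"
  proof (rule measurable_bounded_by_integrable_imp_absolutely_integrable[where g = "\<lambda>t. 1 / t ^ 2"])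
    have "continuous_on {t. R < \<bar>t\<bar>} (\<lambda>t. \<Psi> t * cnj (\<Phi> t))"
      using B R(3) by (intro continuous_on_subset[OF cont]) fastforce
    then show "(\<lambda>t. \<Psi> t * cnj (\<Phi> t)) \<in> borel_measurable (lebesgue_on {t. R < \<bar>t\<bar>})"
      using meas by (rule continuous_imp_measurable_on_sets_lebesgue)
    show "(\<lambda>t::real. 1 / t ^ 2) integrable_on {t. R < \<bar>t\<bar>}"
      using integrable_inverse_square_tail[of R] R(4) set_lebesgue_integral_eq_integral(1) by simp
    show "norm (\<Psi> t * cnj (\<Phi> t)) \<le> 1 / t ^ 2" if "t \<in> {t. R < \<bar>t\<bar>}" for t
    proof -
      have t: "0 < \<bar>t\<bar>" "R\<^sub>1 \<le> \<bar>t\<bar>" "R\<^sub>2 \<le> \<bar>t\<bar>"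
        using that R by auto
      have "(\<bar>t\<bar> * cmod (\<Psi> t)) * (\<bar>t\<bar> * cmod (\<Phi> t)) \<le> 1 * 1"
        using R12(1)[OF t(2)] R12(2)[OF t(3)] by (intro mult_mono) auto
      then have "t ^ 2 * norm (\<Psi> t * cnj (\<Phi> t)) \<le> 1"
        by (simp add: norm_mult power2_eq_square mult_ac abs_mult_self_eq flip: abs_mult)
      then show ?thesis
        using t(1) by (simp add: field_simps)
    qed
  qed (rule meas)
  then show ?thesis
    by blast
qed

text \<open>Orders belong to indices, while the locale attaches them to points; injectivity of x
  makes \<open>inv_into\<close> the translation. On the whole line a compactly supported g is
  rapidly decreasing and serves as its own extension.\<close>

lemma singular_space_decreasing:
  assumes "inj_on x {1..N}"
  shows "singular_space UNIV (decreasing_points N x) (\<lambda>p. n (inv_into {1..N} x p))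
    (F_decreasing N x n) (has_product_decreasing N x) (product_decreasing N x)"
proof
  let ?P = "decreasing_points N x" and ?\<nu> = "\<lambda>p. n (inv_into {1..N} x p)"
  let ?F = "F_decreasing N x n"
  have fin: "finite ?P"
    by (simp add: decreasing_points_def)
  have op: "open (- ?P)"
    using finite_imp_closed[OF fin] by (simp add: open_Compl)
  have \<nu>: "x j \<in> ?P" "?\<nu> (x j) = n j" if "j \<in> {1..N}" for j
    using that assms by (auto simp: decreasing_points_def)
  have expansions: "(\<forall>j\<in>{1..N}. singular_expansion \<Psi> (x j) (n j))
      \<longleftrightarrow> (\<forall>p\<in>?P. singular_expansion \<Psi> p (?\<nu> p))" for \<Psi>
    unfolding decreasing_points_def using assms by simp
  have F: "\<Psi> \<in> ?F \<longleftrightarrow> smooth_on (- ?P) \<Psi> \<and> (\<forall>t\<in>?P. \<Psi> t = 0)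
      \<and> (\<forall>p\<in>?P. singular_expansion \<Psi> p (?\<nu> p)) \<and> rapidly_decreasing \<Psi>" for \<Psi>
    unfolding F_decreasing_def expansions by simp
  show "finite ?P"
    by (rule fin)
  show "cfun.subspace ?F"
  proof (rule cfun.subspaceI)
    show "0 \<in> ?F"
      unfolding F by (simp add: smooth_on_zero singular_expansion_zero rapidly_decreasing_def)
    show "\<Psi> + \<Phi> \<in> ?F" if "\<Psi> \<in> ?F" "\<Phi> \<in> ?F" for \<Psi> \<Phi>
      using that op unfolding F
      by (simp add: smooth_on_plus singular_expansion_plus rapidly_decreasing_plus)
    show "cscale c \<Psi> \<in> ?F" if "\<Psi> \<in> ?F" for c \<Psi>
      using that op unfolding F
      by (simp add: smooth_on_cscale singular_expansion_cscale rapidly_decreasing_cscale)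
        (simp add: cscale_def)
  qed
  have cont: "continuous_on (- ?P) \<Psi>" if "\<Psi> \<in> ?F" for \<Psi>
    using that smooth_on_imp_continuous_on unfolding F by blast
  then show "continuous_on (UNIV - ?P) \<Psi>" if "\<Psi> \<in> ?F" for \<Psi>
    using that by (simp add: Compl_eq_Diff_UNIV)
  show "smooth_on (interior UNIV - ?P) \<Psi>" if "\<Psi> \<in> ?F" for \<Psi>
    using that unfolding F by (simp add: Compl_eq_Diff_UNIV)
  show "\<exists>R. (\<lambda>t. \<Psi> t * cnj (\<Phi> t)) absolutely_integrable_on {t \<in> UNIV. R < \<bar>t\<bar>}"
    if "\<Psi> \<in> ?F" "\<Phi> \<in> ?F" for \<Psi> \<Phi>
  proof -
    have "continuous_on (- ?P) (\<lambda>t. \<Psi> t * cnj (\<Phi> t))"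
      using cont that by (intro continuous_intros)
    from rapidly_decreasing_product_tail[OF _ _ fin this] show ?thesis
      using that unfolding F by simp
  qed
  show "singular_expansion \<Psi> p (?\<nu> p)" if "\<Psi> \<in> ?F" "p \<in> ?P" for \<Psi> p
    using that unfolding F by blast
  show "\<Psi> = 0" if \<Psi>: "\<Psi> \<in> ?F" and "\<And>t. t \<in> interior UNIV - ?P \<Longrightarrow> \<Psi> t = 0" for \<Psi>
  proof
    fix t
    show "\<Psi> t = 0 t"
      using that unfolding F by (cases "t \<in> ?P") auto
  qed
  show "\<exists>\<Psi>\<in>?F. \<forall>t\<in>UNIV. \<Psi> t = g t"
    if K: "compact K" and g: "smooth_on (- ?P) g" "\<And>t. t \<notin> K \<Longrightarrow> g t = 0"
      "\<And>p. p \<in> ?P \<Longrightarrow> g p = 0 \<and> singular_expansion g p (?\<nu> p)" for K g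
  proof -
    obtain B where B: "\<And>t. t \<in> K \<Longrightarrow> norm t \<le> B"
      using compact_imp_bounded[OF K] by (auto simp: bounded_iff)
    have "eventually (\<lambda>t. g t = 0) at_infinity"
      unfolding eventually_at_infinity
    proof (intro exI[of _ "B + 1"] allI impI)
      fix t :: real
      assume "B + 1 \<le> norm t"
      then have "t \<notin> K"
        using B[of t] by auto
      then show "g t = 0"
        by (rule g(2))
    qed
    then have "((\<lambda>t. complex_of_real t ^ k * g t) \<longlongrightarrow> 0) at_infinity" for k
      by (intro tendsto_eventually) (auto elim: eventually_mono)
    then show ?thesis
      using g unfolding F rapidly_decreasing_def by (intro bexI[of _ g]) (auto simp: F rapidly_decreasing_def)
  qed
qed (auto simp: has_product_decreasing_def product_decreasing_def)

section \<open>The periodic case\<close>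

lemma periodic_int_shift:
  fixes h :: "real \<Rightarrow> complex"
  assumes "\<And>t. h (t + T) = h t"
  shows "h (t + of_int m * T) = h t"
proof (induction m rule: int_induct[where k = 0])
  case (step1 m)
  then show ?case
    using assms[of "t + of_int m * T"] by (simp add: algebra_simps)
next
  case (step2 m)
  then show ?case
    using assms[of "t + of_int (m - 1) * T"] by (simp add: algebra_simps)
qed simp

lemma quasi_periodic_int_shift:
  fixes h :: "real \<Rightarrow> complex"
  assumes "\<And>t. h (t + T) = \<kappa> * h t" "\<kappa> \<noteq> 0"
  shows "h (t + of_int m * T) = \<kappa> powi m * h t"
proof (induction m rule: int_induct[where k = 0])
  case (step1 m)
  then show ?case
    using assms(1)[of "t + of_int m * T"] assms(2) by (simp add: algebra_simps power_int_add)
next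
  case (step2 m)
  then show ?case
    using assms(1)[of "t + of_int (m - 1) * T"] assms(2)
    by (simp add: algebra_simps power_int_diff)
qed simp

text \<open>A shift by a multiple of T moves c to some s in [a, a + T]. The part of the old period
  to the left of s, moved by T, then fills the gap between a + T and s + T.\<close>

lemma has_integral_over_period:
  fixes h :: "real \<Rightarrow> complex"
  assumes per: "\<And>t. h (t + T) = h t" and T: "0 < T" and int: "(h has_integral I) {a..a + T}"
  shows "(h has_integral I) {c..c + T}"
proof -
  define m where "m = \<lfloor>(c - a) / T\<rfloor>"
  define s where "s = c - of_int m * T"
  have "of_int m \<le> (c - a) / T" "(c - a) / T < of_int m + 1"
    by (simp_all add: m_def)
  then have s: "a \<le> s" "s \<le> a + T"
    using T by (simp_all add: s_def field_simps)
  have int1: "h integrable_on {a..s}" "h integrable_on {s..a + T}"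
    using int s by (auto intro: integrable_subinterval_real)
  have "integral {a..s} h + integral {s..a + T} h = I"
    using Henstock_Kurzweil_Integration.integral_combine[OF s has_integral_integrable[OF int]] int
    by (simp add: integral_unique)
  moreover have "(h has_integral integral {a..s} h) {a + T..s + T}"
    using has_integral_shift_real_ivl[OF integrable_integral[OF int1(1)], of "- T"] per[of "_ - T"]
    by simp
  ultimately have "(h has_integral I) {s..s + T}"
    using has_integral_combine[of s "a + T" "s + T" h "integral {s..a + T} h" "integral {a..s} h"]
      s integrable_integral[OF int1(2)] by (simp add: add.commute)
  from has_integral_shift_real_ivl[OF this, of "- of_int m * T"]
  have "((\<lambda>t. h (t + of_int (- m) * T)) has_integral I) {c..c + T}"
    by (simp add: s_def algebra_simps)
  then show ?thesis
    by (simp only: periodic_int_shift[of h, OF per])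
qed

lemma mem_periodic_points: "p \<in> periodic_points N x T \<longleftrightarrow> (\<exists>j\<in>{1..N}. \<exists>m. p = x j + of_int m * T)"
  by (auto simp: periodic_points_def)

lemma periodic_points_shift:
  "p + of_int m * T \<in> periodic_points N x T \<longleftrightarrow> p \<in> periodic_points N x T"
proof -
  have *: "p + of_int m * T \<in> periodic_points N x T" if p: "p \<in> periodic_points N x T" for p m
  proof -
    obtain j k where jk: "j \<in> {1..N}" "p = x j + of_int k * T"
      using p unfolding Int_iff mem_periodic_points by blast
    then have "p + of_int m * T = x j + of_int (k + m) * T"
      by (simp add: algebra_simps)
    then show ?thesis
      using jk(1) unfolding Int_iff mem_periodic_points by blast
  qed
  show ?thesis
    using *[of p m] *[of "p + of_int m * T" "- m"] by auto
qed

lemma finite_periodic_points: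
  assumes "0 < T"
  shows "finite (periodic_points N x T \<inter> {a..b})"
proof (rule finite_subset)
  show "periodic_points N x T \<inter> {a..b}
      \<subseteq> (\<Union>j\<in>{1..N}. (\<lambda>m. x j + of_int m * T) ` {\<lfloor>(a - x j) / T\<rfloor>..\<lceil>(b - x j) / T\<rceil>})"
  proof
    fix p
    assume p: "p \<in> periodic_points N x T \<inter> {a..b}"
    then obtain j m where jm: "j \<in> {1..N}" "p = x j + of_int m * T"
      unfolding Int_iff mem_periodic_points by blast
    have "(a - x j) / T \<le> of_int m" "of_int m \<le> (b - x j) / T"
      using p jm(2) assms by (auto simp: field_simps)
    then have "m \<in> {\<lfloor>(a - x j) / T\<rfloor>..\<lceil>(b - x j) / T\<rceil>}"
      by (simp add: floor_le_iff le_ceiling_iff)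
    then show "p \<in> (\<Union>j\<in>{1..N}. (\<lambda>m. x j + of_int m * T) ` {\<lfloor>(a - x j) / T\<rfloor>..\<lceil>(b - x j) / T\<rceil>})"
      using jm by blast
  qed
qed simp

text \<open>Bounded intervals contain only finitely many of these points, so there are no limit
  points.\<close>

lemma closed_periodic_points:
  assumes "0 < T"
  shows "closed (periodic_points N x T)"
  unfolding closed_limpt
proof (intro allI impI)
  fix y
  assume "y islimpt periodic_points N x T"
  then have "infinite (periodic_points N x T \<inter> ball y 1)"
    by (simp add: islimpt_eq_infinite_ball)
  moreover have "periodic_points N x T \<inter> ball y 1 \<subseteq> periodic_points N x T \<inter> {y - 1..y + 1}"
    by (auto simp: dist_real_def)
  ultimately have False
    using finite_periodic_points[OF assms] finite_subset by blast
  then show "y \<in> periodic_points N x T" ..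
qed

lemma exists_nonsingular_point: "\<exists>c. c \<notin> periodic_points N x T"
proof -
  have "periodic_points N x T \<subseteq> (\<lambda>(j, m). x j + of_int m * T) ` (UNIV :: (nat \<times> int) set)"
    by (auto simp: periodic_points_def)
  then have "countable (periodic_points N x T)"
    by (rule countable_subset) simp
  then have "periodic_points N x T \<noteq> UNIV"
    using uncountable_UNIV_real by metis
  then show ?thesis
    by blast
qed

section \<open>Quasi-periodic continuation from one period\<close>

lemma compact_in_open_interval:
  fixes c T :: real
  assumes "compact K" "K \<subseteq> {c<..<c + T}" "0 < T"
  obtains \<epsilon> where "0 < \<epsilon>" "\<epsilon> \<le> T" "K \<subseteq> {c + \<epsilon>..c + T - \<epsilon>}"
proof -
  have "open (- K)" "c \<in> - K" "c + T \<in> - K"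
    using assms by (auto simp: compact_imp_closed open_Compl)
  then obtain e\<^sub>1 e\<^sub>2 where e: "0 < e\<^sub>1" "ball c e\<^sub>1 \<subseteq> - K" "0 < e\<^sub>2" "ball (c + T) e\<^sub>2 \<subseteq> - K"
    by (meson open_contains_ball)
  show thesis
  proof
    show "0 < min (min e\<^sub>1 e\<^sub>2) T" "min (min e\<^sub>1 e\<^sub>2) T \<le> T"
      using e assms(3) by auto
    show "K \<subseteq> {c + min (min e\<^sub>1 e\<^sub>2) T..c + T - min (min e\<^sub>1 e\<^sub>2) T}"
    proof
      fix t
      assume t: "t \<in> K"
      then have "t \<notin> ball c e\<^sub>1" "t \<notin> ball (c + T) e\<^sub>2" "c < t" "t < c + T"
        using e assms(2) by auto
      then show "t \<in> {c + min (min e\<^sub>1 e\<^sub>2) T..c + T - min (min e\<^sub>1 e\<^sub>2) T}"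
        by (auto simp: dist_real_def)
    qed
  qed
qed

text \<open>Beyond max |a| |b| nothing of the interval is left; this meets the tail condition of
  \<open>singular_space\<close> on a closed period.\<close>

lemma integrable_tail_interval:
  fixes f :: "real \<Rightarrow> complex"
  shows "f absolutely_integrable_on {t \<in> {a..b}. max \<bar>a\<bar> \<bar>b\<bar> < \<bar>t\<bar>}"
proof -
  have "{t \<in> {a..b}. max \<bar>a\<bar> \<bar>b\<bar> < \<bar>t\<bar>} = {}"
    by auto
  then show ?thesis
    by (simp only: set_integrable_def) simp
qed

text \<open>For T > 0 and \<kappa> \<noteq> 0 this is the only function with multiplier \<kappa>
  that agrees with g on the half-open period [c, c + T).\<close>

definition continuation :: "complex \<Rightarrow> real \<Rightarrow> real \<Rightarrow> (real \<Rightarrow> complex) \<Rightarrow> real \<Rightarrow> complex" where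
  "continuation \<kappa> c T g t =
     \<kappa> powi \<lfloor>(t - c) / T\<rfloor> * g (t - of_int \<lfloor>(t - c) / T\<rfloor> * T)"

text \<open>Near the endpoints of a period the formula for that period and the one for its neighbour
  both give \<open>0\<close>, so each formula is valid on an open neighbourhood of its closed period.\<close>

lemma continuation_eq:
  assumes "0 < T" "\<epsilon> \<le> T" and zero: "\<And>t. t \<notin> {c + \<epsilon>..c + T - \<epsilon>} \<Longrightarrow> g t = 0"
    and t: "t - of_int k * T \<in> {c - \<epsilon><..<c + T + \<epsilon>}"
  shows "continuation \<kappa> c T g t = \<kappa> powi k * g (t - of_int k * T)"
proof -
  define s where "s = t - of_int k * T"
  have sb: "c - \<epsilon> < s" "s < c + T + \<epsilon>"
    using t by (simp_all add: s_def)
  have z: "(t - c) / T = of_int k + (s - c) / T"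
    using assms(1) by (simp add: s_def field_simps)
  consider "s < c" | "c \<le> s" "s < c + T" | "c + T \<le> s"
    by linarith
  then show ?thesis
  proof cases
    case 1
    have "\<lfloor>(t - c) / T\<rfloor> = k - 1"
      unfolding z using 1 sb assms(1,2) by (intro floor_unique) (auto simp: field_simps)
    moreover have "t - of_int (k - 1) * T = s + T"
      by (simp add: s_def algebra_simps)
    moreover have "g (s + T) = 0" "g s = 0"
      using 1 sb by (auto intro!: zero)
    ultimately show ?thesis
      unfolding continuation_def s_def[symmetric] by (simp only: mult_zero_right)
  next
    case 2
    have "\<lfloor>(t - c) / T\<rfloor> = k"
      unfolding z using 2 assms(1) by (intro floor_unique) (auto simp: field_simps)
    then show ?thesis
      by (simp add: continuation_def)
  next
    case 3
    have "\<lfloor>(t - c) / T\<rfloor> = k + 1"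
      unfolding z using 3 sb assms(1,2) by (intro floor_unique) (auto simp: field_simps)
    moreover have "t - of_int (k + 1) * T = s - T"
      by (simp add: s_def algebra_simps)
    moreover have "g (s - T) = 0" "g s = 0"
      using 3 sb by (auto intro!: zero)
    ultimately show ?thesis
      unfolding continuation_def s_def[symmetric] by (simp only: mult_zero_right)
  qed
qed

lemma floor_period:
  fixes t c T :: real
  assumes "0 < T"
  shows "t - of_int \<lfloor>(t - c) / T\<rfloor> * T \<in> {c..<c + T}"
proof -
  define m where "m = \<lfloor>(t - c) / T\<rfloor>"
  have "of_int m \<le> (t - c) / T" "(t - c) / T < of_int m + 1"
    unfolding m_def by linarith+
  then show ?thesis
    using assms unfolding m_def[symmetric] by (simp add: field_simps)
qed

lemma continuation_shift:
  assumes "0 < T" "\<kappa> \<noteq> 0"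
  shows "continuation \<kappa> c T g (t + T) = \<kappa> * continuation \<kappa> c T g t"
proof -
  have "(t + T - c) / T = (t - c) / T + 1"
    using assms(1) by (simp add: field_simps)
  then have "\<lfloor>(t + T - c) / T\<rfloor> = \<lfloor>(t - c) / T\<rfloor> + 1"
    by simp
  then show ?thesis
    using assms(2) by (simp add: continuation_def power_int_add algebra_simps)
qed

section \<open>Singular points modulo the period and their orders\<close>

definition point_index :: "nat \<Rightarrow> (nat \<Rightarrow> real) \<Rightarrow> real \<Rightarrow> real \<Rightarrow> nat" where
  "point_index N x T p = (SOME j. j \<in> {1..N} \<and> (\<exists>m::int. p = x j + of_int m * T))"

locale periodic_configuration =
  fixes N :: nat and x :: "nat \<Rightarrow> real" and T :: real
  assumes T_pos: "0 < T" and distinct: "distinct_mod N x T"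
begin

abbreviation "X \<equiv> periodic_points N x T"
abbreviation "idx \<equiv> point_index N x T"
abbreviation "pts c \<equiv> X \<inter> {c..c + T}"

text \<open>Distinctness modulo T leaves the choice in \<open>point_index\<close> only one
  candidate, so the index is constant along shifts.\<close>

lemma point_index_eq:
  assumes "j \<in> {1..N}"
  shows "idx (x j + of_int m * T) = j"
proof -
  have "\<exists>i. i \<in> {1..N} \<and> (\<exists>k::int. x j + of_int m * T = x i + of_int k * T)"
    using assms by blast
  from someI_ex[OF this] obtain k :: int where i: "idx (x j + of_int m * T) \<in> {1..N}"
    "x j + of_int m * T = x (idx (x j + of_int m * T)) + of_int k * T"
    unfolding point_index_def by blast
  then have "x j - x (idx (x j + of_int m * T)) = of_int (k - m) * T"
    by (simp add: algebra_simps)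
  then show ?thesis
    using distinct assms i(1) unfolding distinct_mod_def by metis
qed

lemma point_index_shift:
  assumes "p \<in> X"
  shows "idx (p + of_int m * T) = idx p"
proof -
  obtain j k where jk: "j \<in> {1..N}" "p = x j + of_int k * T"
    using assms unfolding mem_periodic_points by blast
  have shift: "p + of_int m * T = x j + of_int (k + m) * T"
    by (simp add: jk(2) algebra_simps)
  show ?thesis
    unfolding shift by (simp only: jk(2) point_index_eq[OF jk(1)])
qed

lemma periodic_interior:
  assumes "c \<notin> X"
  shows "pts c \<subseteq> interior {c..c + T}"
proof -
  have "c + T \<notin> X"
    using assms periodic_points_shift[of c 1 T N x] by simp
  then show ?thesis
    using assms by (auto simp: less_le)
qed

text \<open>Each x j has exactly one representative \<rho> j in [c, c + T), and as c is nonsingular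
  neither endpoint is a singular point. Summing over the points of the closed period is thus summing
  over j.\<close>

lemma sum_periodic_points:
  assumes "c \<notin> X"
  shows "(\<Sum>p\<in>pts c. l_order (n (idx p))) = l_total N n"
proof -
  define \<rho> where "\<rho> j = x j + of_int (- \<lfloor>(x j - c) / T\<rfloor>) * T" for j
  have \<rho>: "\<rho> j \<in> {c..<c + T}" for j
    using floor_period[OF T_pos, of "x j" c] by (simp add: \<rho>_def)
  have idx: "idx (\<rho> j) = j" if "j \<in> {1..N}" for j
    unfolding \<rho>_def by (rule point_index_eq[OF that])
  have "bij_betw \<rho> {1..N} (pts c)"
  proof (rule bij_betw_imageI)
    show "inj_on \<rho> {1..N}"
      by (rule inj_on_inverseI[where g = idx]) (rule idx)
    show "\<rho> ` {1..N} = pts c"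
    proof
      show "\<rho> ` {1..N} \<subseteq> pts c"
      proof
        fix p
        assume "p \<in> \<rho> ` {1..N}"
        then obtain j where j: "j \<in> {1..N}" "p = \<rho> j"
          by blast
        then have "p \<in> X"
          unfolding mem_periodic_points \<rho>_def by blast
        then show "p \<in> pts c"
          using \<rho>[of j] j(2) by simp
      qed
      show "pts c \<subseteq> \<rho> ` {1..N}"
      proof
        fix p
        assume p: "p \<in> pts c"
        then obtain j m where jm: "j \<in> {1..N}" "p = x j + of_int m * T"
          unfolding Int_iff mem_periodic_points by blast
        have "c \<le> p" "p < c + T"
          using periodic_interior[OF assms] p by auto
        then have "(x j - c) / T + of_int m \<in> {0..<1}"
          using T_pos jm(2) by (auto simp: field_simps)
        then have "\<lfloor>(x j - c) / T\<rfloor> = - m"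
          by (intro floor_unique) auto
        then have "p = \<rho> j"
          by (simp add: \<rho>_def jm(2))
        then show "p \<in> \<rho> ` {1..N}"
          using jm(1) by blast
      qed
    qed
  qed
  from sum.reindex_bij_betw[OF this, of "\<lambda>p. l_order (n (idx p))"] show ?thesis
    using idx by (simp add: l_total_def)
qed

text \<open>For a small radius the regularized integral over a period is the ordinary integral of
  the following periodic function.\<close>

definition periodic_part ::
  "(real \<Rightarrow> complex) \<Rightarrow> real \<Rightarrow> (real \<Rightarrow> nat) \<Rightarrow> (real \<Rightarrow> nat \<Rightarrow> complex) \<Rightarrow> real \<Rightarrow> complex" where
  "periodic_part f \<delta> M b t = f t - (\<Sum>p\<in>{p \<in> X. \<bar>t - p\<bar> \<le> \<delta>}. polar_cut (b p) (M p) \<delta> (t - p))"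

section \<open>Independence of the period\<close>

lemma periodic_part_shift:
  assumes "\<And>t. f (t + T) = f t" "\<And>p. p \<in> X \<Longrightarrow> M (p + T) = M p \<and> b (p + T) = b p"
  shows "periodic_part f \<delta> M b (t + T) = periodic_part f \<delta> M b t"
proof -
  have X: "p + T \<in> X \<longleftrightarrow> p \<in> X" "p - T \<in> X \<longleftrightarrow> p \<in> X" for p
    using periodic_points_shift[of p 1 T N x] periodic_points_shift[of p "- 1" T N x] by simp_all
  have "(\<Sum>p\<in>{p \<in> X. \<bar>t + T - p\<bar> \<le> \<delta>}. polar_cut (b p) (M p) \<delta> (t + T - p))
      = (\<Sum>p\<in>{p \<in> X. \<bar>t - p\<bar> \<le> \<delta>}. polar_cut (b p) (M p) \<delta> (t - p))"
    by (rule sum.reindex_bij_witness[of _ "\<lambda>p. p + T" "\<lambda>p. p - T"])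
      (use X assms(2)[of "_ - T"] in \<open>auto simp: algebra_simps\<close>)
  then show ?thesis
    by (simp add: periodic_part_def assms(1))
qed

text \<open>No singular point lies within \<delta> of c nor, by periodicity, of c + T. Therefore no
  cut from a neighbouring period reaches into this one, and the periodic function agrees here with
  \<open>regular_part\<close>.\<close>

lemma has_integral_periodic_part:
  assumes reg: "regularizable f {c..c + T} (pts c) \<delta> M b"
    and adm: "admissible_radius {c..c + T} (pts c) \<delta>"
    and far: "\<And>p. p \<in> X \<Longrightarrow> \<delta> < \<bar>p - c\<bar>"
  shows "(periodic_part f \<delta> M b has_integral
      regularized_sum f {c..c + T} (pts c) \<delta> M b) {c..c + T}"
proof -
  let ?P = "pts c"
  have fin: "finite ?P"
    by (rule finite_periodic_points[OF T_pos])
  have "(regular_part f ?P \<delta> M b has_integral regularized_sum f {c..c + T} ?P \<delta> M b) {c..c + T}"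
    using regular_part_integral[OF adm fin reg] set_lebesgue_integral_eq_integral(1)
    by (metis integrable_integral)
  moreover have "regular_part f ?P \<delta> M b t = periodic_part f \<delta> M b t" if t: "t \<in> {c..c + T}" for t
  proof -
    have "p \<in> {c..c + T}" if p: "p \<in> X" "\<bar>t - p\<bar> \<le> \<delta>" for p
    proof -
      have "p - T \<in> X"
        using periodic_points_shift[of p "- 1" T N x] p(1) by simp
      from far[OF this] far[OF p(1)] show ?thesis
        using t p(2) by (auto simp: abs_real_def split: if_splits)
    qed
    then have "{p \<in> X. \<bar>t - p\<bar> \<le> \<delta>} \<subseteq> ?P"
      by blast
    moreover have "polar_cut (b p) (M p) \<delta> (t - p) = 0" if "p \<in> ?P - {p \<in> X. \<bar>t - p\<bar> \<le> \<delta>}" for p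
      using that by (auto simp: polar_cut_def)
    ultimately show ?thesis
      unfolding regular_part_def periodic_part_def
      by (intro arg_cong2[where f = "(-)"] sum.mono_neutral_right fin refl) auto
  qed
  ultimately show ?thesis
    by (metis (no_types, lifting) has_integral_eq)
qed

text \<open>At a radius small enough for both periods, the two values are ordinary integrals of the
  same T-periodic function over one period each. The value I transfers because it is the same for
  every admissible radius.\<close>

lemma has_regularized_integral_any_period:
  assumes per: "\<And>t. f (t + T) = f t" "\<And>p. p \<in> X \<Longrightarrow> M (p + T) = M p \<and> b (p + T) = b p"
    and cont: "continuous_on (- X) f"
    and germ: "\<And>p. p \<in> X \<Longrightarrow> polar_remainder f M b p \<in> O[at p](\<lambda>_. 1)"
    and c: "c \<notin> X" "c' \<notin> X"
    and int: "has_regularized_integral f {c..c + T} (pts c) I"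
  shows "has_regularized_integral f {c'..c' + T} (pts c') I"
proof -
  have away: "\<exists>\<delta>. admissible_radius {c..c + T} (pts c) \<delta> \<and> (\<forall>p\<in>X. \<delta> < \<bar>p - c\<bar>)"
    if "c \<notin> X" for c
  proof -
    have "open (- X)" "c \<in> - X"
      using closed_periodic_points[OF T_pos] that by (simp_all add: open_Compl)
    then obtain e where e: "0 < e" "ball c e \<subseteq> - X"
      by (meson open_contains_ball)
    note c = that
    obtain \<delta> where \<delta>: "admissible_radius {c..c + T} (pts c) \<delta>"
      using exists_admissible_radius[OF finite_periodic_points[OF T_pos] periodic_interior[OF c]] by blast
    then have "0 < \<delta>"
      by (simp add: admissible_radius_def)
    then have "admissible_radius {c..c + T} (pts c) (min \<delta> (e / 2))"
      using e(1) by (intro admissible_radius_mono[OF \<delta>]) auto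
    moreover have "min \<delta> (e / 2) < \<bar>p - c\<bar>" if "p \<in> X" for p
    proof -
      have "p \<notin> ball c e"
        using e(2) that by blast
      then show ?thesis
        using e(1) by (auto simp: dist_real_def)
    qed
    ultimately show ?thesis
      by blast
  qed
  obtain \<delta>\<^sub>1 \<delta>\<^sub>2 where \<delta>1: "admissible_radius {c..c + T} (pts c) \<delta>\<^sub>1" "\<And>p. p \<in> X \<Longrightarrow> \<delta>\<^sub>1 < \<bar>p - c\<bar>"
    and \<delta>2: "admissible_radius {c'..c' + T} (pts c') \<delta>\<^sub>2" "\<And>p. p \<in> X \<Longrightarrow> \<delta>\<^sub>2 < \<bar>p - c'\<bar>"
    using away[OF c(1)] away[OF c(2)] by blast
  define \<delta> where "\<delta> = min \<delta>\<^sub>1 \<delta>\<^sub>2"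
  have \<delta>: "0 < \<delta>" "\<delta> \<le> \<delta>\<^sub>1" "\<delta> \<le> \<delta>\<^sub>2"
    using \<delta>1(1) \<delta>2(1) by (auto simp: \<delta>_def admissible_radius_def)
  let ?R = "\<lambda>c. regularized_sum f {c..c + T} (pts c) \<delta> M b"
  note adm1 = admissible_radius_mono[OF \<delta>1(1) \<delta>(1,2)] and adm2 = admissible_radius_mono[OF \<delta>2(1) \<delta>(1,3)]
  have data: "regularizable f {c..c + T} (pts c) \<delta> M b"
    "has_regularized_integral f {c..c + T} (pts c) (?R c)"
    if adm: "admissible_radius {c..c + T} (pts c) \<delta>" for c
  proof -
    have "continuous_on ({c..c + T} - pts c) f"
      by (rule continuous_on_subset[OF cont]) blast
    note hyps = adm finite_periodic_points[OF T_pos] closed_atLeastAtMost this germ[OF IntD1]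
      integrable_tail_interval
    show "regularizable f {c..c + T} (pts c) \<delta> M b"
      by (rule regularizable_of_germs[OF hyps])
    show "has_regularized_integral f {c..c + T} (pts c) (?R c)"
      by (rule has_regularized_integral_of_germs[OF hyps])
  qed
  have "(periodic_part f \<delta> M b has_integral ?R c) {c..c + T}"
    using \<delta>1(2) \<delta>(2) by (intro has_integral_periodic_part[OF data(1)[OF adm1] adm1]) force
  then have "(periodic_part f \<delta> M b has_integral ?R c) {c'..c' + T}"
    by (rule has_integral_over_period[rotated 2])
      (rule periodic_part_shift, rule per, erule per, rule T_pos)
  moreover have "(periodic_part f \<delta> M b has_integral ?R c') {c'..c' + T}"
    using \<delta>2(2) \<delta>(3) by (intro has_integral_periodic_part[OF data(1)[OF adm2] adm2]) force
  ultimately have "?R c' = ?R c"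
    by (rule has_integral_unique[rotated])
  also have "\<dots> = I"
    using has_regularized_integral_unique[OF data(2)[OF adm1] int] .
  finally show ?thesis
    using data(2)[OF adm2] by simp
qed

lemma periodic_product_germ:
  assumes per: "\<And>t. f (t + T) = f t"
    and germ: "\<And>j. j \<in> {1..N} \<Longrightarrow> (\<lambda>t. f t - polar_part (B j) (n j) (t - x j)) \<in> O[at (x j)](\<lambda>_. 1)"
    and p: "p \<in> X"
  shows "polar_remainder f (\<lambda>p. n (idx p)) (\<lambda>p. B (idx p)) p \<in> O[at p](\<lambda>_. 1)"
proof -
  obtain j m where jm: "j \<in> {1..N}" "p = x j + of_int m * T"
    using p unfolding mem_periodic_points by blast
  have idx: "idx p = j"
    unfolding jm(2) by (rule point_index_eq[OF jm(1)])
  have "(\<lambda>t. f (t - of_int m * T) - polar_part (B j) (n j) (t - of_int m * T - x j))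
      \<in> O[at (x j + of_int m * T)](\<lambda>t. 1)"
    using bigo_at_shift[of "\<lambda>t. f t - polar_part (B j) (n j) (t - x j)" "of_int m * T" "x j" "\<lambda>_. 1"]
      germ[OF jm(1)] by blast
  moreover have "f (t - of_int m * T) = f t" "t - of_int m * T - x j = t - p" for t
    using periodic_int_shift[of f T t "- m", OF per] by (simp_all add: jm(2))
  ultimately show ?thesis
    unfolding polar_remainder_def[abs_def] idx by (simp only: jm(2)[symmetric])
qed

section \<open>The quasi-periodic space as an instance\<close>

lemma F_periodic_iff:
  "\<Psi> \<in> F_periodic N x n T \<kappa> \<longleftrightarrow> smooth_on (- X) \<Psi> \<and> (\<forall>t\<in>X. \<Psi> t = 0)
    \<and> (\<forall>p\<in>X. singular_expansion \<Psi> p (n (idx p))) \<and> (\<forall>t. \<Psi> (t + T) = \<kappa> * \<Psi> t)"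
proof -
  have "(\<forall>j\<in>{1..N}. \<forall>m::int. singular_expansion \<Psi> (x j + of_int m * T) (n j))
      \<longleftrightarrow> (\<forall>p\<in>X. singular_expansion \<Psi> p (n (idx p)))"
  proof (intro iffI ballI allI)
    fix p
    assume *: "\<forall>j\<in>{1..N}. \<forall>m::int. singular_expansion \<Psi> (x j + of_int m * T) (n j)" and "p \<in> X"
    then obtain j m where jm: "j \<in> {1..N}" "p = x j + of_int m * T"
      unfolding mem_periodic_points by blast
    have "idx p = j"
      unfolding jm(2) by (rule point_index_eq[OF jm(1)])
    then show "singular_expansion \<Psi> p (n (idx p))"
      using * jm by simp
  next
    fix j and m :: int
    assume *: "\<forall>p\<in>X. singular_expansion \<Psi> p (n (idx p))" and j: "j \<in> {1..N}"
    have "x j + of_int m * T \<in> X"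
      using j unfolding mem_periodic_points by blast
    from bspec[OF * this] show "singular_expansion \<Psi> (x j + of_int m * T) (n j)"
      unfolding point_index_eq[OF j] .
  qed
  then show ?thesis
    unfolding F_periodic_def by simp
qed

text \<open>The product of \<kappa> and its conjugate is 1: here |\<kappa>| = 1 enters, beyond
  \<kappa> \<noteq> 0.\<close>

lemma product_periodic_fun:
  assumes "\<Psi> \<in> F_periodic N x n T \<kappa>" "\<Phi> \<in> F_periodic N x n T \<kappa>" "cmod \<kappa> = 1"
  shows "\<Psi> (t + T) * cnj (\<Phi> (t + T)) = \<Psi> t * cnj (\<Phi> t)"
proof -
  have "\<kappa> * cnj \<kappa> = 1"
    using assms(3) by (simp add: complex_norm_square[symmetric])
  moreover have "\<Psi> (t + T) * cnj (\<Phi> (t + T)) = (\<kappa> * cnj \<kappa>) * (\<Psi> t * cnj (\<Phi> t))"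
    using assms(1,2) unfolding F_periodic_iff by (simp add: mult_ac)
  ultimately show ?thesis
    by simp
qed

lemma continuous_on_F_periodic: "\<Psi> \<in> F_periodic N x n T \<kappa> \<Longrightarrow> continuous_on (- X) \<Psi>"
  using smooth_on_imp_continuous_on unfolding F_periodic_iff by blast

lemma has_product_periodic_iff:
  assumes \<Psi>: "\<Psi> \<in> F_periodic N x n T \<kappa>" and \<Phi>: "\<Phi> \<in> F_periodic N x n T \<kappa>"
    and \<kappa>: "cmod \<kappa> = 1" and c: "c \<notin> X"
  shows "has_product_periodic N x T \<Psi> \<Phi> I \<longleftrightarrow>
    has_regularized_integral (\<lambda>t. \<Psi> t * cnj (\<Phi> t)) {c..c + T} (pts c) I"
proof -
  let ?f = "\<lambda>t. \<Psi> t * cnj (\<Phi> t)"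
  have xX: "x j \<in> X" if "j \<in> {1..N}" for j
    unfolding mem_periodic_points by (intro bexI[OF _ that] exI[of _ 0]) simp
  have "\<exists>a. has_expansion \<Omega> (x j) (n j) a" if "\<Omega> \<in> F_periodic N x n T \<kappa>" "j \<in> {1..N}" for \<Omega> j
    using that xX[OF that(2)] point_index_eq[OF that(2), of 0]
    unfolding F_periodic_iff singular_expansion_iff by force
  then obtain a b where ab: "\<And>j. j \<in> {1..N} \<Longrightarrow> has_expansion \<Psi> (x j) (n j) (a j)"
    "\<And>j. j \<in> {1..N} \<Longrightarrow> has_expansion \<Phi> (x j) (n j) (b j)"
    using \<Psi> \<Phi> by metis
  \<comment> \<open>Coefficients are chosen at the x j only and carried to all shifts through
    \<open>idx\<close>, so they are periodic by construction.\<close>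
  define B where "B j = product_coeff (n j) (a j) (b j)" for j
  have germ: "polar_remainder ?f (\<lambda>p. n (idx p)) (\<lambda>p. B (idx p)) p \<in> O[at p](\<lambda>_. 1)" if "p \<in> X" for p
  proof (rule periodic_product_germ[OF _ _ that])
    show "?f (t + T) = ?f t" for t
      by (rule product_periodic_fun[OF \<Psi> \<Phi> \<kappa>])
    show "(\<lambda>t. ?f t - polar_part (B j) (n j) (t - x j)) \<in> O[at (x j)](\<lambda>_. 1)" if "j \<in> {1..N}" for j
      unfolding B_def by (rule has_expansion_mult_cnj[OF ab(1)[OF that] ab(2)[OF that]])
  qed
  have per: "n (idx (p + T)) = n (idx p) \<and> B (idx (p + T)) = B (idx p)" if "p \<in> X" for p
    using point_index_shift[OF that, of 1] by simp
  have cont: "continuous_on (- X) ?f"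
    using continuous_on_F_periodic[OF \<Psi>] continuous_on_F_periodic[OF \<Phi>] by (intro continuous_intros)
  show ?thesis
    unfolding has_product_periodic_def
    using c has_regularized_integral_any_period[of ?f "\<lambda>p. n (idx p)" "\<lambda>p. B (idx p)" c _ I,
        OF product_periodic_fun[OF \<Psi> \<Phi> \<kappa>] per cont germ c]
    by blast
qed

text \<open>The margin \<epsilon> between K and the ends of the period makes the formula with shift
  m valid on the open set W m, which contains the m-th closed period. Every point thus has a
  neighbourhood on which the continuation is a shifted multiple of g, and smoothness and expansions
  carry over.\<close>

lemma extend_periodic:
  assumes c: "c \<notin> X" and \<kappa>: "\<kappa> \<noteq> 0" and K: "compact K" "K \<subseteq> {c<..<c + T}"
    and g: "smooth_on (- pts c) g" and zero: "\<And>t. t \<notin> K \<Longrightarrow> g t = 0"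
    and sing: "\<And>p. p \<in> pts c \<Longrightarrow> g p = 0 \<and> singular_expansion g p (n (idx p))"
  shows "\<exists>\<Psi>\<in>F_periodic N x n T \<kappa>. \<forall>t\<in>{c..c + T}. \<Psi> t = g t"
proof -
  obtain \<epsilon> where \<epsilon>: "0 < \<epsilon>" "\<epsilon> \<le> T" "K \<subseteq> {c + \<epsilon>..c + T - \<epsilon>}"
    using compact_in_open_interval[OF K T_pos] by blast
  let ?\<Psi> = "continuation \<kappa> c T g"
  have eq: "?\<Psi> t = \<kappa> powi k * g (t - of_int k * T)"
    if "t - of_int k * T \<in> {c - \<epsilon><..<c + T + \<epsilon>}" for t k
    by (rule continuation_eq[OF T_pos \<epsilon>(2) _ that]) (use zero \<epsilon>(3) in blast)
  define k where "k t = \<lfloor>(t - c) / T\<rfloor>" for t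
  have k: "t - of_int (k t) * T \<in> {c..<c + T}" for t
    unfolding k_def by (rule floor_period[OF T_pos])
  have k': "t - of_int (k t) * T \<in> {c - \<epsilon><..<c + T + \<epsilon>}" for t
    using k[of t] \<epsilon>(1) by simp
  define W where "W m = {t. t - of_int m * T \<in> {c - \<epsilon><..<c + T + \<epsilon>}}" for m :: int
  have W: "W m = {c - \<epsilon> + of_int m * T<..<c + T + \<epsilon> + of_int m * T}" for m
    by (auto simp: W_def)
  have X_shift: "t - of_int m * T \<in> X \<longleftrightarrow> t \<in> X" for t m
    using periodic_points_shift[of t "- m" T N x] by simp
  let ?P = "pts c"
  have open_P: "open (- ?P)"
    by (intro open_Compl finite_imp_closed finite_periodic_points T_pos)
  have "?\<Psi> \<in> F_periodic N x n T \<kappa>"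
    unfolding F_periodic_iff
  proof (intro conjI ballI allI)
    show "?\<Psi> (t + T) = \<kappa> * ?\<Psi> t" for t
      by (rule continuation_shift[OF T_pos \<kappa>])
    show "?\<Psi> t = 0" if "t \<in> X" for t
    proof -
      have "t - of_int (k t) * T \<in> ?P"
        using X_shift that k[of t] by auto
      then show ?thesis
        using eq[OF k'] sing by simp
    qed
    show "smooth_on (- X) ?\<Psi>"
    proof (rule smooth_on_local)
      fix t
      assume t: "t \<in> - X"
      let ?m = "k t"
      let ?U = "{s. 1 * s + (- of_int ?m * T) \<in> - ?P}"
      have "open ((\<lambda>s. 1 * s + (- of_int ?m * T)) -` (- ?P))"
        by (intro open_vimage open_P continuous_intros)
      then have U: "open ?U"
        by (simp only: vimage_def)
      have "smooth_on ?U (\<lambda>s. g (1 * s + (- of_int ?m * T)))"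
        by (intro smooth_on_affine open_P g) simp
      then have "smooth_on (?U \<inter> W ?m) (\<lambda>s. g (1 * s + (- of_int ?m * T)))"
        by (rule smooth_on_subset) blast
      moreover have UW: "open (?U \<inter> W ?m)"
        by (intro open_Int U) (simp only: W open_greaterThanLessThan)
      ultimately have "smooth_on (?U \<inter> W ?m) (\<lambda>s. \<kappa> powi ?m * g (1 * s + (- of_int ?m * T)))"
        by (intro smooth_on_mult smooth_on_const)
      then have "smooth_on (?U \<inter> W ?m) ?\<Psi>"
      proof (rule smooth_on_cong[OF UW])
        fix s
        assume "s \<in> ?U \<inter> W ?m"
        then show "\<kappa> powi ?m * g (1 * s + (- of_int ?m * T)) = ?\<Psi> s"
          using eq[of s ?m] by (simp add: W_def)
      qed
      moreover have "t \<in> ?U"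
        using t X_shift[of t ?m] by auto
      moreover have "t \<in> W ?m"
        using k'[of t] by (simp add: W_def)
      ultimately show "\<exists>U. t \<in> U \<and> smooth_on U ?\<Psi>"
        by (intro exI[of _ "?U \<inter> W ?m"] conjI IntI)
    qed
    show "singular_expansion ?\<Psi> p (n (idx p))" if p: "p \<in> X" for p
    proof -
      let ?m = "k p" and ?q = "p - of_int (k p) * T"
      have q: "?q \<in> ?P"
        using X_shift p k[of p] by auto
      have "idx (?q + of_int ?m * T) = idx ?q"
        using q by (intro point_index_shift) blast
      then have idx: "idx ?q = idx p"
        by simp
      obtain a where "has_expansion g ?q (n (idx p)) a"
        using sing[OF q] unfolding idx singular_expansion_iff by blast
      from has_expansion_scale[OF has_expansion_shift[OF this, of "of_int ?m * T"], of "\<kappa> powi ?m"]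
      have "has_expansion (cscale (\<kappa> powi ?m) (\<lambda>t. g (t - of_int ?m * T))) p (n (idx p)) (\<lambda>j. \<kappa> powi ?m * a j)"
        by simp
      moreover have "eventually (\<lambda>t. cscale (\<kappa> powi ?m) (\<lambda>t. g (t - of_int ?m * T)) t = ?\<Psi> t) (at p)"
      proof -
        have "eventually (\<lambda>t. t \<in> W ?m) (at p)"
          using k'[of p] by (intro eventually_at_in_open') (simp_all add: W W_def[symmetric])
        then show ?thesis
          by eventually_elim (simp add: cscale_def eq W_def)
      qed
      ultimately have "has_expansion ?\<Psi> p (n (idx p)) (\<lambda>j. \<kappa> powi ?m * a j)"
        by (rule has_expansion_transform)
      then show ?thesis
        unfolding singular_expansion_iff by blast
    qed
  qed
  \<comment> \<open>Shift 0 covers the closed period, including c + T, where the floor in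
    \<open>continuation\<close> is already 1.\<close>
  moreover have "?\<Psi> t = g t" if "t \<in> {c..c + T}" for t
    using eq[of t 0] that \<epsilon>(1) by simp
  ultimately show ?thesis
    by blast
qed

text \<open>Vanishing on the open period leaves only its left end c, which is nonsingular, so
  continuity from the right gives 0 there. Quasi-periodicity carries this to every t.\<close>

lemma determined_periodic:
  assumes \<Psi>: "\<Psi> \<in> F_periodic N x n T \<kappa>" and c: "c \<notin> X" and \<kappa>: "\<kappa> \<noteq> 0"
    and zero: "\<And>t. t \<in> {c<..<c + T} - X \<Longrightarrow> \<Psi> t = 0"
  shows "\<Psi> = 0"
proof
  fix t
  have zero': "\<Psi> s = 0" if "s \<in> {c<..<c + T}" for s
    using zero[of s] that \<Psi> unfolding F_periodic_iff by (cases "s \<in> X") auto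
  have "open (- X)"
    using closed_periodic_points[OF T_pos] by (simp add: open_Compl)
  then have "isCont \<Psi> c"
    using continuous_on_F_periodic[OF \<Psi>] c by (simp add: continuous_on_eq_continuous_at)
  then have "(\<Psi> \<longlongrightarrow> \<Psi> c) (at_right c)"
    by (simp add: isCont_def filterlim_at_split)
  moreover have "(\<Psi> \<longlongrightarrow> 0) (at_right c)"
  proof (rule tendsto_eventually)
    have "eventually (\<lambda>s. s \<in> {c<..<c + T}) (at_right c)"
      using T_pos by (intro eventually_at_right_real) simp
    then show "eventually (\<lambda>s. \<Psi> s = 0) (at_right c)"
      by eventually_elim (rule zero')
  qed
  ultimately have "\<Psi> c = 0"
    using tendsto_unique[of "at_right c"] by force
  define s where "s = t - of_int \<lfloor>(t - c) / T\<rfloor> * T"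
  have "s \<in> {c..<c + T}"
    unfolding s_def by (rule floor_period[OF T_pos])
  then have "\<Psi> s = 0"
    using zero'[of s] \<open>\<Psi> c = 0\<close> by (cases "s = c") auto
  moreover have "\<Psi> (s + of_int \<lfloor>(t - c) / T\<rfloor> * T) = \<kappa> powi \<lfloor>(t - c) / T\<rfloor> * \<Psi> s"
    using \<Psi> \<kappa> unfolding F_periodic_iff by (intro quasi_periodic_int_shift) auto
  ultimately show "\<Psi> t = 0 t"
    by (simp add: s_def)
qed

lemma singular_space_periodic:
  assumes c: "c \<notin> X" and \<kappa>: "cmod \<kappa> = 1"
  shows "singular_space {c..c + T} (pts c) (\<lambda>p. n (idx p))
    (F_periodic N x n T \<kappa>) (has_product_periodic N x T) (product_periodic N x T)"
proof
  let ?S = "{c..c + T}" and ?P = "pts c" and ?F = "F_periodic N x n T \<kappa>"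
  have \<kappa>0: "\<kappa> \<noteq> 0"
    using \<kappa> by auto
  have open_X: "open (- X)"
    using closed_periodic_points[OF T_pos] by (simp add: open_Compl)
  have diff: "interior ?S - ?P = {c<..<c + T} - X"
    by auto
  show "closed ?S" "interior ?S \<noteq> {}"
    using T_pos by simp_all
  show "finite ?P"
    by (rule finite_periodic_points[OF T_pos])
  show "?P \<subseteq> interior ?S"
    by (rule periodic_interior[OF c])
  show "cfun.subspace ?F"
  proof (rule cfun.subspaceI)
    show "0 \<in> ?F"
      unfolding F_periodic_iff by (simp add: smooth_on_zero singular_expansion_zero)
    show "\<Psi> + \<Phi> \<in> ?F" if "\<Psi> \<in> ?F" "\<Phi> \<in> ?F" for \<Psi> \<Phi>
      using that open_X unfolding F_periodic_iff
      by (simp add: smooth_on_plus singular_expansion_plus distrib_left)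
    show "cscale a \<Psi> \<in> ?F" if "\<Psi> \<in> ?F" for a \<Psi>
      using that open_X unfolding F_periodic_iff
      by (simp add: smooth_on_cscale singular_expansion_cscale) (simp add: cscale_def)
  qed
  show "smooth_on (interior ?S - ?P) \<Psi>" if "\<Psi> \<in> ?F" for \<Psi>
    using that unfolding F_periodic_iff diff by (auto intro: smooth_on_subset)
  show "continuous_on (?S - ?P) \<Psi>" if "\<Psi> \<in> ?F" for \<Psi>
    by (rule continuous_on_subset[OF continuous_on_F_periodic[OF that]]) blast
  show "\<exists>R. (\<lambda>t. \<Psi> t * cnj (\<Phi> t)) absolutely_integrable_on {t \<in> ?S. R < \<bar>t\<bar>}" for \<Psi> \<Phi>
    using integrable_tail_interval by blast
  show "singular_expansion \<Psi> p (n (idx p))" if "\<Psi> \<in> ?F" "p \<in> ?P" for \<Psi> p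
    using that unfolding F_periodic_iff by blast
  show "\<Psi> = 0" if "\<Psi> \<in> ?F" "\<And>t. t \<in> interior ?S - ?P \<Longrightarrow> \<Psi> t = 0" for \<Psi>
    by (rule determined_periodic[OF that(1) c \<kappa>0]) (rule that(2), simp only: diff)
  show "\<exists>\<Psi>\<in>?F. \<forall>t\<in>?S. \<Psi> t = g t"
    if "compact K" "K \<subseteq> interior ?S" "smooth_on (- ?P) g" "\<And>t. t \<notin> K \<Longrightarrow> g t = 0"
      "\<And>p. p \<in> ?P \<Longrightarrow> g p = 0 \<and> singular_expansion g p (n (idx p))" for K g
    using extend_periodic[OF c \<kappa>0 that(1) _ that(3,4,5)] that(2) by simp
  show "has_product_periodic N x T \<Psi> \<Phi> I \<longleftrightarrow>
      has_regularized_integral (\<lambda>t. \<Psi> t * cnj (\<Phi> t)) ?S ?P I" if "\<Psi> \<in> ?F" "\<Phi> \<in> ?F" for \<Psi> \<Phi> I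
    by (rule has_product_periodic_iff[OF that \<kappa> c])
qed (simp add: product_periodic_def)

end

theorem mainTheorem1:
  fixes N :: nat and x :: "nat \<Rightarrow> real" and n :: "nat \<Rightarrow> nat"
  shows
    "(inj_on x {1..N} \<longrightarrow>
        (\<forall>\<Psi>\<^sub>1\<in>F_decreasing N x n. \<forall>\<Psi>\<^sub>2\<in>F_decreasing N x n.
           \<exists>!I. has_product_decreasing N x \<Psi>\<^sub>1 \<Psi>\<^sub>2 I)
        \<and> indefinite_inner_product (F_decreasing N x n) (product_decreasing N x)
        \<and> (0 < l_total N n \<longrightarrow>
             takes_both_signs (F_decreasing N x n) (product_decreasing N x))
        \<and> has_negative_squares (F_decreasing N x n) (product_decreasing N x) (l_total N n))
     \<and>
     (\<forall>(T::real) (\<kappa>::complex). 0 < T \<and> distinct_mod N x T \<and> cmod \<kappa> = 1 \<longrightarrow>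
        (\<forall>\<Psi>\<^sub>1\<in>F_periodic N x n T \<kappa>. \<forall>\<Psi>\<^sub>2\<in>F_periodic N x n T \<kappa>.
           \<exists>!I. has_product_periodic N x T \<Psi>\<^sub>1 \<Psi>\<^sub>2 I)
        \<and> indefinite_inner_product (F_periodic N x n T \<kappa>) (product_periodic N x T)
        \<and> (0 < l_total N n \<longrightarrow>
             takes_both_signs (F_periodic N x n T \<kappa>) (product_periodic N x T))
        \<and> has_negative_squares (F_periodic N x n T \<kappa>) (product_periodic N x T) (l_total N n))"
proof (intro conjI[of "_ \<longrightarrow> _"] impI allI, goal_cases)
  case 1
  have "l_total N n = (\<Sum>p\<in>decreasing_points N x. l_order (n (inv_into {1..N} x p)))"
    using 1 by (simp add: l_total_def decreasing_points_def sum.reindex)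
  then show ?case
    by (rule singular_space.negative_squares[OF singular_space_decreasing[OF 1]])
next
  case (2 T \<kappa>)
  then have conf: "periodic_configuration N x T" and \<kappa>: "cmod \<kappa> = 1"
    by (simp_all add: periodic_configuration_def)
  \<comment> \<open>Any nonsingular base point will do, since
    \<open>has_product_periodic_iff\<close> shows the product to be the same for every period; one
    exists because the singular set is countable.\<close>
  obtain c where c: "c \<notin> periodic_points N x T"
    using exists_nonsingular_point by blast
  show ?case
    by (rule singular_space.negative_squares[OF
          periodic_configuration.singular_space_periodic[OF conf c \<kappa>]])
      (rule periodic_configuration.sum_periodic_points[OF conf c, symmetric])
qed

end
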